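(* Let $\Delta$ be a $(d-1)$-dimensional simplicial complex, $F$ a face of $\Delta$ of positive dimension, and $\Gamma$ the stellar subdivision of $\Delta$ at $F$. If the link of $F$ in $\Delta$ is Cohen–Macaulay of dimension $d-1-|F|$, then $h'_i(\Gamma)-h_i(\Gamma)=h'_i(\Delta)-h_i(\Delta)$ for all $i$.
   Context: Fix an infinite field $k$; Cohen–Macaulay is over $k$. $h_i$ is the $h$-vector and $h'_i(\Delta)=\dim_k(k[\Delta]/(\Theta))_i$ for a generic l.s.o.p. $\Theta$. The stellar subdivision at $F$ removes all faces containing $F$ and adds a new vertex $\rho$ with all sets $\tau\cup\{\rho\}$ where $\tau\not\supseteq F$ and $\tau\cup F\in\Delta$. *)

theory Defs
  imports Complex_Main "HOL-Library.Poly_Mapping" "HOL-Library.FuncSet"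
begin

section \<open>Simplicial complexes\<close>

definition simplicial_complex :: "'v set set \<Rightarrow> bool" where
  "simplicial_complex \<Delta> \<longleftrightarrow>
     finite \<Delta> \<and> {} \<in> \<Delta> \<and> (\<forall>G\<in>\<Delta>. finite G) \<and> (\<forall>G\<in>\<Delta>. \<forall>H. H \<subseteq> G \<longrightarrow> H \<in> \<Delta>)"

abbreviation vertices :: "'v set set \<Rightarrow> 'v set" where
  "vertices \<Delta> \<equiv> \<Union>\<Delta>"

definition sc_rank :: "'v set set \<Rightarrow> nat" where
  "sc_rank \<Delta> = Max (card ` \<Delta>)"

definition sc_dim :: "'v set set \<Rightarrow> int" where
  "sc_dim \<Delta> = int (sc_rank \<Delta>) - 1"

definition face_dim :: "'v set \<Rightarrow> int" where
  "face_dim G = int (card G) - 1"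

definition link :: "'v set set \<Rightarrow> 'v set \<Rightarrow> 'v set set" where
  "link \<Delta> F = {G. G \<inter> F = {} \<and> G \<union> F \<in> \<Delta>}"

definition stellar :: "'v set set \<Rightarrow> 'v set \<Rightarrow> 'v \<Rightarrow> 'v set set" where
  "stellar \<Delta> F \<rho> =
     {G \<in> \<Delta>. \<not> F \<subseteq> G} \<union> {\<tau> \<union> {\<rho>} | \<tau>. \<not> F \<subseteq> \<tau> \<and> \<tau> \<union> F \<in> \<Delta>}"

text \<open>\<open>f_num \<Delta> j\<close> is the number of faces with \<open>j\<close> vertices, usually written $f_{j-1}$.\<close>

definition f_num :: "'v set set \<Rightarrow> nat \<Rightarrow> nat" where
  "f_num \<Delta> j = card {G \<in> \<Delta>. card G = j}"

text \<open>
  The usual formula with \<open>d = sc_rank \<Delta>\<close>. It also gives \<open>0\<close> for \<open>i > d\<close>: the binomial coefficient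
  vanishes for \<open>j \<le> d\<close>, and \<open>f_num \<Delta> j = 0\<close> for \<open>j > d\<close>, so truncated subtraction does no harm.
\<close>

definition h_num :: "'v set set \<Rightarrow> nat \<Rightarrow> int" where
  "h_num \<Delta> i =
     (\<Sum>j\<le>i. (-1) ^ (i - j) * int ((sc_rank \<Delta> - j) choose (i - j)) * int (f_num \<Delta> j))"


section \<open>Polynomials and quotient vector spaces\<close>

type_synonym ('v, 'k) mpoly = "('v \<Rightarrow>\<^sub>0 nat) \<Rightarrow>\<^sub>0 'k"

definition indet :: "'v \<Rightarrow> ('v, 'k::field) mpoly" where
  "indet v = Poly_Mapping.single (Poly_Mapping.single v 1) 1"

definition scalar_mult :: "'k::field \<Rightarrow> ('v, 'k) mpoly \<Rightarrow> ('v, 'k) mpoly" where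
  "scalar_mult c p = Poly_Mapping.single 0 c * p"

definition mon_degree :: "('v \<Rightarrow>\<^sub>0 nat) \<Rightarrow> nat" where
  "mon_degree m = (\<Sum>v\<in>Poly_Mapping.keys m. Poly_Mapping.lookup m v)"

definition homogeneous_part :: "nat \<Rightarrow> ('v, 'k::field) mpoly set" where
  "homogeneous_part i = {p. \<forall>m\<in>Poly_Mapping.keys p. mon_degree m = i}"

definition poly_eval :: "('v \<Rightarrow> 'k) \<Rightarrow> ('v, 'k::field) mpoly \<Rightarrow> 'k" where
  "poly_eval a p =
     (\<Sum>m\<in>Poly_Mapping.keys p. Poly_Mapping.lookup p m *
        (\<Prod>v\<in>Poly_Mapping.keys m. a v ^ Poly_Mapping.lookup m v))"

definition ideal_gen :: "('v, 'k::field) mpoly set \<Rightarrow> ('v, 'k) mpoly set" where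
  "ideal_gen S = module.span (*) S"

text \<open>
  \<open>basis_mod V W B\<close>: the classes of the elements of the finite set \<open>B\<close> form a basis of the quotient
  space \<open>V / W\<close>, for linear subspaces \<open>W \<subseteq> V\<close>.
\<close>

definition basis_mod ::
    "('v, 'k::field) mpoly set \<Rightarrow> ('v, 'k) mpoly set \<Rightarrow> ('v, 'k) mpoly set \<Rightarrow> bool" where
  "basis_mod V W B \<longleftrightarrow>
     finite B \<and> B \<subseteq> V \<and>
     (\<forall>p\<in>V. \<exists>c. p - (\<Sum>b\<in>B. scalar_mult (c b) b) \<in> W) \<and>
     (\<forall>c. (\<Sum>b\<in>B. scalar_mult (c b) b) \<in> W \<longrightarrow> (\<forall>b\<in>B. c b = 0))"

definition quot_finite_dim ::
    "('v, 'k::field) mpoly set \<Rightarrow> ('v, 'k) mpoly set \<Rightarrow> bool" where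
  "quot_finite_dim V W \<longleftrightarrow> (\<exists>B. basis_mod V W B)"

definition quot_dim :: "('v, 'k::field) mpoly set \<Rightarrow> ('v, 'k) mpoly set \<Rightarrow> nat" where
  "quot_dim V W = (THE n. \<exists>B. basis_mod V W B \<and> card B = n)"


section \<open>The face ring\<close>

text \<open>
  There is one indeterminate for every element of the type \<open>'v\<close>. If \<open>v\<close> is not a vertex of \<open>\<Delta>\<close>,
  then \<open>{v}\<close> is a nonface, so \<open>indet v\<close> lies in the ideal generated by \<open>nonface_monomials \<Delta>\<close>;
  the quotient by this ideal is therefore the face ring of \<open>\<Delta>\<close> on its vertex set.
\<close>

definition nonface_monomials :: "'v set set \<Rightarrow> ('v, 'k::field) mpoly set" where
  "nonface_monomials \<Delta> = {\<Prod>v\<in>G. indet v | G. finite G \<and> G \<notin> \<Delta>}"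

text \<open>
  A sequence of linear forms is given by its coefficients: the \<open>j\<close>-th form is
  $\sum_v a(j, v) x_v$, the sum being over the vertices of \<open>\<Delta>\<close>.
\<close>

definition linear_form :: "'v set set \<Rightarrow> (nat \<times> 'v \<Rightarrow> 'k) \<Rightarrow> nat \<Rightarrow> ('v, 'k::field) mpoly" where
  "linear_form \<Delta> a j = (\<Sum>v\<in>vertices \<Delta>. scalar_mult (a (j, v)) (indet v))"

text \<open>
  The preimage in the polynomial ring of the ideal of the face ring generated by the first \<open>n\<close>
  linear forms.
\<close>

definition face_ideal ::
    "'v set set \<Rightarrow> (nat \<times> 'v \<Rightarrow> 'k) \<Rightarrow> nat \<Rightarrow> ('v, 'k::field) mpoly set" where
  "face_ideal \<Delta> a n = ideal_gen (nonface_monomials \<Delta> \<union> linear_form \<Delta> a ` {..<n})"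

text \<open>The Krull dimension of the face ring is \<open>sc_rank \<Delta>\<close>.\<close>

definition is_lsop :: "'v set set \<Rightarrow> (nat \<times> 'v \<Rightarrow> 'k::field) \<Rightarrow> bool" where
  "is_lsop \<Delta> a \<longleftrightarrow> quot_finite_dim UNIV (face_ideal \<Delta> a (sc_rank \<Delta>))"

definition regular_sequence :: "'v set set \<Rightarrow> (nat \<times> 'v \<Rightarrow> 'k::field) \<Rightarrow> nat \<Rightarrow> bool" where
  "regular_sequence \<Delta> a n \<longleftrightarrow>
     (\<forall>j<n. \<forall>p. linear_form \<Delta> a j * p \<in> face_ideal \<Delta> a j \<longrightarrow> p \<in> face_ideal \<Delta> a j) \<and>
     face_ideal \<Delta> a n \<noteq> UNIV"

text \<open>
  The face ring is Cohen--Macaulay if some (equivalently, every) system of parameters is a regular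
  sequence; over an infinite field linear systems of parameters exist and suffice.
\<close>

definition cohen_macaulay :: "'k::field itself \<Rightarrow> 'v set set \<Rightarrow> bool" where
  "cohen_macaulay _ \<Delta> \<longleftrightarrow>
     (\<exists>a :: nat \<times> 'v \<Rightarrow> 'k. is_lsop \<Delta> a \<and> regular_sequence \<Delta> a (sc_rank \<Delta>))"

text \<open>
  The degree \<open>i\<close> part of the face ring modulo the linear forms; the ideal is homogeneous, so its
  degree \<open>i\<close> part is its intersection with the forms of degree \<open>i\<close>.
\<close>

definition reduction_dim :: "'v set set \<Rightarrow> (nat \<times> 'v \<Rightarrow> 'k::field) \<Rightarrow> nat \<Rightarrow> nat" where
  "reduction_dim \<Delta> a i =
     quot_dim (homogeneous_part i) (face_ideal \<Delta> a (sc_rank \<Delta>) \<inter> homogeneous_part i)"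


section \<open>Generic linear systems of parameters\<close>

definition zariski_open :: "'i set \<Rightarrow> ('i \<Rightarrow> 'k::field) set \<Rightarrow> bool" where
  "zariski_open I U \<longleftrightarrow>
     (\<exists>S :: ('i, 'k) mpoly set.
        (\<forall>p\<in>S. \<forall>m\<in>Poly_Mapping.keys p. Poly_Mapping.keys m \<subseteq> I) \<and>
        U = {a \<in> I \<rightarrow>\<^sub>E UNIV. \<exists>p\<in>S. poly_eval a p \<noteq> 0})"

definition holds_generically :: "'i set \<Rightarrow> (('i \<Rightarrow> 'k::field) \<Rightarrow> bool) \<Rightarrow> bool" where
  "holds_generically I P \<longleftrightarrow> (\<exists>U. zariski_open I U \<and> U \<noteq> {} \<and> (\<forall>a\<in>U. P a))"

text \<open>
  Over an infinite field nonempty Zariski open sets intersect and the generic value exists, so the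
  description below determines a unique number.
\<close>

definition h_prime :: "'k::field itself \<Rightarrow> 'v set set \<Rightarrow> nat \<Rightarrow> nat" where
  "h_prime _ \<Delta> i =
     (THE n. holds_generically ({..<sc_rank \<Delta>} \<times> vertices \<Delta>)
        (\<lambda>a :: nat \<times> 'v \<Rightarrow> 'k. is_lsop \<Delta> a \<and> reduction_dim \<Delta> a i = n))"

end

theory Submission
  imports Defs "HOL-Computational_Algebra.Polynomial"
    "HOL-Computational_Algebra.Formal_Power_Series"
begin

text \<open>
  Write \<open>S\<close> for the polynomial ring and \<open>I(K)\<close> for the nonface ideal of \<open>K\<close>. Let \<open>D\<close> be the
  deletion of \<open>F\<close> from \<open>\<Delta>\<close>, \<open>T = F * lk F\<close> the star of \<open>F\<close> in \<open>\<Delta>\<close> and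
  \<open>T' = \<rho> * \<partial>F * lk F\<close> the star of \<open>\<rho>\<close> in \<open>\<Gamma>\<close>. Then \<open>\<Delta> = D \<union> T\<close> and \<open>\<Gamma> = D \<union> T'\<close>, and
  both intersections are \<open>\<partial>F * lk F\<close>. Take one generic sequence \<open>\<theta>\<close> of \<open>d\<close> linear forms for both
  complexes. The Mayer--Vietoris sequence
  \<open>0 \<rightarrow> S/I(\<Delta>) \<rightarrow> S/I(D) \<oplus> S/I(T) \<rightarrow> S/I(D \<inter> T) \<rightarrow> 0\<close> fails to stay exact modulo \<open>\<theta>\<close> by the
  cokernel of \<open>Tor\<^sub>1(S/I(D)) \<rightarrow> Tor\<^sub>1(S/I(D \<inter> T))\<close> as soon as \<open>\<theta>\<close> is regular on \<open>S/I(T)\<close>, and this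
  cokernel does not involve \<open>T\<close>. Hence \<open>h'(\<Gamma>) - h'(\<Delta>) = h(T') - h(T)\<close>, which is
  \<open>h(\<Gamma>) - h(\<Delta>)\<close> by inclusion and exclusion of faces.

  Regularity is obtained from Hilbert functions: \<open>\<theta>\<close> is regular on \<open>S/I(K)\<close> as soon as the
  Hilbert function of the reduction is at most the \<open>h\<close>-vector of \<open>K\<close>. By semicontinuity it suffices
  to check this bound at one \<open>\<theta>\<close>, built for \<open>T\<close> and for \<open>T'\<close> from a regular
  sequence for the link.
\<close>

text \<open>Since \<Delta> itself is not assumed Cohen-Macaulay, h'(\<Delta>) cannot be computed;
  only the difference can, because the uncontrolled cokernel is the same for \<Delta> and \<Gamma>:
  it depends on D, on the common intersection and on \<theta>. Regularity is not visibly an open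
  condition on \<theta>, whereas an upper bound on the dimension of one graded piece is: that
  dimension is governed by the rank of a matrix whose entries are polynomial in the coefficients. A
  bound in all degrees at once is still generic, because generically everything vanishes above
  degree d. Write r = |F|. On T the test sequence kills the variables of F and leaves a quotient of
  the reduction of the link, matching h(T) = h(lk F). On T' it kills \<rho> and identifies all
  variables of F with a single x; the nonface F then gives x^r = 0, and the powers of x account for
  the factor 1 + X + ... + X^(r-1) in h(T'). Both h' and h thus change by h(lk F) (X + ... +
  X^(r-1)).\<close>

abbreviation keys :: "('a \<Rightarrow>\<^sub>0 'b::zero) \<Rightarrow> 'a set" where
  "keys \<equiv> Poly_Mapping.keys"

abbreviation lookup :: "('a \<Rightarrow>\<^sub>0 'b::zero) \<Rightarrow> 'a \<Rightarrow> 'b" where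
  "lookup \<equiv> Poly_Mapping.lookup"

abbreviation single :: "'a \<Rightarrow> 'b \<Rightarrow> 'a \<Rightarrow>\<^sub>0 'b::zero" where
  "single \<equiv> Poly_Mapping.single"

section \<open>Independent families of coordinate vectors\<close>

text \<open>Row independence of a matrix with explicit entries: the entries will later be polynomial
  functions of parameters, which an abstract notion of independent vectors would hide.\<close>

definition indep_family :: "'a set \<Rightarrow> 'x set \<Rightarrow> ('a \<Rightarrow> 'x \<Rightarrow> 'k::field) \<Rightarrow> bool" where
  "indep_family A X u \<longleftrightarrow>
     (\<forall>c. (\<forall>x\<in>X. (\<Sum>s\<in>A. c s * u s x) = 0) \<longrightarrow> (\<forall>s\<in>A. c s = 0))"

lemma indep_family_eliminate:
  fixes u :: "'a \<Rightarrow> 'x \<Rightarrow> 'k::field"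
  assumes fin: "finite A" and s: "s \<notin> A" and e: "e \<in> X" "u s e \<noteq> 0"
  shows "indep_family (insert s A) X u \<longleftrightarrow>
         indep_family A (X - {e}) (\<lambda>t x. u s e * u t x - u t e * u s x)"
    (is "_ \<longleftrightarrow> indep_family A _ ?w")
proof
  assume L: "indep_family (insert s A) X u"
  show "indep_family A (X - {e}) ?w"
    unfolding indep_family_def
  proof (intro allI impI)
    fix c :: "'a \<Rightarrow> 'k"
    assume c: "\<forall>x\<in>X - {e}. (\<Sum>t\<in>A. c t * ?w t x) = 0"
    \<comment> \<open>Expanding the eliminated rows: each row t keeps c t times the pivot, and the
      multiples of row s collect into one coefficient.\<close>
    define c' where "c' = (\<lambda>t. if t = s then - (\<Sum>t\<in>A. c t * u t e) else u s e * c t)"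
    have c'_sum: "(\<Sum>t\<in>A. c' t * u t x) = u s e * (\<Sum>t\<in>A. c t * u t x)" for x
      unfolding sum_distrib_left by (rule sum.cong) (use s in \<open>auto simp: c'_def\<close>)
    have "(\<Sum>t\<in>insert s A. c' t * u t x) = (\<Sum>t\<in>A. c t * ?w t x)" for x
    proof -
      have "(\<Sum>t\<in>A. c t * ?w t x) =
          u s e * (\<Sum>t\<in>A. c t * u t x) - (\<Sum>t\<in>A. c t * u t e) * u s x"
        unfolding sum_distrib_left sum_distrib_right sum_subtractf[symmetric]
        by (rule sum.cong) (auto simp: algebra_simps)
      then show ?thesis
        using fin s by (simp add: c'_sum) (simp add: c'_def algebra_simps)
    qed
    moreover have "(\<Sum>t\<in>A. c t * ?w t e) = 0"
      by (simp add: algebra_simps)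
    ultimately have "\<forall>x\<in>X. (\<Sum>t\<in>insert s A. c' t * u t x) = 0"
      using c by (metis Diff_iff empty_iff insert_iff)
    then have "\<forall>t\<in>insert s A. c' t = 0"
      using L unfolding indep_family_def by blast
    then show "\<forall>t\<in>A. c t = 0"
      using s e unfolding c'_def by (metis insert_iff mult_eq_0_iff)
  qed
next
  assume R: "indep_family A (X - {e}) ?w"
  show "indep_family (insert s A) X u"
    unfolding indep_family_def
  proof (intro allI impI)
    fix c :: "'a \<Rightarrow> 'k"
    assume c: "\<forall>x\<in>X. (\<Sum>t\<in>insert s A. c t * u t x) = 0"
    have eq: "(\<Sum>t\<in>A. c t * u t x) = - (c s * u s x)" if "x \<in> X" for x
      using c that fin s by (simp add: eq_neg_iff_add_eq_0 add.commute)
    have "(\<Sum>t\<in>A. c t * ?w t x) = 0" if "x \<in> X" for x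
    proof -
      have "(\<Sum>t\<in>A. c t * ?w t x) =
          u s e * (\<Sum>t\<in>A. c t * u t x) - (\<Sum>t\<in>A. c t * u t e) * u s x"
        unfolding sum_distrib_left sum_distrib_right sum_subtractf[symmetric]
        by (rule sum.cong) (auto simp: algebra_simps)
      then show ?thesis
        using eq[OF that] eq[OF e(1)] by (simp add: algebra_simps)
    qed
    then have A0: "\<forall>t\<in>A. c t = 0"
      using R unfolding indep_family_def by blast
    then have "c s * u s e = 0"
      using eq[OF e(1)] by simp
    then show "\<forall>t\<in>insert s A. c t = 0"
      using A0 e by simp
  qed
qed

lemma indep_family_nonzero:
  fixes u :: "'a \<Rightarrow> 'x \<Rightarrow> 'c::field"
  assumes "finite A" "s \<in> A" "indep_family A X u"
  obtains e where "e \<in> X" "u s e \<noteq> 0"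
proof (rule ccontr)
  assume "\<not> thesis"
  then have z: "\<forall>x\<in>X. u s x = 0"
    using that by blast
  let ?c = "\<lambda>t. if t = s then 1 else (0::'c)"
  have "\<forall>x\<in>X. (\<Sum>t\<in>A. ?c t * u t x) = 0"
    using z by (intro ballI sum.neutral) auto
  then have "\<forall>t\<in>A. ?c t = 0"
    using assms(3)[unfolded indep_family_def, THEN spec[of _ ?c]] by blast
  then show False
    using assms(2) by auto
qed

lemma indep_family_card_le:
  assumes "finite A" "finite X" "indep_family A X u"
  shows "card A \<le> card X"
  using assms
proof (induction A arbitrary: X u rule: finite_induct)
  case (insert s A)
  obtain e where e: "e \<in> X" "u s e \<noteq> 0"
    using indep_family_nonzero[where u = u, OF _ _ insert.prems(2), of s] insert.hyps(1) by blast
  have "indep_family A (X - {e}) (\<lambda>t x. u s e * u t x - u t e * u s x)"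
    using indep_family_eliminate[where u = u, OF insert.hyps(1,2) e] insert.prems(2) by blast
  then have "card A \<le> card (X - {e})"
    using insert.IH insert.prems(1) by blast
  then show ?case
    using e insert by (metis Suc_le_mono card.remove card_insert_disjoint)
qed simp


section \<open>Polynomial functions and genericity\<close>

text \<open>Polynomials as functions: sums and products of entries, all that elimination uses, stay
  inside without any handling of coefficients. \<open>polyfun_imp_poly_eval\<close> and
  \<open>poly_eval_polyfun\<close> translate to and from formal polynomials.\<close>

inductive polyfun :: "'i set \<Rightarrow> (('i \<Rightarrow> 'k::field) \<Rightarrow> 'k) \<Rightarrow> bool" for I where
  polyfun_const: "polyfun I (\<lambda>_. c)"
| polyfun_var: "i \<in> I \<Longrightarrow> polyfun I (\<lambda>a. a i)"
| polyfun_add: "polyfun I f \<Longrightarrow> polyfun I g \<Longrightarrow> polyfun I (\<lambda>a. f a + g a)"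
| polyfun_mult: "polyfun I f \<Longrightarrow> polyfun I g \<Longrightarrow> polyfun I (\<lambda>a. f a * g a)"

lemma polyfun_diff:
  assumes "polyfun I f" "polyfun I g"
  shows "polyfun I (\<lambda>a. f a - g a)"
proof -
  have "polyfun I (\<lambda>a. f a + (- 1) * g a)"
    by (intro polyfun_add polyfun_mult polyfun_const assms)
  then show ?thesis
    by simp
qed

lemma polyfun_sum: "(\<And>x. x \<in> X \<Longrightarrow> polyfun I (f x)) \<Longrightarrow> polyfun I (\<lambda>a. \<Sum>x\<in>X. f x a)"
  by (induction X rule: infinite_finite_induct) (auto intro: polyfun_const polyfun_add)

lemma polyfun_prod: "(\<And>x. x \<in> X \<Longrightarrow> polyfun I (f x)) \<Longrightarrow> polyfun I (\<lambda>a. \<Prod>x\<in>X. f x a)"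
  by (induction X rule: infinite_finite_induct) (auto intro: polyfun_const polyfun_mult)

lemma polyfun_power: "polyfun I f \<Longrightarrow> polyfun I (\<lambda>a. f a ^ n)"
  by (induction n) (auto intro: polyfun_const polyfun_mult)

lemma polyfun_mono: "polyfun I f \<Longrightarrow> I \<subseteq> J \<Longrightarrow> polyfun J f"
  by (induction rule: polyfun.induct) (auto intro: polyfun.intros)

lemma polyfun_cong:
  assumes "polyfun I f" "\<And>i. i \<in> I \<Longrightarrow> a i = b i"
  shows "f a = f b"
  using assms by (induction rule: polyfun.induct) auto

lemma polyfun_on_line:
  assumes "polyfun I f"
  shows "\<exists>q. \<forall>t. f (\<lambda>i. a i + t * (b i - a i)) = poly q t"
  using assms
proof (induction rule: polyfun.induct)
  case (polyfun_const c)
  show ?case by (intro exI[of _ "[:c:]"]) simp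
next
  case (polyfun_var i)
  show ?case by (intro exI[of _ "[:a i, b i - a i:]"]) simp
next
  case (polyfun_add f g)
  then show ?case by (metis poly_add)
next
  case (polyfun_mult f g)
  then show ?case by (metis poly_mult)
qed

text \<open>On the line that passes through a at t = 0 and b at t = 1 both functions become nonzero
  polynomials in t, whose product has only finitely many roots; an infinite field offers another t.
  This is the irreducibility of affine space.\<close>

lemma polyfun_nonzero_common:
  fixes f g :: "('i \<Rightarrow> 'k::field) \<Rightarrow> 'k"
  assumes inf: "infinite (UNIV :: 'k set)" and "polyfun I f" "polyfun J g"
    and "f a \<noteq> 0" "g b \<noteq> 0"
  shows "\<exists>c. f c \<noteq> 0 \<and> g c \<noteq> 0"
proof -
  obtain p where p: "\<And>t. f (\<lambda>i. a i + t * (b i - a i)) = poly p t"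
    using polyfun_on_line[OF assms(2)] by blast
  obtain q where q: "\<And>t. g (\<lambda>i. a i + t * (b i - a i)) = poly q t"
    using polyfun_on_line[OF assms(3)] by blast
  have "p \<noteq> 0" "q \<noteq> 0"
    using p[of 0] q[of 1] assms(4,5) by auto
  then have "finite {t. poly (p * q) t = 0}"
    by (intro poly_roots_finite) simp
  then obtain t where "poly (p * q) t \<noteq> 0"
    using inf by (metis (mono_tags, lifting) UNIV_eq_I mem_Collect_eq)
  then show ?thesis
    using p q by (metis mult_eq_0_iff poly_mult)
qed

text \<open>One nonvanishing polynomial stands in for a Zariski open set. The points are arbitrary
  functions, not extensional ones on I, so that statements about different index sets can be moved
  to a common larger one by \<open>generic_mono\<close>.\<close>

definition generic :: "'i set \<Rightarrow> (('i \<Rightarrow> 'k::field) \<Rightarrow> bool) \<Rightarrow> bool" where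
  "generic I P \<longleftrightarrow> (\<exists>f. polyfun I f \<and> (\<exists>a. f a \<noteq> 0) \<and> (\<forall>a. f a \<noteq> 0 \<longrightarrow> P a))"

lemma genericI: "polyfun I f \<Longrightarrow> f a \<noteq> 0 \<Longrightarrow> (\<And>a. f a \<noteq> 0 \<Longrightarrow> P a) \<Longrightarrow> generic I P"
  unfolding generic_def by blast

lemma generic_exists: "generic I P \<Longrightarrow> \<exists>a. P a"
  unfolding generic_def by blast

lemma generic_mono:
  assumes "generic I P" "I \<subseteq> J" "\<And>a. P a \<Longrightarrow> Q a"
  shows "generic J Q"
proof -
  obtain f a where f: "polyfun I f" "f a \<noteq> 0" "\<And>a. f a \<noteq> 0 \<Longrightarrow> P a"
    using assms(1) unfolding generic_def by blast
  then show ?thesis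
    using assms(2,3) by (intro genericI[of J f a]) (auto intro: polyfun_mono)
qed

lemma generic_conj:
  fixes P Q :: "('i \<Rightarrow> 'k::field) \<Rightarrow> bool"
  assumes inf: "infinite (UNIV :: 'k set)" and "generic I P" "generic I Q"
  shows "generic I (\<lambda>a. P a \<and> Q a)"
proof -
  obtain f a where f: "polyfun I f" "f a \<noteq> 0" "\<And>a. f a \<noteq> 0 \<Longrightarrow> P a"
    using assms(2) unfolding generic_def by blast
  obtain g b where g: "polyfun I g" "g b \<noteq> 0" "\<And>a. g a \<noteq> 0 \<Longrightarrow> Q a"
    using assms(3) unfolding generic_def by blast
  obtain c where "f c \<noteq> 0 \<and> g c \<noteq> 0"
    using polyfun_nonzero_common[where f = f and g = g, OF inf f(1) g(1) f(2) g(2)] by (rule exE)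
  then show ?thesis
    by (intro genericI[OF polyfun_mult[OF f(1) g(1)], of c]) (use f g in auto)
qed

lemma generic_all_le:
  fixes P :: "nat \<Rightarrow> ('i \<Rightarrow> 'k::field) \<Rightarrow> bool"
  assumes inf: "infinite (UNIV :: 'k set)" and P: "\<And>i. generic I (P i)"
  shows "generic I (\<lambda>a. \<forall>i\<le>n. P i a)"
proof (induction n)
  case 0
  show ?case using P[of 0] by simp
next
  case (Suc n)
  show ?case
    by (rule generic_mono[OF generic_conj[OF inf Suc P[of "Suc n"]]]) (auto simp: le_Suc_eq)
qed

text \<open>
  Gaussian elimination with polynomial entries: the product of the successive pivots is the
  polynomial that does not vanish at the given point.
\<close>

lemma indep_family_open:
  fixes u :: "('i \<Rightarrow> 'k::field) \<Rightarrow> 'a \<Rightarrow> 'x \<Rightarrow> 'k"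
  assumes "finite A" and "\<And>s x. s \<in> A \<Longrightarrow> x \<in> X \<Longrightarrow> polyfun I (\<lambda>a. u a s x)"
    and "indep_family A X (u a0)"
  shows "\<exists>f. polyfun I f \<and> f a0 \<noteq> 0 \<and> (\<forall>a. f a \<noteq> 0 \<longrightarrow> indep_family A X (u a))"
  using assms
proof (induction A arbitrary: X u rule: finite_induct)
  case empty
  show ?case
    by (intro exI[of _ "\<lambda>_. 1"]) (auto simp: indep_family_def intro: polyfun_const)
next
  case (insert s A)
  obtain e where e: "e \<in> X" "u a0 s e \<noteq> 0"
    using indep_family_nonzero[where u = "u a0", OF _ _ insert.prems(2), of s] insert.hyps(1)
    by blast
  define w where "w = (\<lambda>a t x. u a s e * u a t x - u a t e * u a s x)"
  have elim: "indep_family (insert s A) X (u a) \<longleftrightarrow> indep_family A (X - {e}) (w a)"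
    if "u a s e \<noteq> 0" for a
    using indep_family_eliminate[where u = "u a", OF insert.hyps(1,2) e(1) that] by (simp add: w_def)
  have "\<exists>f. polyfun I f \<and> f a0 \<noteq> 0 \<and> (\<forall>a. f a \<noteq> 0 \<longrightarrow> indep_family A (X - {e}) (w a))"
  proof (rule insert.IH)
    show "polyfun I (\<lambda>a. w a t x)" if "t \<in> A" "x \<in> X - {e}" for t x
      unfolding w_def using that e insert.prems(1) by (intro polyfun_diff polyfun_mult) auto
    show "indep_family A (X - {e}) (w a0)"
      using elim[OF e(2)] insert.prems(2) by simp
  qed
  then obtain f where f: "polyfun I f" "f a0 \<noteq> 0"
      "\<And>a. f a \<noteq> 0 \<Longrightarrow> indep_family A (X - {e}) (w a)"
    by blast
  show ?case
  proof (intro exI[of _ "\<lambda>a. u a s e * f a"] conjI allI impI)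
    show "polyfun I (\<lambda>a. u a s e * f a)"
      using e f insert.prems(1) by (intro polyfun_mult) auto
  qed (use e f elim in auto)
qed

section \<open>Evaluation of polynomials and Zariski open sets\<close>

lemma lookup_scalar_mult [simp]:
  "lookup (scalar_mult c p) m = c * lookup p m"
  unfolding scalar_mult_def mult_map_scale_conv_mult[symmetric] by (simp add: map.rep_eq when_def)

lemma poly_mapping_sum_single:
  fixes p :: "'a \<Rightarrow>\<^sub>0 'b::comm_monoid_add"
  assumes "finite K" "keys p \<subseteq> K"
  shows "p = (\<Sum>m\<in>K. single m (lookup p m))"
proof (rule poly_mapping_eqI)
  fix x
  show "lookup p x =
      lookup (\<Sum>m\<in>K. single m (lookup p m)) x"
    using assms
    by (auto simp: lookup_sum lookup_single when_def sum.delta in_keys_iff subset_iff)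
qed

definition mon_eval :: "('v \<Rightarrow> 'k::field) \<Rightarrow> ('v \<Rightarrow>\<^sub>0 nat) \<Rightarrow> 'k" where
  "mon_eval a m = (\<Prod>v\<in>keys m. a v ^ lookup m v)"

lemma mon_eval_superset:
  assumes "finite K" "keys m \<subseteq> K"
  shows "mon_eval a m = (\<Prod>v\<in>K. a v ^ lookup m v)"
  unfolding mon_eval_def using assms
  by (intro prod.mono_neutral_left) (auto simp: in_keys_iff)

lemma keys_add_nat:
  "keys (m + n :: 'v \<Rightarrow>\<^sub>0 nat) = keys m \<union> keys n"
  by (auto simp: in_keys_iff lookup_add)

lemma mon_eval_add: "mon_eval a (m + n) = mon_eval a m * mon_eval a n"
proof -
  let ?K = "keys m \<union> keys n"
  show ?thesis
    by (simp add: mon_eval_superset[of ?K] keys_add_nat lookup_add power_add prod.distrib)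
qed

lemma poly_eval_superset:
  assumes "finite K" "keys p \<subseteq> K"
  shows "poly_eval a p = (\<Sum>m\<in>K. lookup p m * mon_eval a m)"
  unfolding poly_eval_def mon_eval_def[symmetric] using assms
  by (intro sum.mono_neutral_left) (auto simp: in_keys_iff)

lemma poly_eval_add: "poly_eval a (p + q) = poly_eval a p + poly_eval a q"
proof -
  let ?K = "keys p \<union> keys q"
  have "keys (p + q) \<subseteq> ?K"
    by (rule keys_add)
  then show ?thesis
    by (simp add: poly_eval_superset[of ?K] lookup_add ring_distribs sum.distrib)
qed

lemma poly_eval_sum: "poly_eval a (sum f X) = (\<Sum>x\<in>X. poly_eval a (f x))"
  by (induction X rule: infinite_finite_induct) (auto simp: poly_eval_add poly_eval_def[of a 0])

lemma poly_eval_single: "poly_eval a (single m c) = c * mon_eval a m"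
  by (simp add: poly_eval_superset[of "{m}"])

lemma poly_eval_mult: "poly_eval a (p * q) = poly_eval a p * poly_eval a q"
proof -
  let ?s = "\<lambda>p m. single m (lookup p m)"
  have "p * q = (\<Sum>m\<in>keys p. ?s p m) * (\<Sum>n\<in>keys q. ?s q n)"
    using poly_mapping_sum_single[of "keys p" p]
      poly_mapping_sum_single[of "keys q" q] by simp
  then have "p * q = (\<Sum>m\<in>keys p. \<Sum>n\<in>keys q.
      single (m + n) (lookup p m * lookup q n))"
    by (simp add: sum_product mult_single)
  then have "poly_eval a (p * q) = (\<Sum>m\<in>keys p. \<Sum>n\<in>keys q.
      (lookup p m * mon_eval a m) * (lookup q n * mon_eval a n))"
    by (simp add: poly_eval_sum poly_eval_single mon_eval_add mult_ac)
  also have "\<dots> = poly_eval a p * poly_eval a q"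
    by (simp only: poly_eval_superset[OF finite_keys order.refl] sum_product)
  finally show ?thesis .
qed

lemma polyfun_imp_poly_eval:
  assumes "polyfun I f"
  shows "\<exists>p. (\<forall>m\<in>keys p. keys m \<subseteq> I) \<and> (\<forall>a. f a = poly_eval a p)"
  using assms
proof (induction rule: polyfun.induct)
  case (polyfun_const c)
  show ?case
    by (intro exI[of _ "single 0 c"])
      (auto simp: poly_eval_single mon_eval_def split: if_splits)
next
  case (polyfun_var i)
  then show ?case
    by (intro exI[of _ "indet i"]) (auto simp: indet_def poly_eval_single mon_eval_def)
next
  case (polyfun_add f g)
  then obtain p q where
    "\<forall>m\<in>keys p. keys m \<subseteq> I" "\<forall>a. f a = poly_eval a p"
    "\<forall>m\<in>keys q. keys m \<subseteq> I" "\<forall>a. g a = poly_eval a q"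
    by blast
  then show ?case
    using keys_add[of p q] by (intro exI[of _ "p + q"]) (fastforce simp: poly_eval_add)
next
  case (polyfun_mult f g)
  then obtain p q where pq:
    "\<forall>m\<in>keys p. keys m \<subseteq> I" "\<forall>a. f a = poly_eval a p"
    "\<forall>m\<in>keys q. keys m \<subseteq> I" "\<forall>a. g a = poly_eval a q"
    by blast
  have "keys m \<subseteq> I" if "m \<in> keys (p * q)" for m
  proof -
    obtain x y where "x \<in> keys p" "y \<in> keys q" "m = x + y"
      using \<open>m \<in> keys (p * q)\<close> keys_mult[of p q] by blast
    then show ?thesis
      using pq by (auto simp: keys_add_nat)
  qed
  then show ?case
    using pq by (intro exI[of _ "p * q"]) (auto simp: poly_eval_mult)
qed

lemma poly_eval_polyfun:
  assumes "\<forall>m\<in>keys p. keys m \<subseteq> I"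
  shows "polyfun I (\<lambda>a. poly_eval a p)"
  unfolding poly_eval_def using assms
  by (intro polyfun_sum polyfun_mult polyfun_prod polyfun_power polyfun_const polyfun_var) auto

lemma generic_imp_holds_generically:
  assumes "generic I P"
  shows "holds_generically I P"
proof -
  obtain f a where f: "polyfun I f" "f a \<noteq> 0" "\<And>a. f a \<noteq> 0 \<Longrightarrow> P a"
    using assms unfolding generic_def by blast
  obtain p where p: "\<forall>m\<in>keys p. keys m \<subseteq> I" "\<And>a. f a = poly_eval a p"
    using polyfun_imp_poly_eval[OF f(1)] by blast
  define U where "U = {a \<in> I \<rightarrow>\<^sub>E UNIV. \<exists>q\<in>{p}. poly_eval a q \<noteq> 0}"
  have "zariski_open I U"
    unfolding zariski_open_def U_def using p(1) by (intro exI[of _ "{p}"]) auto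
  \<comment> \<open>Points of a Zariski open set are extensional on I; f reads only the coordinates
    in I, so its value survives the restriction.\<close>
  moreover have "f (restrict a I) \<noteq> 0"
    using f(2) polyfun_cong[OF f(1), of "restrict a I" a] by simp
  then have "restrict a I \<in> U"
    unfolding U_def using p(2) by auto
  moreover have "\<forall>a\<in>U. P a"
    unfolding U_def using f(3) p(2) by auto
  ultimately show ?thesis
    unfolding holds_generically_def by blast
qed

text \<open>Nonempty open sets meet. This is what makes the description in \<open>h_prime\<close>
  unique.\<close>

lemma generic_meets_holds_generically:
  fixes P Q :: "('i \<Rightarrow> 'k::field) \<Rightarrow> bool"
  assumes inf: "infinite (UNIV :: 'k set)" and P: "generic I P" and Q: "holds_generically I Q"
  shows "\<exists>a. P a \<and> Q a"
proof -
  obtain f a where f: "polyfun I f" "f a \<noteq> 0" "\<And>a. f a \<noteq> 0 \<Longrightarrow> P a"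
    using P unfolding generic_def by blast
  obtain S b p where S: "\<forall>p\<in>S. \<forall>m\<in>keys p. keys m \<subseteq> I"
      "\<forall>a\<in>{a \<in> I \<rightarrow>\<^sub>E UNIV. \<exists>p\<in>S. poly_eval a p \<noteq> 0}. Q a" "p \<in> S" "poly_eval b p \<noteq> 0"
  proof -
    obtain U where U: "zariski_open I U" "U \<noteq> {}" "\<forall>a\<in>U. Q a"
      using Q unfolding holds_generically_def by blast
    obtain S where S: "\<forall>p\<in>S. \<forall>m\<in>keys p. keys m \<subseteq> I"
        "U = {a \<in> I \<rightarrow>\<^sub>E UNIV. \<exists>p\<in>S. poly_eval a p \<noteq> 0}"
      using U(1) unfolding zariski_open_def by (elim exE conjE)
    obtain b p where "p \<in> S" "poly_eval b p \<noteq> 0"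
      using U(2) unfolding S(2) by auto
    then show ?thesis
      using that[OF S(1) U(3)[unfolded S(2)]] by simp
  qed
  have p: "polyfun I (\<lambda>a. poly_eval a p)"
    using S by (intro poly_eval_polyfun) auto
  obtain c where c: "f c \<noteq> 0 \<and> poly_eval c p \<noteq> 0"
    using polyfun_nonzero_common[where f = f and g = "\<lambda>a. poly_eval a p", OF inf f(1) p f(2) S(4)]
    by (rule exE)
  let ?c = "restrict c I"
  have "f ?c \<noteq> 0" "poly_eval ?c p \<noteq> 0"
    using c polyfun_cong[OF f(1), of ?c c] polyfun_cong[OF p, of ?c c] by auto
  moreover have "?c \<in> I \<rightarrow>\<^sub>E UNIV"
    by simp
  ultimately have "P ?c \<and> Q ?c"
    using f(3) S(2,3) by blast
  then show ?thesis
    by (rule exI[of _ ?c])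
qed

section \<open>Dimensions of quotient spaces\<close>

interpretation mv: vector_space "scalar_mult :: 'k::field \<Rightarrow> ('v, 'k) mpoly \<Rightarrow> ('v, 'k) mpoly"
  by unfold_locales
    (auto simp: scalar_mult_def distrib_left distrib_right single_add mult_single mult.assoc[symmetric])

interpretation mr: module "(*) :: ('v, 'k::field) mpoly \<Rightarrow> ('v, 'k) mpoly \<Rightarrow> ('v, 'k) mpoly"
  by unfold_locales (auto simp: algebra_simps)

text \<open>As a simplification rule this would be reversed associativity of the polynomial ring.\<close>

declare mr.scale_scale [simp del]

lemma ideal_imp_linear_subspace: "mr.subspace X \<Longrightarrow> mv.subspace X"
  unfolding mr.subspace_def mv.subspace_def by (auto simp: scalar_mult_def)

definition indep_mod :: "('v, 'k::field) mpoly set \<Rightarrow> ('v, 'k) mpoly set \<Rightarrow> bool" where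
  "indep_mod W B \<longleftrightarrow> (\<forall>c. (\<Sum>b\<in>B. scalar_mult (c b) b) \<in> W \<longrightarrow> (\<forall>b\<in>B. c b = 0))"

lemma indep_modD:
  "indep_mod W B \<Longrightarrow> (\<Sum>b\<in>B. scalar_mult (c b) b) \<in> W \<Longrightarrow> b \<in> B \<Longrightarrow> c b = 0"
  unfolding indep_mod_def by simp

lemma span_mod_iff:
  assumes "mv.subspace W" "finite B"
  shows "(\<exists>c. p - (\<Sum>b\<in>B. scalar_mult (c b) b) \<in> W) \<longleftrightarrow> p \<in> mv.span (B \<union> W)"
proof
  assume "\<exists>c. p - (\<Sum>b\<in>B. scalar_mult (c b) b) \<in> W"
  then obtain c where c: "p - (\<Sum>b\<in>B. scalar_mult (c b) b) \<in> W" ..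
  have "(\<Sum>b\<in>B. scalar_mult (c b) b) \<in> mv.span (B \<union> W)"
    by (intro mv.span_sum mv.span_scale mv.span_base) auto
  moreover have "p - (\<Sum>b\<in>B. scalar_mult (c b) b) \<in> mv.span (B \<union> W)"
    using c by (intro mv.span_base) auto
  ultimately show "p \<in> mv.span (B \<union> W)"
    using mv.span_add by fastforce
next
  assume "p \<in> mv.span (B \<union> W)"
  then obtain x y where xy: "p = x + y" "x \<in> mv.span B" "y \<in> W"
    using mv.span_Un[of B W] mv.span_eq_iff[THEN iffD2, OF assms(1)] by auto
  then obtain c where "x = (\<Sum>b\<in>B. scalar_mult (c b) b)"
    using mv.span_finite[OF assms(2)] by auto
  then show "\<exists>c. p - (\<Sum>b\<in>B. scalar_mult (c b) b) \<in> W"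
    using xy by (intro exI[of _ c]) simp
qed

lemma basis_mod_iff:
  assumes "mv.subspace W"
  shows "basis_mod V W B \<longleftrightarrow> finite B \<and> B \<subseteq> V \<and> V \<subseteq> mv.span (B \<union> W) \<and> indep_mod W B"
  unfolding basis_mod_def indep_mod_def using span_mod_iff[OF assms] by blast

text \<open>The coefficients of the \<open>u t\<close> on the spanning set, modulo W, form a matrix;
  a dependence of its rows would put a combination of the \<open>u t\<close> into W. The family is
  indexed because in \<open>hilb_semicontinuous\<close> its members move with a parameter while the
  index set stays fixed.\<close>

lemma indep_mod_card_le:
  fixes u :: "'t \<Rightarrow> ('v, 'k::field) mpoly"
  assumes W: "mv.subspace W" and B: "finite B" "V \<subseteq> mv.span (B \<union> W)"
    and T: "finite T" "\<And>t. t \<in> T \<Longrightarrow> u t \<in> V"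
    and ind: "\<And>c. (\<Sum>t\<in>T. scalar_mult (c t) (u t)) \<in> W \<Longrightarrow> \<forall>t\<in>T. c t = 0"
  shows "card T \<le> card B"
proof -
  have "\<forall>t\<in>T. \<exists>c. u t - (\<Sum>b\<in>B. scalar_mult (c b) b) \<in> W"
    using B T(2) span_mod_iff[OF W B(1)] by blast
  then obtain A where A: "\<And>t. t \<in> T \<Longrightarrow> u t - (\<Sum>b\<in>B. scalar_mult (A t b) b) \<in> W"
    by metis
  have "indep_family T B A"
    unfolding indep_family_def
  proof (intro allI impI)
    fix c
    assume c: "\<forall>b\<in>B. (\<Sum>t\<in>T. c t * A t b) = 0"
    have "(\<Sum>t\<in>T. scalar_mult (c t) (u t - (\<Sum>b\<in>B. scalar_mult (A t b) b))) \<in> W"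
      using A by (intro mv.subspace_sum[OF W] mv.subspace_scale[OF W]) auto
    also have "(\<Sum>t\<in>T. scalar_mult (c t) (u t - (\<Sum>b\<in>B. scalar_mult (A t b) b))) =
        (\<Sum>t\<in>T. scalar_mult (c t) (u t)) - (\<Sum>t\<in>T. \<Sum>b\<in>B. scalar_mult (c t * A t b) b)"
      by (simp add: mv.scale_right_diff_distrib mv.scale_sum_right sum_subtractf)
    also have "(\<Sum>t\<in>T. \<Sum>b\<in>B. scalar_mult (c t * A t b) b) = 
        (\<Sum>b\<in>B. scalar_mult (\<Sum>t\<in>T. c t * A t b) b)"
      by (subst sum.swap) (simp add: mv.scale_sum_left)
    also have "\<dots> = 0"
      using c by (intro sum.neutral) simp
    finally show "\<forall>t\<in>T. c t = 0"
      by (intro ind) simp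
  qed
  then show ?thesis
    using indep_family_card_le T(1) B(1) by blast
qed

lemma indep_mod_set_card_le:
  assumes "mv.subspace W" "finite B" "V \<subseteq> mv.span (B \<union> W)" "finite C" "C \<subseteq> V" "indep_mod W C"
  shows "card C \<le> card B"
  using assms(5,6) unfolding indep_mod_def
  by (intro indep_mod_card_le[OF assms(1-4), of "\<lambda>x. x"]) auto

lemma quot_dim_eq:
  assumes W: "mv.subspace W" and B: "basis_mod V W B"
  shows "quot_dim V W = card B"
  unfolding quot_dim_def
proof (rule the_equality)
  show "\<exists>B'. basis_mod V W B' \<and> card B' = card B"
    using B by blast
  show "n = card B" if n: "\<exists>B. basis_mod V W B \<and> card B = n" for n
  proof -
    obtain C where C: "basis_mod V W C" "card C = n"
      using n by blast
    then show ?thesis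
      using B indep_mod_set_card_le[OF W, of B V C] indep_mod_set_card_le[OF W, of C V B]
      unfolding basis_mod_iff[OF W] by force
  qed
qed

lemma spanning_contains_basis_mod:
  assumes W: "mv.subspace W" and "finite B" "B \<subseteq> V" "V \<subseteq> mv.span (B \<union> W)"
  shows "\<exists>B'\<subseteq>B. basis_mod V W B'"
  using assms(2-)
proof (induction B rule: finite_psubset_induct)
  case (psubset B)
  show ?case
  proof (cases "indep_mod W B")
    case True
    then show ?thesis
      using psubset W by (auto simp: basis_mod_iff)
  next
    case False
    then obtain c b where c: "(\<Sum>b\<in>B. scalar_mult (c b) b) \<in> W" "b \<in> B" "c b \<noteq> 0"
      unfolding indep_mod_def by blast
    define x where "x = (\<Sum>b'\<in>B - {b}. scalar_mult (c b') b')"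
    have "scalar_mult (c b) b + x \<in> W"
      using c psubset.hyps(1) by (simp add: x_def sum.remove[of B b])
    then have "scalar_mult (inverse (c b)) (scalar_mult (c b) b + x) \<in> W"
      using W by (simp add: mv.subspace_scale)
    then have "b + scalar_mult (inverse (c b)) x \<in> mv.span (B - {b} \<union> W)"
      using c by (intro mv.span_base) (simp add: mv.scale_right_distrib)
    moreover have "scalar_mult (inverse (c b)) x \<in> mv.span (B - {b} \<union> W)"
      unfolding x_def by (intro mv.span_scale mv.span_sum mv.span_base) auto
    ultimately have "b \<in> mv.span (B - {b} \<union> W)"
      using mv.span_diff by fastforce
    then have "mv.span (insert b (B - {b} \<union> W)) = mv.span (B - {b} \<union> W)"
      by (rule mv.span_redundant)
    moreover have "insert b (B - {b} \<union> W) = B \<union> W"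
      using c(2) by auto
    ultimately have "V \<subseteq> mv.span (B - {b} \<union> W)"
      using psubset.prems(2) by simp
    then have "\<exists>B'\<subseteq>B - {b}. basis_mod V W B'"
      using psubset.IH[of "B - {b}"] c(2) psubset.prems by auto
    then show ?thesis
      by blast
  qed
qed

lemma quot_dim_le_card:
  assumes "mv.subspace W" "finite B" "B \<subseteq> V" "V \<subseteq> mv.span (B \<union> W)"
  shows "quot_finite_dim V W" "quot_dim V W \<le> card B"
  using spanning_contains_basis_mod[OF assms] quot_dim_eq[OF assms(1)] assms(2)
  by (auto simp: quot_finite_dim_def intro: card_mono)

lemma indep_mod_insert:
  assumes W: "mv.subspace W" and "finite B" "indep_mod W B" "x \<notin> mv.span (B \<union> W)"
  shows "x \<notin> B" "indep_mod W (insert x B)"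
proof -
  show x: "x \<notin> B"
    using assms(4) mv.span_base[of x "B \<union> W"] by auto
  show "indep_mod W (insert x B)"
    unfolding indep_mod_def
  proof (intro allI impI)
    fix c
    assume "(\<Sum>b\<in>insert x B. scalar_mult (c b) b) \<in> W"
    then have cW: "scalar_mult (c x) x + (\<Sum>b\<in>B. scalar_mult (c b) b) \<in> W"
      using x assms(2) by simp
    have "c x = 0"
    proof (rule ccontr)
      assume cx: "c x \<noteq> 0"
      have "scalar_mult (c x) x + (\<Sum>b\<in>B. scalar_mult (c b) b) \<in> mv.span (B \<union> W)"
        using cW by (intro mv.span_base) auto
      moreover have "(\<Sum>b\<in>B. scalar_mult (c b) b) \<in> mv.span (B \<union> W)"
        by (intro mv.span_scale mv.span_sum mv.span_base) auto
      ultimately have "scalar_mult (c x) x \<in> mv.span (B \<union> W)"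
        using mv.span_diff by fastforce
      then have "scalar_mult (inverse (c x)) (scalar_mult (c x) x) \<in> mv.span (B \<union> W)"
        by (rule mv.span_scale)
      then show False
        using cx assms(4) by simp
    qed
    then show "\<forall>b\<in>insert x B. c b = 0"
      using cW assms(3) unfolding indep_mod_def by auto
  qed
qed

text \<open>A largest subset of U independent modulo W exists, since sizes are bounded by a spanning
  set of V; anything outside its span could be added to it.\<close>

lemma quot_finite_dim_subspace:
  assumes W: "mv.subspace W" and "quot_finite_dim V W" "U \<subseteq> V"
  shows "quot_finite_dim U W"
proof -
  obtain B where B: "finite B" "V \<subseteq> mv.span (B \<union> W)"
    using assms(2) unfolding quot_finite_dim_def basis_mod_iff[OF W] by blast
  let ?P = "\<lambda>C. finite C \<and> C \<subseteq> U \<and> indep_mod W C"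
  have "?P {}"
    by (auto simp: indep_mod_def)
  moreover have "\<forall>C. ?P C \<longrightarrow> card C < Suc (card B)"
    using indep_mod_set_card_le[OF W B] assms(3) by (auto simp: less_Suc_eq_le)
  ultimately obtain C where C: "?P C" "\<And>D. ?P D \<Longrightarrow> card D \<le> card C"
    using ex_has_greatest_nat[of ?P "{}" card "Suc (card B)"] by blast
  have "U \<subseteq> mv.span (C \<union> W)"
  proof
    fix x
    assume x: "x \<in> U"
    show "x \<in> mv.span (C \<union> W)"
    proof (rule ccontr)
      assume "x \<notin> mv.span (C \<union> W)"
      then have "x \<notin> C" "indep_mod W (insert x C)"
        using indep_mod_insert[OF W] C(1) by auto
      then show False
        using C(2)[of "insert x C"] C(1) x by auto
    qed
  qed
  then show ?thesis
    using C(1) unfolding quot_finite_dim_def basis_mod_iff[OF W] by blast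
qed

lemma quot_finite_dim_superspace:
  assumes "mv.subspace W" "mv.subspace U" "quot_finite_dim V W" "W \<subseteq> U"
  shows "quot_finite_dim V U"
proof -
  obtain B where B: "finite B" "B \<subseteq> V" "V \<subseteq> mv.span (B \<union> W)"
    using assms(3) unfolding quot_finite_dim_def basis_mod_iff[OF assms(1)] by blast
  have "mv.span (B \<union> W) \<subseteq> mv.span (B \<union> U)"
    using assms(4) by (intro mv.span_mono) auto
  then show ?thesis
    using quot_dim_le_card(1)[OF assms(2) B(1,2)] B(3) by blast
qed

lemma quot_dim_add:
  fixes V W U :: "('v, 'k::field) mpoly set"
  assumes W: "mv.subspace W" and U: "mv.subspace U"
    and fd: "quot_finite_dim V W" and WU: "W \<subseteq> U" and UV: "U \<subseteq> V"
  shows "quot_dim V W = quot_dim V U + quot_dim U W"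
proof -
  obtain B1 where B1: "basis_mod U W B1"
    using quot_finite_dim_subspace[OF W fd UV] unfolding quot_finite_dim_def by blast
  obtain B2 where B2: "basis_mod V U B2"
    using quot_finite_dim_superspace[OF W U fd WU] unfolding quot_finite_dim_def by blast
  note b1 = B1[unfolded basis_mod_iff[OF W]] and b2 = B2[unfolded basis_mod_iff[OF U]]
  have disj: "B1 \<inter> B2 = {}"
  proof (rule ccontr)
    assume "B1 \<inter> B2 \<noteq> {}"
    then obtain b where b: "b \<in> B1" "b \<in> B2"
      by blast
    let ?c = "\<lambda>x. if x = b then 1 else (0::'k)"
    have "(\<Sum>x\<in>B2. scalar_mult (?c x) x) = (\<Sum>x\<in>B2. if x = b then x else 0)"
      by (intro sum.cong) auto
    also have "\<dots> = b"
      using b b2 by (simp add: sum.delta)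
    finally have "(\<Sum>x\<in>B2. scalar_mult (?c x) x) \<in> U"
      using b b1 by auto
    then have "?c b = 0"
      using indep_modD[where c = ?c] b2 b(2) by blast
    then show False
      by simp
  qed
  have "indep_mod W (B1 \<union> B2)"
    unfolding indep_mod_def
  proof (intro allI impI)
    fix c
    assume "(\<Sum>b\<in>B1 \<union> B2. scalar_mult (c b) b) \<in> W"
    then have s: "(\<Sum>b\<in>B1. scalar_mult (c b) b) + (\<Sum>b\<in>B2. scalar_mult (c b) b) \<in> W"
      using b1 b2 disj by (simp add: sum.union_disjoint)
    moreover have "(\<Sum>b\<in>B1. scalar_mult (c b) b) \<in> U"
      using b1 by (intro mv.subspace_sum[OF U] mv.subspace_scale[OF U]) auto
    ultimately have "(\<Sum>b\<in>B2. scalar_mult (c b) b) \<in> U"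
      using WU mv.subspace_diff[OF U] by fastforce
    then have c2: "\<forall>b\<in>B2. c b = 0"
      using b2[unfolded indep_mod_def] by simp
    then have "(\<Sum>b\<in>B1. scalar_mult (c b) b) \<in> W"
      using s by simp
    then show "\<forall>b\<in>B1 \<union> B2. c b = 0"
      using b1[unfolded indep_mod_def] c2 by auto
  qed
  moreover have "V \<subseteq> mv.span (B1 \<union> B2 \<union> W)"
  proof -
    have "mv.span (B1 \<union> W) \<subseteq> mv.span (B1 \<union> B2 \<union> W)" 
      by (intro mv.span_mono) auto
    then have "B2 \<union> U \<subseteq> mv.span (B1 \<union> B2 \<union> W)"
      using b1 by (auto intro: mv.span_base)
    then have "mv.span (B2 \<union> U) \<subseteq> mv.span (B1 \<union> B2 \<union> W)"
      by (intro mv.span_minimal mv.subspace_span)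
    then show ?thesis
      using b2 by blast
  qed
  ultimately have "basis_mod V W (B1 \<union> B2)"
    using b1 b2 UV unfolding basis_mod_iff[OF W] by auto
  then show ?thesis
    using quot_dim_eq[OF W] quot_dim_eq[OF U B2] quot_dim_eq[OF W B1] b1 b2 disj
    by (simp add: card_Un_disjoint)
qed

lemma quot_dim_0_imp_subset:
  assumes "mv.subspace W" "quot_finite_dim V W" "quot_dim V W = 0"
  shows "V \<subseteq> W"
proof -
  obtain B where B: "basis_mod V W B"
    using assms(2) unfolding quot_finite_dim_def by blast
  then have "B = {}"
    using quot_dim_eq[OF assms(1) B] assms(1,3) by (simp add: basis_mod_iff)
  then show ?thesis
    using B assms(1) by (auto simp: basis_mod_iff mv.span_eq_iff[THEN iffD2])
qed

text \<open>R plays the part of a linear isomorphism between V/W and V'/W'. A relation spares proofs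
  of well-definedness where the correspondence depends on choosing a decomposition: two choices
  differ only within W'.\<close>

lemma quot_dim_relation:
  fixes V W V' W' :: "('v, 'k::field) mpoly set"
  assumes sub: "mv.subspace V" "mv.subspace W" "mv.subspace V'" "mv.subspace W'"
    and add: "\<And>x y x' y'. R x y \<Longrightarrow> R x' y' \<Longrightarrow> R (x + x') (y + y')"
    and scale: "\<And>c x y. R x y \<Longrightarrow> R (scalar_mult c x) (scalar_mult c y)"
    and left: "\<And>x. x \<in> V \<Longrightarrow> \<exists>y\<in>V'. R x y"
    and right: "\<And>y. y \<in> V' \<Longrightarrow> \<exists>x\<in>V. R x y"
    and compat: "\<And>x y. R x y \<Longrightarrow> x \<in> V \<Longrightarrow> y \<in> V' \<Longrightarrow> x \<in> W \<longleftrightarrow> y \<in> W'"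
    and fd: "quot_finite_dim V W"
  shows "quot_finite_dim V' W' \<and> quot_dim V' W' = quot_dim V W"
proof -
  obtain B where B: "basis_mod V W B"
    using fd unfolding quot_finite_dim_def by blast
  note b = B[unfolded basis_mod_def]
  have "\<forall>x\<in>B. \<exists>y. y \<in> V' \<and> R x y"
    using left b by blast
  then obtain g where g: "\<And>x. x \<in> B \<Longrightarrow> g x \<in> V'" "\<And>x. x \<in> B \<Longrightarrow> R x (g x)"
    by metis
  have zero: "R 0 0"
    using left[OF mv.subspace_0[OF sub(1)]] scale[of _ _ 0] by auto
  have Rsum: "R (\<Sum>x\<in>C. scalar_mult (c x) x) (\<Sum>x\<in>C. scalar_mult (c x) (g x))"
    if "C \<subseteq> B" for c C
    using finite_subset[OF that] b that
    by (induction C rule: infinite_finite_induct) (auto intro: zero add scale g)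
  have sumV: "(\<Sum>x\<in>B. scalar_mult (c x) x) \<in> V" for c
    using b by (intro mv.subspace_sum[OF sub(1)] mv.subspace_scale[OF sub(1)]) auto
  have sumV': "(\<Sum>x\<in>B. scalar_mult (c x) (g x)) \<in> V'" for c
    using g by (intro mv.subspace_sum[OF sub(3)] mv.subspace_scale[OF sub(3)]) auto
  have ind: "\<forall>x\<in>B. c x = 0" if "(\<Sum>x\<in>B. scalar_mult (c x) (g x)) \<in> W'" for c
  proof -
    have "(\<Sum>x\<in>B. scalar_mult (c x) x) \<in> W"
      using compat[OF Rsum[OF order.refl, of c] sumV[of c] sumV'[of c]] that by simp
    then show ?thesis
      using b by simp
  qed
  \<comment> \<open>Two basis elements with the same image would give a relation with coefficients 1
    and -1.\<close>
  have inj: "inj_on g B"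
  proof (rule inj_onI, rule ccontr)
    fix x y
    assume xy: "x \<in> B" "y \<in> B" "g x = g y" "x \<noteq> y"
    let ?c = "\<lambda>z. if z = x then 1 else if z = y then -1 else (0::'k)"
    have "(\<Sum>z\<in>B. scalar_mult (?c z) (g z)) = (\<Sum>z\<in>{x,y}. scalar_mult (?c z) (g z))"
      using b xy by (intro sum.mono_neutral_right) auto
    also have "\<dots> = 0"
      using xy by simp
    finally have "(\<Sum>z\<in>B. scalar_mult (?c z) (g z)) \<in> W'"
      using mv.subspace_0[OF sub(4)] by simp
    then have "?c x = 0"
      using ind[of ?c] xy(1) by blast
    then show False
      by simp
  qed
  have "basis_mod V' W' (g ` B)"
    unfolding basis_mod_def
  proof (intro conjI ballI allI impI)
    show "finite (g ` B)" "g ` B \<subseteq> V'"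
      using b g by auto
  next
    fix y
    assume y: "y \<in> V'"
    obtain x where x: "x \<in> V" "R x y"
      using right[OF y] by blast
    obtain c where c: "x - (\<Sum>x\<in>B. scalar_mult (c x) x) \<in> W"
      using b x(1) by blast
    have "R (x + scalar_mult (-1) (\<Sum>x\<in>B. scalar_mult (c x) x))
        (y + scalar_mult (-1) (\<Sum>x\<in>B. scalar_mult (c x) (g x)))"
      by (intro add scale Rsum x(2) order.refl)
    then have "R (x - (\<Sum>x\<in>B. scalar_mult (c x) x)) (y - (\<Sum>x\<in>B. scalar_mult (c x) (g x)))"
      by simp
    then have "y - (\<Sum>x\<in>B. scalar_mult (c x) (g x)) \<in> W'"
      using compat[OF _ mv.subspace_diff[OF sub(1) x(1) sumV] mv.subspace_diff[OF sub(3) y sumV'], of c c] c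
      by blast
    moreover have "(\<Sum>z\<in>g ` B. scalar_mult (c (inv_into B g z)) z) =
        (\<Sum>x\<in>B. scalar_mult (c x) (g x))"
      by (simp add: sum.reindex[OF inj] inv_into_f_f[OF inj])
    ultimately show "\<exists>c. y - (\<Sum>z\<in>g ` B. scalar_mult (c z) z) \<in> W'"
      by (intro exI[of _ "\<lambda>z. c (inv_into B g z)"]) simp
  next
    fix c z
    assume c: "(\<Sum>z\<in>g ` B. scalar_mult (c z) z) \<in> W'" and z: "z \<in> g ` B"
    have "(\<Sum>x\<in>B. scalar_mult (c (g x)) (g x)) \<in> W'"
      using c by (simp add: sum.reindex[OF inj])
    then show "c z = 0"
      using ind[of "\<lambda>x. c (g x)"] z by blast
  qed
  then show ?thesis
    using quot_dim_eq[OF sub(4)] quot_dim_eq[OF sub(2) B] card_image[OF inj]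
    by (auto simp: quot_finite_dim_def)
qed

section \<open>Graded ideals\<close>

text \<open>Selecting monomials by a predicate covers two uses: homogeneous components, selected by
  degree, and the splitting of a polynomial by support in \<open>nonface_ideal_Int\<close>.\<close>

definition restrict_mons :: "(('v \<Rightarrow>\<^sub>0 nat) \<Rightarrow> bool) \<Rightarrow> ('v, 'k::field) mpoly \<Rightarrow> ('v, 'k) mpoly" where
  "restrict_mons P p = Poly_Mapping.mapp (\<lambda>m c. c when P m) p"

lemma lookup_restrict_mons:
  "lookup (restrict_mons P p) m = (lookup p m when P m)"
  by (auto simp: restrict_mons_def lookup_mapp when_def in_keys_iff)

lemma keys_restrict_mons:
  "keys (restrict_mons P p) = {m \<in> keys p. P m}"
  by (auto simp: in_keys_iff lookup_restrict_mons when_def split: if_splits)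

lemma restrict_mons_0 [simp]: "restrict_mons P 0 = 0"
  by (rule poly_mapping_eqI) (simp add: lookup_restrict_mons)

lemma restrict_mons_add: "restrict_mons P (p + q) = restrict_mons P p + restrict_mons P q"
  by (rule poly_mapping_eqI) (simp add: lookup_restrict_mons lookup_add when_def)

lemma restrict_mons_diff: "restrict_mons P (p - q) = restrict_mons P p - restrict_mons P q"
  by (rule poly_mapping_eqI) (simp add: lookup_restrict_mons lookup_minus when_def)

lemma restrict_mons_id: "(\<And>m. m \<in> keys p \<Longrightarrow> P m) \<Longrightarrow> restrict_mons P p = p"
  by (rule poly_mapping_eqI) (auto simp: lookup_restrict_mons when_def in_keys_iff)

lemma restrict_mons_eq_0: "(\<And>m. m \<in> keys p \<Longrightarrow> \<not> P m) \<Longrightarrow> restrict_mons P p = 0"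
  by (rule poly_mapping_eqI) (auto simp: lookup_restrict_mons when_def in_keys_iff)

lemma mon_degree_superset:
  "finite K \<Longrightarrow> keys m \<subseteq> K \<Longrightarrow> mon_degree m = (\<Sum>v\<in>K. lookup m v)"
  unfolding mon_degree_def by (intro sum.mono_neutral_left) (auto simp: in_keys_iff)

lemma mon_degree_add: "mon_degree (m + n) = mon_degree m + mon_degree n"
proof -
  let ?K = "keys m \<union> keys n"
  show ?thesis
    by (simp add: mon_degree_superset[of ?K] keys_add_nat lookup_add sum.distrib)
qed

lemma mon_degree_single [simp]: "mon_degree (single v n) = n"
  by (simp add: mon_degree_def)

abbreviation hcomp :: "nat \<Rightarrow> ('v, 'k::field) mpoly \<Rightarrow> ('v, 'k) mpoly" where
  "hcomp i \<equiv> restrict_mons (\<lambda>m. mon_degree m = i)"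

lemma hcomp_in: "hcomp i p \<in> homogeneous_part i"
  by (auto simp: homogeneous_part_def keys_restrict_mons)

lemma hcomp_id: "p \<in> homogeneous_part i \<Longrightarrow> hcomp i p = p"
  by (rule restrict_mons_id) (auto simp: homogeneous_part_def)

lemma subspace_homogeneous_part: "mv.subspace (homogeneous_part i)"
  by (fastforce simp: mv.subspace_def homogeneous_part_def in_keys_iff lookup_add)

lemma homogeneous_part_mult:
  assumes "p \<in> homogeneous_part i" "q \<in> homogeneous_part j"
  shows "p * q \<in> homogeneous_part (i + j)"
  using assms keys_mult[of p q] by (fastforce simp: homogeneous_part_def mon_degree_add)

lemma homogeneous_part_power:
  assumes "p \<in> homogeneous_part 1"
  shows "p ^ k \<in> homogeneous_part k"
proof (induction k)
  case 0
  show ?case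
    by (auto simp: homogeneous_part_def mon_degree_def)
next
  case (Suc k)
  show ?case
    using homogeneous_part_mult[OF assms Suc] by simp
qed

lemma indet_homogeneous: "indet v \<in> homogeneous_part 1"
  by (auto simp: homogeneous_part_def indet_def)

lemma single_homogeneous: "single m c \<in> homogeneous_part (mon_degree m)"
  by (auto simp: homogeneous_part_def)

lemma hcomp_mult:
  assumes f: "f \<in> homogeneous_part k"
  shows "hcomp (i + k) (f * p) = f * hcomp i p"
proof -
  have "hcomp (i + k) (f * (p - hcomp i p)) = 0"
  proof (rule restrict_mons_eq_0)
    fix m
    assume "m \<in> keys (f * (p - hcomp i p))"
    then obtain x y where xy: "x \<in> keys f" "y \<in> keys (p - hcomp i p)" "m = x + y"
      using keys_mult[of f "p - hcomp i p"] by blast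
    then have "mon_degree x = k" "mon_degree y \<noteq> i"
      using f by (auto simp: homogeneous_part_def in_keys_iff lookup_minus lookup_restrict_mons)
    then show "mon_degree m \<noteq> i + k"
      using xy by (simp add: mon_degree_add)
  qed
  moreover have "hcomp (i + k) (f * hcomp i p) = f * hcomp i p"
    using homogeneous_part_mult[OF f hcomp_in[of i p]] by (intro hcomp_id) (simp add: add.commute)
  ultimately show ?thesis
    by (simp add: right_diff_distrib restrict_mons_diff)
qed

lemma hcomp_mult_low:
  assumes f: "f \<in> homogeneous_part k" and "i < k"
  shows "hcomp i (f * p) = 0"
proof (rule restrict_mons_eq_0)
  fix m
  assume "m \<in> keys (f * p)"
  then obtain x y where "x \<in> keys f" "m = x + y"
    using keys_mult[of f p] by blast
  then show "mon_degree m \<noteq> i"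
    using assms by (auto simp: homogeneous_part_def mon_degree_add)
qed

lemma sum_hcomp: "p = (\<Sum>i\<in>mon_degree ` keys p. hcomp i p)"
proof (rule poly_mapping_eqI)
  fix m
  show "lookup p m =
      lookup (\<Sum>i\<in>mon_degree ` keys p. hcomp i p) m"
    by (cases "m \<in> keys p")
      (auto simp: lookup_sum lookup_restrict_mons when_def sum.delta' in_keys_iff)
qed

definition graded :: "('v, 'k::field) mpoly set \<Rightarrow> bool" where
  "graded X \<longleftrightarrow> (\<forall>p\<in>X. \<forall>i. hcomp i p \<in> X)"

lemma graded_Int: "graded A \<Longrightarrow> graded B \<Longrightarrow> graded (A \<inter> B)"
  by (auto simp: graded_def)

lemma graded_UNIV: "graded UNIV"
  by (simp add: graded_def)

definition sum_set :: "('v, 'k::field) mpoly set \<Rightarrow> ('v, 'k) mpoly set \<Rightarrow> ('v, 'k) mpoly set" where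
  "sum_set A B = {a + b | a b. a \<in> A \<and> b \<in> B}"

lemma graded_sum_set: "graded A \<Longrightarrow> graded B \<Longrightarrow> graded (sum_set A B)"
  by (fastforce simp: graded_def sum_set_def restrict_mons_add)

lemma subspace_sum_set: "mv.subspace A \<Longrightarrow> mv.subspace B \<Longrightarrow> mv.subspace (sum_set A B)"
  unfolding sum_set_def by (rule mv.subspace_sums)

section \<open>Hilbert functions of graded quotients\<close>

definition hilb :: "('v, 'k::field) mpoly set \<Rightarrow> nat \<Rightarrow> nat" where
  "hilb X i = quot_dim (homogeneous_part i) (X \<inter> homogeneous_part i)"

text \<open>\<open>quot_dim\<close> is a definite description and is informative only for
  finite-dimensional quotients. Finiteness is not automatic, since there is one variable for every
  element of the type.\<close>

definition fin_hilb :: "('v, 'k::field) mpoly set \<Rightarrow> bool" where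
  "fin_hilb X \<longleftrightarrow> (\<forall>i. quot_finite_dim (homogeneous_part i) (X \<inter> homogeneous_part i))"

lemma subspace_Int_homogeneous: "mv.subspace X \<Longrightarrow> mv.subspace (X \<inter> homogeneous_part i)"
  by (intro mv.subspace_inter subspace_homogeneous_part)

lemma fin_hilb_mono:
  assumes "fin_hilb X" "mv.subspace X" "mv.subspace Y" "X \<subseteq> Y"
  shows "fin_hilb Y"
  using assms quot_finite_dim_superspace[OF subspace_Int_homogeneous subspace_Int_homogeneous]
  unfolding fin_hilb_def by (meson Int_mono order.refl)

lemma hilb_add:
  assumes "fin_hilb X" "mv.subspace X" "mv.subspace Y" "X \<subseteq> Y"
  shows "hilb X i = hilb Y i + quot_dim (Y \<inter> homogeneous_part i) (X \<inter> homogeneous_part i)"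
  unfolding hilb_def using assms
  by (intro quot_dim_add subspace_Int_homogeneous) (auto simp: fin_hilb_def)

lemma hilb_mono:
  assumes "fin_hilb X" "mv.subspace X" "mv.subspace Y" "X \<subseteq> Y"
  shows "hilb Y i \<le> hilb X i"
  using hilb_add[OF assms] by simp

text \<open>R raises degrees by k. Homogeneous components of related elements are again related, so
  the isomorphism induced by R restricts to one from degree i to degree i + k.\<close>

lemma quot_dim_graded_relation:
  fixes V W V' W' :: "('v, 'k::field) mpoly set"
  assumes sub: "mv.subspace V" "mv.subspace W" "mv.subspace V'" "mv.subspace W'"
    and gr: "graded V" "graded V'"
    and add: "\<And>x y x' y'. R x y \<Longrightarrow> R x' y' \<Longrightarrow> R (x + x') (y + y')"
    and scale: "\<And>c x y. R x y \<Longrightarrow> R (scalar_mult c x) (scalar_mult c y)"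
    and hcomp: "\<And>x y. R x y \<Longrightarrow> R (hcomp i x) (hcomp (i + k) y)"
    and left: "\<And>x. x \<in> V \<Longrightarrow> \<exists>y\<in>V'. R x y"
    and right: "\<And>y. y \<in> V' \<Longrightarrow> \<exists>x\<in>V. R x y"
    and compat: "\<And>x y. R x y \<Longrightarrow> x \<in> V \<Longrightarrow> y \<in> V' \<Longrightarrow> x \<in> W \<longleftrightarrow> y \<in> W'"
    and fd: "quot_finite_dim (V \<inter> homogeneous_part i) (W \<inter> homogeneous_part i)"
  shows "quot_dim (V' \<inter> homogeneous_part (i + k)) (W' \<inter> homogeneous_part (i + k)) =
         quot_dim (V \<inter> homogeneous_part i) (W \<inter> homogeneous_part i)"
proof (rule conjunct2[OF quot_dim_relation[where R = R]])
  show "\<exists>y\<in>V' \<inter> homogeneous_part (i + k). R x y" if x: "x \<in> V \<inter> homogeneous_part i" for x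
  proof -
    obtain y where y: "y \<in> V'" "R x y"
      using left x by blast
    then have "R x (hcomp (i + k) y)" "hcomp (i + k) y \<in> V'"
      using hcomp[OF y(2)] x gr by (auto simp: hcomp_id graded_def)
    then show ?thesis
      using hcomp_in by blast
  qed
  show "\<exists>x\<in>V \<inter> homogeneous_part i. R x y" if y: "y \<in> V' \<inter> homogeneous_part (i + k)" for y
  proof -
    obtain x where x: "x \<in> V" "R x y"
      using right y by blast
    then have "R (hcomp i x) y" "hcomp i x \<in> V"
      using hcomp[OF x(2)] y gr by (auto simp: hcomp_id graded_def)
    then show ?thesis
      using hcomp_in by blast
  qed
qed (use sub add scale compat fd in \<open>auto intro: subspace_Int_homogeneous\<close>)

text \<open>From (A + B)/B \<cong> A/(A \<inter> B): related elements are those congruent modulo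
  B.\<close>

lemma hilb_modular:
  fixes A B :: "('v, 'k::field) mpoly set"
  assumes A: "mv.subspace A" "graded A" and B: "mv.subspace B" "graded B"
    and fin: "fin_hilb (A \<inter> B)"
  shows "hilb (A \<inter> B) i + hilb (sum_set A B) i = hilb A i + hilb B i"
proof -
  let ?S = "homogeneous_part i :: ('v, 'k) mpoly set"
  have AB: "mv.subspace (A \<inter> B)" and sAB: "mv.subspace (sum_set A B)"
    using A B by (auto intro: mv.subspace_inter subspace_sum_set)
  have sub: "A \<subseteq> sum_set A B" "B \<subseteq> sum_set A B"
    using mv.subspace_0[OF A(1)] mv.subspace_0[OF B(1)]
    by (force simp: sum_set_def)+
  have "fin_hilb B"
    using fin_hilb_mono[OF fin AB B(1)] by simp
  then have "hilb B i = hilb (sum_set A B) i + quot_dim (sum_set A B \<inter> ?S) (B \<inter> ?S)"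
    using hilb_add[OF _ B(1) sAB sub(2)] by blast
  moreover have "hilb (A \<inter> B) i = hilb A i + quot_dim (A \<inter> ?S) ((A \<inter> B) \<inter> ?S)"
    by (rule hilb_add[OF fin AB A(1)]) simp
  moreover have "quot_dim (sum_set A B \<inter> homogeneous_part (i + 0)) (B \<inter> homogeneous_part (i + 0)) =
      quot_dim (A \<inter> ?S) ((A \<inter> B) \<inter> ?S)"
  proof (rule quot_dim_graded_relation[where R = "\<lambda>x y. x - y \<in> B"])
    show "x - y \<in> B \<Longrightarrow> x' - y' \<in> B \<Longrightarrow> (x + x') - (y + y') \<in> B" for x y x' y'
      using mv.subspace_add[OF B(1), of "x - y" "x' - y'"] by (simp add: algebra_simps)
    show "x - y \<in> B \<Longrightarrow> scalar_mult c x - scalar_mult c y \<in> B" for c x y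
      using mv.subspace_scale[OF B(1)] by (metis mv.scale_right_diff_distrib)
    show "x - y \<in> B \<Longrightarrow> hcomp i x - hcomp (i + 0) y \<in> B" for x y
      using B(2) by (simp add: graded_def flip: restrict_mons_diff)
    show "x \<in> A \<Longrightarrow> \<exists>y\<in>sum_set A B. x - y \<in> B" for x
      using sub mv.subspace_0[OF B(1)] by (intro bexI[of _ x]) auto
    show "\<exists>x\<in>A. x - y \<in> B" if "y \<in> sum_set A B" for y
    proof -
      obtain a b where "y = a + b" "a \<in> A" "b \<in> B"
        using \<open>y \<in> sum_set A B\<close> by (auto simp: sum_set_def)
      then show ?thesis
        using mv.subspace_neg[OF B(1)] by (intro bexI[of _ a]) auto
    qed
    show "x \<in> A \<inter> B \<longleftrightarrow> y \<in> B" if "x - y \<in> B" "x \<in> A" for x y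
      using that mv.subspace_add[OF B(1), of "x - y" y] mv.subspace_diff[OF B(1), of x "x - y"] by auto
    show "quot_finite_dim (A \<inter> ?S) ((A \<inter> B) \<inter> ?S)"
      using fin subspace_Int_homogeneous[OF AB] quot_finite_dim_subspace
      unfolding fin_hilb_def by blast
  qed (use A B AB sAB in \<open>auto intro: graded_sum_set\<close>)
  ultimately show ?thesis
    by simp
qed

section \<open>Adjoining one form, and colon ideals\<close>

definition adjoin :: "('v, 'k::field) mpoly set \<Rightarrow> ('v, 'k) mpoly \<Rightarrow> ('v, 'k) mpoly set" where
  "adjoin A f = {e + f * p | e p. e \<in> A}"

lemma adjoin_superset: "A \<subseteq> adjoin A f"
proof
  fix x
  assume "x \<in> A"
  then show "x \<in> adjoin A f"
    unfolding adjoin_def by (intro CollectI exI[of _ x] exI[of _ 0]) simp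
qed

lemma ideal_adjoin:
  assumes "mr.subspace A"
  shows "mr.subspace (adjoin A f)"
proof (rule mr.subspaceI)
  show "0 \<in> adjoin A f"
    using adjoin_superset mr.subspace_0[OF assms] by blast
  show "x + y \<in> adjoin A f" if xy: "x \<in> adjoin A f" "y \<in> adjoin A f" for x y
  proof -
    obtain e p e' p' where "x = e + f * p" "y = e' + f * p'" "e \<in> A" "e' \<in> A"
      using xy by (auto simp: adjoin_def)
    then show ?thesis
      unfolding adjoin_def using mr.subspace_add[OF assms]
      by (intro CollectI exI[of _ "e + e'"] exI[of _ "p + p'"]) (auto simp: algebra_simps)
  qed
  show "c * x \<in> adjoin A f" if x: "x \<in> adjoin A f" for c x
  proof -
    obtain e p where "x = e + f * p" "e \<in> A"
      using x by (auto simp: adjoin_def)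
    then show ?thesis
      unfolding adjoin_def using mr.subspace_scale[OF assms, of e c]
      by (intro CollectI exI[of _ "c * e"] exI[of _ "c * p"]) (auto simp: distrib_left mult.left_commute)
  qed
qed

lemma hcomp_mult_cases:
  assumes "f \<in> homogeneous_part k"
  shows "hcomp i (f * p) = (if i < k then 0 else f * hcomp (i - k) p)"
  using hcomp_mult_low[OF assms, of i p] hcomp_mult[OF assms, of "i - k" p] by auto

lemma graded_adjoin:
  assumes "graded A" "f \<in> homogeneous_part k"
  shows "graded (adjoin A f)"
  unfolding graded_def
proof (intro ballI allI)
  fix x i
  assume "x \<in> adjoin A f"
  then obtain e p where "x = e + f * p" "e \<in> A"
    by (auto simp: adjoin_def)
  then show "hcomp i x \<in> adjoin A f"
    unfolding adjoin_def using assms(1)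
    by (intro CollectI exI[of _ "hcomp i e"] exI[of _ "if i < k then 0 else hcomp (i - k) p"])
      (auto simp: restrict_mons_add hcomp_mult_cases[OF assms(2)] graded_def)
qed

lemma ideal_colon:
  assumes "mr.subspace A"
  shows "mr.subspace {p. f * p \<in> A}"
  using assms unfolding mr.subspace_def by (auto simp: distrib_left mult.left_commute)

lemma hilb_adjoin_low:
  assumes A: "mr.subspace A" "graded A" and f: "f \<in> homogeneous_part k" "i < k"
  shows "hilb (adjoin A f) i = hilb A i"
proof -
  have "x \<in> A" if x: "x \<in> adjoin A f" "x \<in> homogeneous_part i" for x
  proof -
    obtain e p where e: "x = e + f * p" "e \<in> A"
      using x by (auto simp: adjoin_def)
    then have "x = hcomp i e"
      using hcomp_id[OF x(2)] hcomp_mult_low[OF f, of p] by (simp add: restrict_mons_add)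
    then show ?thesis
      using e A by (simp add: graded_def)
  qed
  then have "adjoin A f \<inter> homogeneous_part i = A \<inter> homogeneous_part i"
    using adjoin_superset[of A f] by blast
  then show ?thesis
    by (simp add: hilb_def)
qed

text \<open>The exact sequence 0 \<rightarrow> S/(A : f) \<rightarrow> S/A \<rightarrow> S/(A + f)
  \<rightarrow> 0, whose first map is multiplication by f and shifts degrees by k.\<close>

lemma hilb_adjoin:
  assumes A: "mr.subspace A" "graded A" and fin: "fin_hilb A" and f: "f \<in> homogeneous_part k"
  shows "hilb A (i + k) = hilb (adjoin A f) (i + k) + hilb {p. f * p \<in> A} i"
proof -
  have lA: "mv.subspace A" "mv.subspace (adjoin A f)" "mv.subspace {p. f * p \<in> A}"
    using A ideal_adjoin ideal_colon by (blast intro: ideal_imp_linear_subspace)+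
  have AC: "A \<subseteq> {p. f * p \<in> A}"
    using mr.subspace_scale[OF A(1)] by blast
  have "quot_dim (adjoin A f \<inter> homogeneous_part (i + k)) (A \<inter> homogeneous_part (i + k)) =
      quot_dim (UNIV \<inter> homogeneous_part i) ({p. f * p \<in> A} \<inter> homogeneous_part i)"
  proof (rule quot_dim_graded_relation[where R = "\<lambda>x y. y - f * x \<in> A"])
    show "y - f * x \<in> A \<Longrightarrow> y' - f * x' \<in> A \<Longrightarrow> (y + y') - f * (x + x') \<in> A" for x y x' y'
      using mv.subspace_add[OF lA(1), of "y - f * x" "y' - f * x'"] by (simp add: algebra_simps)
    show "y - f * x \<in> A \<Longrightarrow> scalar_mult c y - f * scalar_mult c x \<in> A" for c x y
      using mv.subspace_scale[OF lA(1), of "y - f * x" c]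
      by (simp add: scalar_mult_def right_diff_distrib mult.left_commute)
    show "y - f * x \<in> A \<Longrightarrow> hcomp (i + k) y - f * hcomp i x \<in> A" for x y
      using A(2) by (auto simp: graded_def restrict_mons_diff hcomp_mult[OF f] dest!: bspec spec[of _ "i + k"])
    show "\<exists>y\<in>adjoin A f. y - f * x \<in> A" for x
      using mv.subspace_0[OF lA(1)] by (intro bexI[of _ "f * x"]) (force simp: adjoin_def)+
    show "\<exists>x\<in>UNIV. y - f * x \<in> A" if y: "y \<in> adjoin A f" for y
    proof -
      obtain e p where "y = e + f * p" "e \<in> A"
        using y by (auto simp: adjoin_def)
      then show ?thesis
        by (intro bexI[of _ p]) auto
    qed
    show "x \<in> {p. f * p \<in> A} \<longleftrightarrow> y \<in> A" if "y - f * x \<in> A" for x y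
      using that mv.subspace_add[OF lA(1), of "y - f * x" "f * x"]
        mv.subspace_diff[OF lA(1), of y "y - f * x"] by auto
    show "quot_finite_dim (UNIV \<inter> homogeneous_part i) ({p. f * p \<in> A} \<inter> homogeneous_part i)"
      using fin_hilb_mono[OF fin lA(1,3) AC] by (simp add: fin_hilb_def)
  qed (use lA A f in \<open>auto intro: graded_adjoin graded_UNIV\<close>)
  then show ?thesis
    using hilb_add[OF fin lA(1,2) adjoin_superset, of "i + k"] by (simp add: hilb_def)
qed

lemma graded_subset_iff:
  assumes "mr.subspace A" "graded B" "\<And>i. B \<inter> homogeneous_part i \<subseteq> A"
  shows "B \<subseteq> A"
proof
  fix p
  assume "p \<in> B"
  then have "hcomp i p \<in> A" for i
    using assms(2,3) hcomp_in[of i p] by (auto simp: graded_def)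
  then have "(\<Sum>i\<in>mon_degree ` keys p. hcomp i p) \<in> A"
    by (intro mr.subspace_sum[OF assms(1)])
  then show "p \<in> A"
    using sum_hcomp[of p] by simp
qed

section \<open>Ideals of nonfaces\<close>

text \<open>Membership is tested one monomial at a time, so intersections, sums and graded pieces
  can be read off. \<open>nonface_ideal_eq_span\<close> links this form to the generators.\<close>

definition nonface_ideal :: "'v set set \<Rightarrow> ('v, 'k::field) mpoly set" where
  "nonface_ideal \<Delta> = {p. \<forall>m\<in>keys p. keys m \<notin> \<Delta>}"

definition subset_closed :: "'v set set \<Rightarrow> bool" where
  "subset_closed \<Delta> \<longleftrightarrow> (\<forall>G\<in>\<Delta>. \<forall>H. H \<subseteq> G \<longrightarrow> H \<in> \<Delta>)"

lemma simplicial_complex_subset_closed: "simplicial_complex \<Delta> \<Longrightarrow> subset_closed \<Delta>"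
  by (simp add: simplicial_complex_def subset_closed_def)

lemma ideal_nonface_ideal:
  assumes "subset_closed \<Delta>"
  shows "mr.subspace (nonface_ideal \<Delta>)"
proof (rule mr.subspaceI)
  show "x + y \<in> nonface_ideal \<Delta>" if "x \<in> nonface_ideal \<Delta>" "y \<in> nonface_ideal \<Delta>" for x y
    using that keys_add[of x y] by (auto simp: nonface_ideal_def)
  show "c * x \<in> nonface_ideal \<Delta>" if x: "x \<in> nonface_ideal \<Delta>" for c x
    unfolding nonface_ideal_def
  proof (intro CollectI ballI)
    fix m
    assume "m \<in> keys (c * x)"
    then obtain u w where w: "w \<in> keys x" "m = u + w"
      using keys_mult[of c x] by blast
    then have "keys w \<notin> \<Delta>" "keys w \<subseteq> keys m"
      using x by (auto simp: nonface_ideal_def keys_add_nat)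
    then show "keys m \<notin> \<Delta>"
      using assms unfolding subset_closed_def by blast
  qed
qed (simp add: nonface_ideal_def)

lemma graded_nonface_ideal: "graded (nonface_ideal \<Delta>)"
  by (auto simp: graded_def nonface_ideal_def keys_restrict_mons)

lemma nonface_ideal_Un: "nonface_ideal (A \<union> B) = nonface_ideal A \<inter> nonface_ideal B"
  by (auto simp: nonface_ideal_def)

lemma nonface_ideal_antimono: "A \<subseteq> B \<Longrightarrow> nonface_ideal B \<subseteq> nonface_ideal A"
  by (auto simp: nonface_ideal_def)

text \<open>A polynomial without monomials supported in A \<inter> B splits into the monomials whose
  support is not in A and the rest, whose supports are in A and hence not in B.\<close>

lemma nonface_ideal_Int:
  assumes "subset_closed A" "subset_closed B"
  shows "nonface_ideal (A \<inter> B) = sum_set (nonface_ideal A) (nonface_ideal B)"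
proof (intro subset_antisym subsetI)
  fix p :: "('a, 'b) mpoly"
  assume p: "p \<in> nonface_ideal (A \<inter> B)"
  let ?P = "\<lambda>m. keys m \<notin> A"
  have "restrict_mons ?P p \<in> nonface_ideal A"
    by (auto simp: nonface_ideal_def keys_restrict_mons)
  moreover have "p - restrict_mons ?P p \<in> nonface_ideal B"
    using p
    by (auto simp: nonface_ideal_def in_keys_iff lookup_minus lookup_restrict_mons when_def
        split: if_splits)
  ultimately show "p \<in> sum_set (nonface_ideal A) (nonface_ideal B)"
    unfolding sum_set_def
    by (intro CollectI exI[of _ "restrict_mons ?P p"] exI[of _ "p - restrict_mons ?P p"]) auto
next
  fix p :: "('a, 'b) mpoly"
  assume "p \<in> sum_set (nonface_ideal A) (nonface_ideal B)"
  then obtain x y where xy: "p = x + y" "x \<in> nonface_ideal A" "y \<in> nonface_ideal B"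
    by (auto simp: sum_set_def)
  have "nonface_ideal A \<subseteq> nonface_ideal (A \<inter> B)" "nonface_ideal B \<subseteq> nonface_ideal (A \<inter> B)"
    by (rule nonface_ideal_antimono; simp)+
  moreover have "subset_closed (A \<inter> B)"
    using assms by (auto simp: subset_closed_def)
  ultimately show "p \<in> nonface_ideal (A \<inter> B)"
    using xy mr.subspace_add[OF ideal_nonface_ideal, of "A \<inter> B" x y] by blast
qed

lemma prod_indet:
  assumes "finite G"
  shows "(\<Prod>v\<in>G. indet v :: ('v, 'k::field) mpoly) =
    single (\<Sum>v\<in>G. single v (Suc 0)) 1"
  using assms by (induction G rule: finite_induct) (auto simp: indet_def mult_single)

lemma lookup_sum_single:
  "finite G \<Longrightarrow> lookup (\<Sum>v\<in>G. single v (Suc 0)) x = (if x \<in> G then 1 else 0)"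
  by (simp add: lookup_sum lookup_single when_def sum.delta)

lemma keys_sum_single:
  "finite G \<Longrightarrow> keys (\<Sum>v\<in>G. single v (Suc 0)) = G"
  by (auto simp: in_keys_iff lookup_sum_single split: if_splits)

lemma nonface_ideal_eq_span:
  assumes "subset_closed \<Delta>"
  shows "mr.span (nonface_monomials \<Delta>) = (nonface_ideal \<Delta> :: ('v, 'k::field) mpoly set)"
proof (intro subset_antisym)
  show "mr.span (nonface_monomials \<Delta>) \<subseteq> (nonface_ideal \<Delta> :: ('v, 'k) mpoly set)"
    by (rule mr.span_minimal[OF _ ideal_nonface_ideal[OF assms]])
      (auto simp: nonface_monomials_def nonface_ideal_def prod_indet keys_sum_single)
next
  show "nonface_ideal \<Delta> \<subseteq> (mr.span (nonface_monomials \<Delta>) :: ('v, 'k) mpoly set)"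
  proof
    fix p :: "('v, 'k) mpoly"
    assume p: "p \<in> nonface_ideal \<Delta>"
    have "single m (lookup p m) \<in> mr.span (nonface_monomials \<Delta>)"
      if m: "m \<in> keys p" for m
    proof -
      let ?G = "keys m"
      let ?g = "\<Sum>v\<in>?G. single v (Suc 0)"
      \<comment> \<open>A monomial is divisible by the squarefree monomial of its own support, and
        that is one of the generators.\<close>
      have "m = (m - ?g) + ?g"
        by (rule poly_mapping_eqI) (auto simp: lookup_add lookup_minus lookup_sum_single in_keys_iff)
      then have "single m (lookup p m) =
          single (m - ?g) (lookup p m) * (\<Prod>v\<in>?G. indet v)"
        by (simp add: prod_indet mult_single)
      moreover have "(\<Prod>v\<in>?G. indet v) \<in> (nonface_monomials \<Delta> :: ('v, 'k) mpoly set)"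
        using m p by (auto simp: nonface_monomials_def nonface_ideal_def)
      ultimately show ?thesis
        by (simp add: mr.span_base mr.span_scale)
    qed
    then have "(\<Sum>m\<in>keys p. single m (lookup p m))
        \<in> mr.span (nonface_monomials \<Delta>)"
      by (intro mr.span_sum)
    then show "p \<in> mr.span (nonface_monomials \<Delta>)"
      using poly_mapping_sum_single[of "keys p" p] by simp
  qed
qed

section \<open>Adjoining a sequence of forms\<close>

definition extend_ideal ::
    "('v, 'k::field) mpoly set \<Rightarrow> (nat \<Rightarrow> ('v, 'k) mpoly) \<Rightarrow> nat \<Rightarrow> ('v, 'k) mpoly set" where
  "extend_ideal A \<theta> n = {e + (\<Sum>j<n. \<theta> j * p j) | e p. e \<in> A}"

lemma extend_ideal_0 [simp]: "extend_ideal A \<theta> 0 = A"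
  by (auto simp: extend_ideal_def)

lemma extend_ideal_Suc: "extend_ideal A \<theta> (Suc n) = adjoin (extend_ideal A \<theta> n) (\<theta> n)"
proof (intro subset_antisym subsetI)
  fix x
  assume "x \<in> extend_ideal A \<theta> (Suc n)"
  then obtain e p where "x = e + (\<Sum>j<n. \<theta> j * p j) + \<theta> n * p n" "e \<in> A"
    by (auto simp: extend_ideal_def add.assoc)
  then show "x \<in> adjoin (extend_ideal A \<theta> n) (\<theta> n)"
    unfolding adjoin_def extend_ideal_def by blast
next
  fix x
  assume "x \<in> adjoin (extend_ideal A \<theta> n) (\<theta> n)"
  then obtain e p q where e: "x = e + (\<Sum>j<n. \<theta> j * p j) + \<theta> n * q" "e \<in> A"
    by (auto simp: extend_ideal_def adjoin_def)
  then show "x \<in> extend_ideal A \<theta> (Suc n)"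
    unfolding extend_ideal_def
    by (intro CollectI exI[of _ e] exI[of _ "\<lambda>j. if j < n then p j else q"]) (auto simp: add.assoc)
qed

lemma ideal_extend_ideal: "mr.subspace A \<Longrightarrow> mr.subspace (extend_ideal A \<theta> n)"
  by (induction n) (auto simp: extend_ideal_Suc intro: ideal_adjoin)

lemma graded_extend_ideal:
  "graded A \<Longrightarrow> (\<And>j. \<theta> j \<in> homogeneous_part 1) \<Longrightarrow> graded (extend_ideal A \<theta> n)"
  by (induction n) (auto simp: extend_ideal_Suc intro: graded_adjoin)

lemma extend_ideal_superset: "A \<subseteq> extend_ideal A \<theta> n"
  by (induction n) (auto simp: extend_ideal_Suc dest: subsetD[OF adjoin_superset])

lemma extend_ideal_mono: "A \<subseteq> B \<Longrightarrow> extend_ideal A \<theta> n \<subseteq> extend_ideal B \<theta> n"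
  by (auto simp: extend_ideal_def)

lemma generator_in_extend_ideal:
  assumes "mr.subspace A" "j < n"
  shows "\<theta> j \<in> extend_ideal A \<theta> n"
proof -
  have "\<theta> j = (\<Sum>i<n. \<theta> i * (if i = j then 1 else 0))"
    using assms(2) by (simp add: if_distrib[of "\<lambda>x. _ * x"] sum.delta cong: if_cong)
  then show ?thesis
    unfolding extend_ideal_def using mr.subspace_0[OF assms(1)]
    by (intro CollectI exI[of _ 0] exI[of _ "\<lambda>i. if i = j then 1 else 0"]) simp
qed

lemma extend_ideal_least:
  assumes "mr.subspace B" "A \<subseteq> B" "\<And>j. j < n \<Longrightarrow> \<theta> j \<in> B"
  shows "extend_ideal A \<theta> n \<subseteq> B"
proof
  fix x
  assume "x \<in> extend_ideal A \<theta> n"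
  then obtain e p where e: "x = e + (\<Sum>j<n. \<theta> j * p j)" "e \<in> A"
    by (auto simp: extend_ideal_def)
  have "p j * \<theta> j \<in> B" if "j < n" for j
    using mr.subspace_scale[OF assms(1)] assms(3) that by blast
  then have "(\<Sum>j<n. \<theta> j * p j) \<in> B"
    by (intro mr.subspace_sum[OF assms(1)]) (simp add: mult.commute)
  then show "x \<in> B"
    using e assms mr.subspace_add by blast
qed

lemma extend_ideal_cong:
  assumes A: "mr.subspace A" and d: "\<And>j. j < n \<Longrightarrow> \<theta> j - \<theta>' j \<in> A"
  shows "extend_ideal A \<theta> n = extend_ideal A \<theta>' n"
proof -
  have "extend_ideal A \<theta> n \<subseteq> extend_ideal A \<theta>' n"
    if d: "\<And>j. j < n \<Longrightarrow> \<theta> j - \<theta>' j \<in> A" for \<theta> \<theta>'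
  proof (rule extend_ideal_least)
    show "\<theta> j \<in> extend_ideal A \<theta>' n" if "j < n" for j
      using mr.subspace_add[OF ideal_extend_ideal[OF A] subsetD[OF extend_ideal_superset d[OF that]]
          generator_in_extend_ideal[OF A that, of \<theta>']] by simp
  qed (use A extend_ideal_superset ideal_extend_ideal in auto)
  moreover have "\<theta>' j - \<theta> j \<in> A" if "j < n" for j
    using mr.subspace_neg[OF A d[OF that]] by simp
  ultimately show ?thesis
    using d by blast
qed

definition linear_form_on :: "'v set \<Rightarrow> (nat \<times> 'v \<Rightarrow> 'k::field) \<Rightarrow> nat \<Rightarrow> ('v, 'k) mpoly" where
  "linear_form_on V a j = (\<Sum>v\<in>V. scalar_mult (a (j, v)) (indet v))"

lemma linear_form_eq: "linear_form \<Delta> a = linear_form_on (vertices \<Delta>) a"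
  by (simp add: linear_form_def linear_form_on_def fun_eq_iff)

lemma linear_form_on_homogeneous: "linear_form_on V a j \<in> homogeneous_part 1"
  unfolding linear_form_on_def
  by (intro mv.subspace_sum mv.subspace_scale subspace_homogeneous_part indet_homogeneous)

lemma face_ideal_eq:
  assumes "subset_closed \<Delta>"
  shows "face_ideal \<Delta> a n = extend_ideal (nonface_ideal \<Delta>) (linear_form \<Delta> a) n"
proof (rule subset_antisym)
  note I = ideal_nonface_ideal[OF assms]
  have "nonface_monomials \<Delta> \<subseteq> extend_ideal (nonface_ideal \<Delta>) (linear_form \<Delta> a) n"
    using extend_ideal_superset nonface_ideal_eq_span[OF assms] mr.span_superset by blast
  then show "face_ideal \<Delta> a n \<subseteq> extend_ideal (nonface_ideal \<Delta>) (linear_form \<Delta> a) n"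
    unfolding face_ideal_def ideal_gen_def
    by (intro mr.span_minimal ideal_extend_ideal I) (auto intro: generator_in_extend_ideal[OF I])
  show "extend_ideal (nonface_ideal \<Delta>) (linear_form \<Delta> a) n \<subseteq> face_ideal \<Delta> a n"
    unfolding face_ideal_def ideal_gen_def nonface_ideal_eq_span[OF assms, symmetric]
    by (intro extend_ideal_least mr.subspace_span mr.span_mono) (auto intro: mr.span_base)
qed

lemma indet_nonvertex: "v \<notin> vertices \<Delta> \<Longrightarrow> indet v \<in> nonface_ideal \<Delta>"
  by (auto simp: nonface_ideal_def indet_def)

text \<open>A variable that is not a vertex already lies in the nonface ideal, so coefficients
  outside the vertex set have no effect. Hence one sequence on a common vertex set serves several
  complexes.\<close>

lemma extend_linear_form_on:
  assumes "subset_closed \<Delta>" "finite V" "vertices \<Delta> \<subseteq> V"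
  shows "extend_ideal (nonface_ideal \<Delta>) (linear_form_on V a) n = face_ideal \<Delta> a n"
  unfolding face_ideal_eq[OF assms(1)]
proof (rule extend_ideal_cong[OF ideal_nonface_ideal[OF assms(1)]])
  fix j
  have "linear_form_on V a j - linear_form \<Delta> a j =
      (\<Sum>v\<in>V - vertices \<Delta>. scalar_mult (a (j, v)) (indet v))"
    unfolding linear_form_eq linear_form_on_def using assms by (simp add: sum_diff)
  also have "\<dots> \<in> nonface_ideal \<Delta>"
    using ideal_imp_linear_subspace[OF ideal_nonface_ideal[OF assms(1)]]
    by (intro mv.subspace_sum mv.subspace_scale indet_nonvertex) auto
  finally show "linear_form_on V a j - linear_form \<Delta> a j \<in> nonface_ideal \<Delta>" .
qed

section \<open>Monomial bases of face rings\<close>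

definition face_mons :: "'v set set \<Rightarrow> nat \<Rightarrow> ('v \<Rightarrow>\<^sub>0 nat) set" where
  "face_mons \<Delta> i = {m. keys m \<in> \<Delta> \<and> mon_degree m = i}"

lemma lookup_le_mon_degree: "lookup m v \<le> mon_degree m"
  using member_le_sum[of v "keys m" "lookup m"]
  by (cases "v \<in> keys m") (auto simp: mon_degree_def in_keys_iff)

lemma finite_face_mons:
  assumes "finite (vertices \<Delta>)"
  shows "finite (face_mons \<Delta> i)"
proof (rule finite_imageD)
  let ?f = "\<lambda>m. restrict (lookup m) (vertices \<Delta>)"
  have "?f ` face_mons \<Delta> i \<subseteq> vertices \<Delta> \<rightarrow>\<^sub>E {..i}"
    using lookup_le_mon_degree by (auto simp: face_mons_def)
  then show "finite (?f ` face_mons \<Delta> i)"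
    using assms by (meson finite_PiE finite_atMost finite_subset)
  show "inj_on ?f (face_mons \<Delta> i)"
  proof (rule inj_onI, rule poly_mapping_eqI)
    fix m m' v
    assume mm: "m \<in> face_mons \<Delta> i" "m' \<in> face_mons \<Delta> i" "?f m = ?f m'"
    show "lookup m v = lookup m' v"
    proof (cases "v \<in> vertices \<Delta>")
      case True
      then show ?thesis
        using fun_cong[OF mm(3), of v] by simp
    next
      case False
      then have "v \<notin> keys m" "v \<notin> keys m'"
        using mm by (auto simp: face_mons_def)
      then show ?thesis
        by (simp add: in_keys_iff)
    qed
  qed
qed

lemma scalar_mult_single: "scalar_mult c (single m d) = single m (c * d)"
  by (simp add: scalar_mult_def mult_single)

lemma basis_mod_nonface_ideal:
  assumes "finite (vertices \<Delta>)" "subset_closed \<Delta>"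
  shows "basis_mod (homogeneous_part i) (nonface_ideal \<Delta> \<inter> homogeneous_part i)
    ((\<lambda>m. single m (1::'k::field)) ` face_mons \<Delta> i)"
proof -
  let ?s = "\<lambda>m. single m (1::'k)"
  have inj: "inj_on ?s M" for M :: "('a \<Rightarrow>\<^sub>0 nat) set"
    by (rule inj_onI) (metis lookup_single_eq lookup_single_not_eq zero_neq_one)
  have fin: "finite (face_mons \<Delta> i)"
    by (rule finite_face_mons[OF assms(1)])
  have sum: "(\<Sum>b\<in>?s ` face_mons \<Delta> i. scalar_mult (c b) b) =
      (\<Sum>m\<in>face_mons \<Delta> i. single m (c (?s m)))" for c
    by (simp add: sum.reindex[OF inj] scalar_mult_single)
  show ?thesis
    unfolding basis_mod_def sum
  proof (intro conjI ballI allI impI)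
    show "finite (?s ` face_mons \<Delta> i)"
      using fin by simp
    show "?s ` face_mons \<Delta> i \<subseteq> homogeneous_part i"
      using single_homogeneous by (auto simp: face_mons_def)
  next
    fix p :: "('a, 'k) mpoly"
    assume p: "p \<in> homogeneous_part i"
    define c where "c = (\<lambda>b. lookup p (inv ?s b))"
    have c: "c (?s m) = lookup p m" for m
      by (simp add: c_def inv_f_f[OF inj])
    let ?q = "p - (\<Sum>m\<in>face_mons \<Delta> i. single m (c (?s m)))"
    have "?q \<in> homogeneous_part i"
      using p single_homogeneous
      by (intro mv.subspace_diff mv.subspace_sum subspace_homogeneous_part) (auto simp: face_mons_def)
    moreover have "?q \<in> nonface_ideal \<Delta>"
      using p fin
      by (auto simp: nonface_ideal_def c in_keys_iff lookup_minus lookup_sum lookup_single when_def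
          sum.delta face_mons_def homogeneous_part_def split: if_splits)
    ultimately show "\<exists>c. p - (\<Sum>m\<in>face_mons \<Delta> i. single m (c (?s m))) \<in>
        nonface_ideal \<Delta> \<inter> homogeneous_part i"
      by blast
  next
    fix c b
    assume c: "(\<Sum>m\<in>face_mons \<Delta> i. single m (c (?s m))) \<in> nonface_ideal \<Delta> \<inter> homogeneous_part i"
      and "b \<in> ?s ` face_mons \<Delta> i"
    then obtain m where m: "b = ?s m" "m \<in> face_mons \<Delta> i"
      by blast
    then have "lookup (\<Sum>m\<in>face_mons \<Delta> i. single m (c (?s m))) m = c b"
      using fin by (simp add: lookup_sum lookup_single when_def sum.delta)
    moreover have "m \<notin> keys (\<Sum>m\<in>face_mons \<Delta> i. single m (c (?s m)))"
      using c m(2) unfolding nonface_ideal_def face_mons_def by blast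
    ultimately show "c b = 0"
      by (simp add: in_keys_iff)
  qed
qed

lemma hilb_nonface_ideal:
  assumes "finite (vertices \<Delta>)" "subset_closed \<Delta>"
  shows "hilb (nonface_ideal \<Delta> :: ('v, 'k::field) mpoly set) i = card (face_mons \<Delta> i)"
proof -
  have "inj_on (\<lambda>m. single m (1::'k)) (face_mons \<Delta> i)"
    by (rule inj_onI) (metis lookup_single_eq lookup_single_not_eq zero_neq_one)
  then show ?thesis
    unfolding hilb_def using ideal_imp_linear_subspace[OF ideal_nonface_ideal[OF assms(2)]]
    by (subst quot_dim_eq[OF _ basis_mod_nonface_ideal[OF assms]])
      (auto intro: subspace_Int_homogeneous simp: card_image)
qed

lemma fin_hilb_nonface_ideal:
  assumes "finite (vertices \<Delta>)" "subset_closed \<Delta>"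
  shows "fin_hilb (nonface_ideal \<Delta>)"
  unfolding fin_hilb_def quot_finite_dim_def using basis_mod_nonface_ideal[OF assms] by blast

lemma fin_hilb_extend_nonface_ideal:
  assumes "finite (vertices \<Delta>)" "subset_closed \<Delta>"
  shows "fin_hilb (extend_ideal (nonface_ideal \<Delta>) \<theta> n)"
  by (rule fin_hilb_mono[OF fin_hilb_nonface_ideal[OF assms] _ _ extend_ideal_superset])
    (auto intro: ideal_imp_linear_subspace ideal_extend_ideal ideal_nonface_ideal assms)

section \<open>Hilbert series and regular sequences\<close>

text \<open>The inverse of 1 - X. With it the usual form h(X)/(1 - X)^d of a Hilbert series becomes
  a product of integer power series.\<close>

definition geom :: "int fps" where
  "geom = Abs_fps (\<lambda>_. 1)"

lemma geom_inverse: "(1 - fps_X) * geom = 1"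
proof (rule fps_ext)
  fix n
  show "fps_nth ((1 - fps_X) * geom) n = fps_nth 1 n"
    by (cases n) (auto simp: geom_def left_diff_distrib)
qed

lemma geom_nonzero: "geom \<noteq> 0"
  using geom_inverse by auto

text \<open>A sum of coefficientwise nonnegative series is zero only if each of them is, which turns
  one numerical identity into many.\<close>

definition nonneg_fps :: "int fps \<Rightarrow> bool" where
  "nonneg_fps f \<longleftrightarrow> (\<forall>i. 0 \<le> fps_nth f i)"

lemma nonneg_fps_mult: "nonneg_fps f \<Longrightarrow> nonneg_fps g \<Longrightarrow> nonneg_fps (f * g)"
  by (auto simp: nonneg_fps_def fps_mult_nth intro!: sum_nonneg)

lemma nonneg_fps_geom_power: "nonneg_fps (geom ^ n)"
proof (induction n)
  case 0
  show ?case by (simp add: nonneg_fps_def)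
next
  case (Suc n)
  have "nonneg_fps geom" by (simp add: nonneg_fps_def geom_def)
  then show ?case using Suc by (simp add: nonneg_fps_mult)
qed

lemma nonneg_fps_sum: "(\<And>x. x \<in> X \<Longrightarrow> nonneg_fps (f x)) \<Longrightarrow> nonneg_fps (sum f X)"
  by (auto simp: nonneg_fps_def fps_sum_nth intro: sum_nonneg)

lemma nonneg_fps_add_eq_0:
  assumes "nonneg_fps f" "nonneg_fps g" "f + g = 0"
  shows "f = 0" "g = 0"
proof -
  have "fps_nth f i + fps_nth g i = 0" for i
    by (metis assms(3) fps_add_nth fps_zero_nth)
  then show "f = 0" "g = 0"
    using assms(1,2) by (auto simp: fps_eq_iff nonneg_fps_def add_nonneg_eq_0_iff)
qed

lemma nonneg_fps_sum_eq_0: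
  assumes "finite X" "\<And>x. x \<in> X \<Longrightarrow> nonneg_fps (f x)" "sum f X = 0" "x \<in> X"
  shows "f x = 0"
proof -
  have "nonneg_fps (sum f (X - {x}))"
    using assms(2) by (intro nonneg_fps_sum) auto
  moreover have "f x + sum f (X - {x}) = 0"
    using assms(1,3,4) by (simp add: sum.remove)
  ultimately show ?thesis
    using nonneg_fps_add_eq_0(1) assms(2,4) by blast
qed

definition hseries :: "('v, 'k::field) mpoly set \<Rightarrow> int fps" where
  "hseries A = Abs_fps (\<lambda>i. int (hilb A i))"

text \<open>The Hilbert series of the kernel of multiplication by \<open>f\<close> on the quotient by \<open>A\<close>.\<close>

definition excess :: "('v, 'k::field) mpoly set \<Rightarrow> ('v, 'k) mpoly \<Rightarrow> int fps" where
  "excess A f = Abs_fps (\<lambda>i. int (quot_dim ({p. f * p \<in> A} \<inter> homogeneous_part i) (A \<inter> homogeneous_part i)))"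

lemma nonneg_fps_excess: "nonneg_fps (excess A f)"
  by (simp add: nonneg_fps_def excess_def)

text \<open>This is \<open>hilb_adjoin\<close> with S/(A : f) rewritten as S/A less the kernel of
  multiplication by f; for a nonzero divisor just the factor 1 - X would remain.\<close>

lemma hseries_adjoin:
  assumes A: "mr.subspace A" "graded A" "fin_hilb A" and f: "f \<in> homogeneous_part 1"
  shows "hseries (adjoin A f) = (1 - fps_X) * hseries A + fps_X * excess A f"
proof (rule fps_ext)
  fix n
  have "A \<subseteq> {p. f * p \<in> A}"
    using mr.subspace_scale[OF A(1)] by blast
  then have colon: "hilb A i = hilb {p. f * p \<in> A} i +
      quot_dim ({p. f * p \<in> A} \<inter> homogeneous_part i) (A \<inter> homogeneous_part i)" for i
    using A ideal_colon by (intro hilb_add) (auto intro: ideal_imp_linear_subspace)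
  show "fps_nth (hseries (adjoin A f)) n = fps_nth ((1 - fps_X) * hseries A + fps_X * excess A f) n"
  proof (cases n)
    case 0
    then show ?thesis
      using hilb_adjoin_low[OF A(1,2) f, of 0] by (simp add: hseries_def left_diff_distrib)
  next
    case (Suc i)
    then show ?thesis
      using hilb_adjoin[OF A f, of i] colon[of i]
      by (simp add: hseries_def excess_def left_diff_distrib)
  qed
qed

text \<open>Iterating \<open>hseries_adjoin\<close> and multiplying by 1/(1 - X) at every step
  leaves no negative term: the deviation from the regular case is a sum of nonnegative
  series.\<close>

lemma hseries_extend_ideal:
  assumes A: "mr.subspace A" "graded A" "fin_hilb A" and \<theta>: "\<And>j. \<theta> j \<in> homogeneous_part 1"
  shows "hseries A + (\<Sum>j<n. geom ^ Suc j * (fps_X * excess (extend_ideal A \<theta> j) (\<theta> j))) =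
    geom ^ n * hseries (extend_ideal A \<theta> n)"
proof (induction n)
  case 0
  show ?case by simp
next
  case (Suc n)
  let ?B = "extend_ideal A \<theta> n" and ?X = "fps_X :: int fps"
  have B: "mr.subspace ?B" "graded ?B"
    using A \<theta> by (auto intro: ideal_extend_ideal graded_extend_ideal)
  have "fin_hilb ?B"
    using A B by (intro fin_hilb_mono[OF A(3) _ _ extend_ideal_superset] ideal_imp_linear_subspace)
  then have "geom ^ Suc n * hseries (extend_ideal A \<theta> (Suc n)) =
      geom ^ Suc n * ((1 - ?X) * hseries ?B + ?X * excess ?B (\<theta> n))"
    by (simp add: extend_ideal_Suc hseries_adjoin[OF B _ \<theta>])
  also have "\<dots> = geom ^ n * (((1 - ?X) * geom) * hseries ?B) + geom ^ Suc n * (?X * excess ?B (\<theta> n))"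
    by (simp only: power_Suc distrib_left mult_ac)
  finally show ?case
    using Suc by (simp add: geom_inverse)
qed

definition regular_on ::
    "('v, 'k::field) mpoly set \<Rightarrow> (nat \<Rightarrow> ('v, 'k) mpoly) \<Rightarrow> nat \<Rightarrow> bool" where
  "regular_on A \<theta> n \<longleftrightarrow>
     (\<forall>j<n. \<forall>p. \<theta> j * p \<in> extend_ideal A \<theta> j \<longrightarrow> p \<in> extend_ideal A \<theta> j)"

lemma quot_dim_self: "mv.subspace V \<Longrightarrow> quot_dim V V = 0"
  using quot_dim_eq[of V V "{}"] mv.span_superset by (auto simp: basis_mod_iff indep_mod_def)

lemma hseries_regular:
  assumes A: "mr.subspace A" "graded A" "fin_hilb A" and \<theta>: "\<And>j. \<theta> j \<in> homogeneous_part 1"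
    and reg: "regular_on A \<theta> n"
  shows "hseries A = geom ^ n * hseries (extend_ideal A \<theta> n)"
proof -
  have "excess (extend_ideal A \<theta> j) (\<theta> j) = 0" if "j < n" for j
  proof -
    let ?B = "extend_ideal A \<theta> j"
    have B: "mr.subspace ?B"
      using A by (intro ideal_extend_ideal)
    have "{p. \<theta> j * p \<in> ?B} = ?B"
      using reg that mr.subspace_scale[OF B] unfolding regular_on_def by blast
    moreover have "quot_dim (?B \<inter> homogeneous_part i) (?B \<inter> homogeneous_part i) = 0" for i
      by (intro quot_dim_self subspace_Int_homogeneous ideal_imp_linear_subspace B)
    ultimately show ?thesis
      by (simp add: excess_def fps_eq_iff)
  qed
  then have "(\<Sum>j<n. geom ^ Suc j * (fps_X * excess (extend_ideal A \<theta> j) (\<theta> j))) = 0"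
    by (intro sum.neutral) simp
  then show ?thesis
    using hseries_extend_ideal[where \<theta> = \<theta> and n = n, OF A \<theta>] by simp
qed

lemma excess_0_imp_regular:
  assumes A: "mr.subspace A" "graded A" "fin_hilb A" and f: "f \<in> homogeneous_part 1"
    and 0: "excess A f = 0"
  shows "{p. f * p \<in> A} \<subseteq> A"
proof (rule graded_subset_iff[OF A(1)])
  show "graded {p. f * p \<in> A}"
    unfolding graded_def
  proof (intro ballI allI CollectI)
    fix p i
    assume "p \<in> {p. f * p \<in> A}"
    then have "hcomp (i + 1) (f * p) \<in> A"
      using A(2) by (simp add: graded_def)
    then show "f * hcomp i p \<in> A"
      by (simp only: hcomp_mult[OF f])
  qed
  fix i
  have "quot_dim ({p. f * p \<in> A} \<inter> homogeneous_part i) (A \<inter> homogeneous_part i) = 0"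
    using 0 by (simp add: excess_def fps_eq_iff)
  moreover have l: "mv.subspace (A \<inter> homogeneous_part i)"
    using A(1) by (intro subspace_Int_homogeneous ideal_imp_linear_subspace)
  moreover have "quot_finite_dim ({p. f * p \<in> A} \<inter> homogeneous_part i) (A \<inter> homogeneous_part i)"
    using quot_finite_dim_subspace[OF l A(3)[unfolded fin_hilb_def, THEN spec] Int_lower2] .
  ultimately have "{p. f * p \<in> A} \<inter> homogeneous_part i \<subseteq> A \<inter> homogeneous_part i"
    by (intro quot_dim_0_imp_subset)
  then show "{p. f * p \<in> A} \<inter> homogeneous_part i \<subseteq> A"
    by simp
qed

text \<open>By \<open>hseries_extend_ideal\<close> the gap between H and the series of the
  reduction, times 1/(1 - X)^n, and the kernel series add up to 0. The bound makes every summand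
  nonnegative, so all of them vanish.\<close>

lemma hilbert_criterion:
  assumes A: "mr.subspace A" "graded A" "fin_hilb A" and \<theta>: "\<And>j. \<theta> j \<in> homogeneous_part 1"
    and H: "hseries A = geom ^ n * H"
    and le: "\<And>i. int (hilb (extend_ideal A \<theta> n) i) \<le> fps_nth H i"
  shows "hseries (extend_ideal A \<theta> n) = H" "regular_on A \<theta> n"
proof -
  let ?D = "H - hseries (extend_ideal A \<theta> n)"
  let ?E = "\<lambda>j. geom ^ Suc j * (fps_X * excess (extend_ideal A \<theta> j) (\<theta> j))"
  have nnE: "nonneg_fps (?E j)" for j
    by (intro nonneg_fps_mult nonneg_fps_geom_power nonneg_fps_excess)
      (simp add: nonneg_fps_def fps_X_def)
  have "nonneg_fps ?D"
    using le by (simp add: nonneg_fps_def hseries_def)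
  then have nnD: "nonneg_fps (geom ^ n * ?D)"
    by (intro nonneg_fps_mult nonneg_fps_geom_power)
  have "geom ^ n * ?D + (\<Sum>j<n. ?E j) = 0"
    using hseries_extend_ideal[where \<theta> = \<theta> and n = n, OF A \<theta>] H
    unfolding right_diff_distrib by (simp only: diff_add_eq right_minus_eq)
  then have z: "geom ^ n * ?D = 0" "(\<Sum>j<n. ?E j) = 0"
    using nonneg_fps_add_eq_0[OF nnD nonneg_fps_sum[of "{..<n}" ?E]] nnE by blast+
  show "hseries (extend_ideal A \<theta> n) = H"
    using z(1) geom_nonzero by simp
  show "regular_on A \<theta> n"
    unfolding regular_on_def
  proof (intro allI impI)
    fix j p
    assume j: "j < n" and p: "\<theta> j * p \<in> extend_ideal A \<theta> j"
    let ?B = "extend_ideal A \<theta> j"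
    have "?E j = 0"
      using nonneg_fps_sum_eq_0[of "{..<n}" ?E j] nnE z(2) j by blast
    then have "excess ?B (\<theta> j) = 0"
      using geom_nonzero by simp
    moreover have B: "mr.subspace ?B" "graded ?B"
      using A \<theta> by (auto intro: ideal_extend_ideal graded_extend_ideal)
    moreover have "fin_hilb ?B"
      using A B by (intro fin_hilb_mono[OF A(3) _ _ extend_ideal_superset] ideal_imp_linear_subspace)
    ultimately show "p \<in> ?B"
      using excess_0_imp_regular[OF _ _ _ \<theta>, of ?B j] p by blast
  qed
qed

section \<open>The h-polynomial\<close>

text \<open>The h-polynomial of \<Delta> when d is its rank. The exponent d is a parameter so that
  the deletion and the intersection, which may have smaller rank, can enter an inclusion-exclusion
  with \<Delta>.\<close>

definition hpoly :: "nat \<Rightarrow> 'v set set \<Rightarrow> int fps" where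
  "hpoly d \<Delta> = (\<Sum>G\<in>\<Delta>. fps_X ^ card G * (1 - fps_X) ^ (d - card G))"

text \<open>Every vertex of G carries a positive exponent and so contributes X/(1 - X); the
  induction sums over the exponent k of the new vertex.\<close>

lemma card_mons_with_support:
  assumes "finite G"
  shows "finite {m. keys m = G \<and> mon_degree m = i} \<and>
    int (card {m. keys m = G \<and> mon_degree m = i}) = fps_nth ((fps_X * geom) ^ card G) i"
  using assms
proof (induction G arbitrary: i rule: finite_induct)
  case empty
  have "{m :: 'a \<Rightarrow>\<^sub>0 nat. keys m = {} \<and> mon_degree m = i} = (if i = 0 then {0} else {})"
    by (auto simp: mon_degree_def)
  then show ?case
    by simp
next
  case (insert v G)
  let ?M = "\<lambda>G i. {m. keys m = G \<and> mon_degree m = i}"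
  let ?N = "\<lambda>k. (\<lambda>m. m + single v k) ` ?M G (i - k)"
  have eq: "?M (insert v G) i = (\<Union>k\<in>{1..i}. ?N k)"
  proof (intro subset_antisym subsetI)
    fix m
    assume m: "m \<in> ?M (insert v G) i"
    define k where "k = lookup m v"
    define m' where "m' = m - single v k"
    have mm': "m = m' + single v k"
      by (rule poly_mapping_eqI) (auto simp: m'_def k_def lookup_add lookup_minus lookup_single when_def)
    have "lookup m' x = (if x = v then 0 else lookup m x)" for x
      by (auto simp: m'_def k_def lookup_minus lookup_single when_def)
    then have "keys m' = keys m - {v}"
      by (auto simp: in_keys_iff split: if_splits)
    then have "keys m' = G"
      using m insert.hyps by auto
    moreover have "mon_degree m' + k = i"
      using m mm' by (metis (mono_tags, lifting) mem_Collect_eq mon_degree_add mon_degree_single)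
    moreover have "v \<in> keys m"
      using m by simp
    then have "k \<noteq> 0"
      by (simp add: k_def in_keys_iff)
    ultimately have "k \<in> {1..i}" "m' \<in> ?M G (i - k)"
      by auto
    then show "m \<in> (\<Union>k\<in>{1..i}. ?N k)"
      using mm' by blast
  next
    fix m
    assume "m \<in> (\<Union>k\<in>{1..i}. ?N k)"
    then show "m \<in> ?M (insert v G) i"
      by (auto simp: keys_add_nat mon_degree_add)
  qed
  have card: "card (?N k) = card (?M G (i - k))" for k
    by (rule card_image) (auto intro: inj_onI)
  have fin: "finite (?N k)" for k
    using insert.IH by blast
  have "?N k \<inter> ?N l = {}" if "k \<noteq> l" for k l
  proof (rule ccontr)
    assume "?N k \<inter> ?N l \<noteq> {}"
    then obtain m m' where m: "m \<in> ?M G (i - k)" "m' \<in> ?M G (i - l)"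
        "m + single v k = m' + single v l"
      by blast
    then have "v \<notin> keys m" "v \<notin> keys m'"
      using insert.hyps(2) by auto
    then have "lookup m v = 0" "lookup m' v = 0"
      by (simp_all add: in_keys_iff)
    then show False
      using that arg_cong[OF m(3), of "\<lambda>m. lookup m v"] by (simp add: lookup_add)
  qed
  then have "card (\<Union>k\<in>{1..i}. ?N k) = (\<Sum>k\<in>{1..i}. card (?N k))"
    using fin by (intro card_UN_disjoint) auto
  then have "int (card (?M (insert v G) i)) = (\<Sum>k\<in>{1..i}. int (card (?M G (i - k))))"
    using card by (simp add: eq)
  also have "\<dots> = (\<Sum>k\<in>{1..i}. fps_nth ((fps_X * geom) ^ card G) (i - k))"
    using insert.IH by simp
  also have "\<dots> = (\<Sum>k=0..i. fps_nth (fps_X * geom) k * fps_nth ((fps_X * geom) ^ card G) (i - k))"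
    by (intro sum.mono_neutral_cong_left) (auto simp: geom_def)
  also have "\<dots> = fps_nth ((fps_X * geom) ^ card (insert v G)) i"
    using insert.hyps by (simp add: fps_mult_nth)
  finally show ?case
    using fin by (auto simp: eq)
qed

lemma card_face_mons:
  assumes "finite \<Delta>" "\<And>G. G \<in> \<Delta> \<Longrightarrow> finite G"
  shows "int (card (face_mons \<Delta> i)) = fps_nth (\<Sum>G\<in>\<Delta>. (fps_X * geom) ^ card G) i"
proof -
  let ?M = "\<lambda>G. {m. keys m = G \<and> mon_degree m = i}"
  have "face_mons \<Delta> i = (\<Union>G\<in>\<Delta>. ?M G)"
    by (auto simp: face_mons_def)
  moreover have "card (\<Union>G\<in>\<Delta>. ?M G) = (\<Sum>G\<in>\<Delta>. card (?M G))"
    using assms card_mons_with_support by (intro card_UN_disjoint) auto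
  ultimately have "int (card (face_mons \<Delta> i)) = (\<Sum>G\<in>\<Delta>. int (card (?M G)))"
    by simp
  also have "\<dots> = (\<Sum>G\<in>\<Delta>. fps_nth ((fps_X * geom) ^ card G) i)"
    using assms card_mons_with_support by (intro sum.cong) blast+
  finally show ?thesis
    by (simp add: fps_sum_nth)
qed

lemma finite_vertices: "simplicial_complex \<Delta> \<Longrightarrow> finite (vertices \<Delta>)"
  by (auto simp: simplicial_complex_def)

text \<open>Grouping face monomials by support gives (X/(1 - X))^|G| for each face; the common
  denominator (1 - X)^d produces the h-polynomial.\<close>

lemma hseries_nonface_ideal:
  assumes sc: "simplicial_complex \<Delta>" and d: "\<And>G. G \<in> \<Delta> \<Longrightarrow> card G \<le> d"
  shows "hseries (nonface_ideal \<Delta> :: ('v, 'k::field) mpoly set) = geom ^ d * hpoly d \<Delta>"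
proof -
  have "hseries (nonface_ideal \<Delta> :: ('v, 'k) mpoly set) = (\<Sum>G\<in>\<Delta>. (fps_X * geom) ^ card G)"
    using sc hilb_nonface_ideal[where 'k = 'k, OF finite_vertices[OF sc] simplicial_complex_subset_closed[OF sc]]
      card_face_mons[of \<Delta>]
    by (intro fps_ext) (simp add: hseries_def simplicial_complex_def)
  also have "\<dots> = (\<Sum>G\<in>\<Delta>. geom ^ d * (fps_X ^ card G * (1 - fps_X) ^ (d - card G)))"
  proof (rule sum.cong)
    fix G
    assume "G \<in> \<Delta>"
    then have "geom ^ d = geom ^ card G * geom ^ (d - card G)"
      using d by (simp flip: power_add)
    then have "geom ^ d * (fps_X ^ card G * (1 - fps_X) ^ (d - card G)) =
        (fps_X * geom) ^ card G * ((1 - fps_X) * geom) ^ (d - card G)"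
      by (simp add: power_mult_distrib)
    then show "(fps_X * geom) ^ card G = geom ^ d * (fps_X ^ card G * (1 - fps_X) ^ (d - card G))"
      by (simp add: geom_inverse)
  qed simp
  finally show ?thesis
    by (simp add: hpoly_def sum_distrib_left)
qed

lemma fps_nth_one_minus_X_power:
  "fps_nth ((1 - fps_X) ^ n :: int fps) k = (-1) ^ k * int (n choose k)"
proof (induction n arbitrary: k)
  case 0
  show ?case by (cases k) auto
next
  case (Suc n)
  show ?case
    by (cases k) (auto simp: Suc left_diff_distrib algebra_simps)
qed

lemma h_num_eq_hpoly:
  assumes sc: "simplicial_complex \<Delta>"
  shows "h_num \<Delta> i = fps_nth (hpoly (sc_rank \<Delta>) \<Delta>) i"
proof -
  let ?d = "sc_rank \<Delta>"
  let ?t = "\<lambda>j. (-1) ^ (i - j) * int ((?d - j) choose (i - j))"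
  have fin: "finite \<Delta>"
    using sc by (simp add: simplicial_complex_def)
  have "fps_nth (hpoly ?d \<Delta>) i = (\<Sum>G\<in>\<Delta>. if i < card G then 0 else ?t (card G))"
    by (simp add: hpoly_def fps_sum_nth fps_X_power_mult_nth fps_nth_one_minus_X_power cong: if_cong)
  also have "\<dots> = (\<Sum>G\<in>{G \<in> \<Delta>. card G \<le> i}. ?t (card G))"
    using fin by (intro sum.mono_neutral_cong_right) auto
  also have "\<dots> = (\<Sum>j\<le>i. \<Sum>G\<in>{G \<in> {G \<in> \<Delta>. card G \<le> i}. card G = j}. ?t (card G))"
    using fin by (intro sum.group[symmetric]) auto
  also have "\<dots> = (\<Sum>j\<le>i. ?t j * int (f_num \<Delta> j))"
  proof (rule sum.cong)
    fix j
    assume "j \<in> {..i}"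
    then have "{G \<in> {G \<in> \<Delta>. card G \<le> i}. card G = j} = {G \<in> \<Delta>. card G = j}"
      by auto
    then show "(\<Sum>G\<in>{G \<in> {G \<in> \<Delta>. card G \<le> i}. card G = j}. ?t (card G)) = ?t j * int (f_num \<Delta> j)"
      by (simp add: f_num_def)
  qed simp
  finally show ?thesis
    by (simp add: h_num_def)
qed

lemma hpoly_Un_Int:
  "finite A \<Longrightarrow> finite B \<Longrightarrow> hpoly d (A \<union> B) + hpoly d (A \<inter> B) = hpoly d A + hpoly d B"
  unfolding hpoly_def by (rule sum.union_inter)

section \<open>Gluing along an intersection\<close>

text \<open>Separates the part in A from the part in (\<theta>), the latter being
  \<open>extend_ideal {0} \<theta> n\<close>.\<close>

lemma extend_ideal_iff:
  "x \<in> extend_ideal A \<theta> n \<longleftrightarrow> (\<exists>e\<in>A. x - e \<in> extend_ideal {0} \<theta> n)"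
proof
  assume "x \<in> extend_ideal A \<theta> n"
  then obtain e p where e: "x = e + (\<Sum>j<n. \<theta> j * p j)" "e \<in> A"
    by (auto simp: extend_ideal_def)
  then have "x - e \<in> extend_ideal {0} \<theta> n"
    unfolding extend_ideal_def by (intro CollectI exI[of _ 0] exI[of _ p]) simp
  then show "\<exists>e\<in>A. x - e \<in> extend_ideal {0} \<theta> n"
    using e by blast
next
  assume "\<exists>e\<in>A. x - e \<in> extend_ideal {0} \<theta> n"
  then obtain e p where "x - e = (\<Sum>j<n. \<theta> j * p j)" "e \<in> A"
    by (auto simp: extend_ideal_def)
  then show "x \<in> extend_ideal A \<theta> n"
    unfolding extend_ideal_def by (intro CollectI exI[of _ e] exI[of _ p]) (simp add: algebra_simps)
qed

text \<open>For a regular sequence, \<open>A \<inter> (\<theta>) = A (\<theta>)\<close>; this is the vanishing of the first Tor module.\<close>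

lemma regular_on_tor:
  assumes A: "mr.subspace A"
  shows "regular_on A \<theta> n \<Longrightarrow> (\<Sum>j<n. \<theta> j * q j) \<in> A \<Longrightarrow>
    \<exists>g. (\<forall>j. g j \<in> A) \<and> (\<Sum>j<n. \<theta> j * q j) = (\<Sum>j<n. \<theta> j * g j)"
proof (induction n arbitrary: q)
  case 0
  show ?case
    using mr.subspace_0[OF A] by (intro exI[of _ "\<lambda>_. 0"]) simp
next
  case (Suc n)
  let ?x = "\<Sum>j<Suc n. \<theta> j * q j"
  \<comment> \<open>Regularity of the last form replaces q n by an element e of A plus a combination
    of the earlier forms; that combination is absorbed into their coefficients and leaves a shorter
    relation.\<close>
  have "\<theta> n * q n = ?x + (\<Sum>j<n. \<theta> j * (- q j))"
    by (simp add: sum_negf)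
  then have "\<theta> n * q n \<in> extend_ideal A \<theta> n"
    unfolding extend_ideal_def using Suc.prems(2)
    by (intro CollectI exI[of _ ?x] exI[of _ "\<lambda>j. - q j"]) blast
  then have "q n \<in> extend_ideal A \<theta> n"
    using Suc.prems(1) unfolding regular_on_def by blast
  then obtain e s where e: "q n = e + (\<Sum>j<n. \<theta> j * s j)" "e \<in> A"
    by (auto simp: extend_ideal_def)
  have x: "?x = (\<Sum>j<n. \<theta> j * (q j + \<theta> n * s j)) + \<theta> n * e"
    by (simp add: e(1) distrib_left sum.distrib sum_distrib_left mult_ac)
  have te: "\<theta> n * e \<in> A"
    using mr.subspace_scale[OF A e(2)] .
  have "(\<Sum>j<n. \<theta> j * (q j + \<theta> n * s j)) = ?x - \<theta> n * e"
    unfolding x by simp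
  then have "(\<Sum>j<n. \<theta> j * (q j + \<theta> n * s j)) \<in> A"
    using mr.subspace_diff[OF A Suc.prems(2) te] by simp
  moreover have "regular_on A \<theta> n"
    using Suc.prems(1) by (auto simp: regular_on_def)
  ultimately obtain g where g: "\<forall>j. g j \<in> A"
      "(\<Sum>j<n. \<theta> j * (q j + \<theta> n * s j)) = (\<Sum>j<n. \<theta> j * g j)"
    using Suc.IH[of "\<lambda>j. q j + \<theta> n * s j"] by blast
  then show ?case
    using x e(2) by (intro exI[of _ "\<lambda>j. if j < n then g j else e"]) simp
qed

text \<open>The product ideal (\<theta>)J. The quotient of J \<inter> (\<theta>) by it is the first
  Tor module of S/J and S/(\<theta>).\<close>

definition mult_ideal ::
    "('v, 'k::field) mpoly set \<Rightarrow> (nat \<Rightarrow> ('v, 'k) mpoly) \<Rightarrow> nat \<Rightarrow> ('v, 'k) mpoly set" where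
  "mult_ideal J \<theta> n = {\<Sum>j<n. \<theta> j * g j | g. \<forall>j. g j \<in> J}"

lemma subspace_mult_ideal:
  assumes J: "mr.subspace J"
  shows "mv.subspace (mult_ideal J \<theta> n)"
proof (rule ideal_imp_linear_subspace, rule mr.subspaceI)
  show "0 \<in> mult_ideal J \<theta> n"
    unfolding mult_ideal_def using mr.subspace_0[OF J] by (intro CollectI exI[of _ "\<lambda>_. 0"]) simp
  show "x + y \<in> mult_ideal J \<theta> n" if xy: "x \<in> mult_ideal J \<theta> n" "y \<in> mult_ideal J \<theta> n" for x y
  proof -
    obtain g h where "x = (\<Sum>j<n. \<theta> j * g j)" "y = (\<Sum>j<n. \<theta> j * h j)" "\<forall>j. g j \<in> J" "\<forall>j. h j \<in> J"
      using xy by (auto simp: mult_ideal_def)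
    then show ?thesis
      unfolding mult_ideal_def using mr.subspace_add[OF J]
      by (intro CollectI exI[of _ "\<lambda>j. g j + h j"]) (simp add: distrib_left sum.distrib)
  qed
  show "c * x \<in> mult_ideal J \<theta> n" if x: "x \<in> mult_ideal J \<theta> n" for c x
  proof -
    obtain g where "x = (\<Sum>j<n. \<theta> j * g j)" "\<forall>j. g j \<in> J"
      using x by (auto simp: mult_ideal_def)
    then show ?thesis
      unfolding mult_ideal_def using mr.subspace_scale[OF J]
      by (intro CollectI exI[of _ "\<lambda>j. c * g j"]) (simp add: sum_distrib_left mult.left_commute)
  qed
qed

lemma mult_ideal_subset: "mr.subspace J \<Longrightarrow> mult_ideal J \<theta> n \<subseteq> J"
  by (auto simp: mult_ideal_def intro!: mr.subspace_sum mr.subspace_scale)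

lemma mult_ideal_in_principal: "mult_ideal J \<theta> n \<subseteq> extend_ideal {0} \<theta> n"
  by (auto simp: mult_ideal_def extend_ideal_def)

lemma mult_ideal_mono: "J \<subseteq> K \<Longrightarrow> mult_ideal J \<theta> n \<subseteq> mult_ideal K \<theta> n"
  by (auto simp: mult_ideal_def)

lemma ideal_sum_set:
  assumes "mr.subspace A" "mr.subspace B"
  shows "mr.subspace (sum_set A B)"
proof (rule mr.subspaceI)
  show "0 \<in> sum_set A B"
    using subspace_sum_set[OF assms[THEN ideal_imp_linear_subspace]] by (rule mv.subspace_0)
  show "x + y \<in> sum_set A B" if "x \<in> sum_set A B" "y \<in> sum_set A B" for x y
    using subspace_sum_set[OF assms[THEN ideal_imp_linear_subspace]] that by (rule mv.subspace_add)
  show "c * x \<in> sum_set A B" if x: "x \<in> sum_set A B" for c x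
  proof -
    obtain a b where "x = a + b" "a \<in> A" "b \<in> B"
      using x by (auto simp: sum_set_def)
    then show ?thesis
      unfolding sum_set_def using mr.subspace_scale[OF assms(1)] mr.subspace_scale[OF assms(2)]
      by (intro CollectI exI[of _ "c * a"] exI[of _ "c * b"]) (simp add: distrib_left)
  qed
qed

lemma sum_set_upper:
  assumes "mr.subspace A" "mr.subspace B"
  shows "A \<subseteq> sum_set A B" "B \<subseteq> sum_set A B"
  using mr.subspace_0[OF assms(1)] mr.subspace_0[OF assms(2)] by (force simp: sum_set_def)+

lemma mult_ideal_sum_set:
  assumes x: "x \<in> mult_ideal (sum_set A B) \<theta> n"
  shows "x \<in> sum_set (mult_ideal A \<theta> n) (mult_ideal B \<theta> n)"
proof -
  obtain g where g: "x = (\<Sum>j<n. \<theta> j * g j)" "\<And>j. g j \<in> sum_set A B"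
    using x by (auto simp: mult_ideal_def)
  then have "\<forall>j. \<exists>a b. g j = a + b \<and> a \<in> A \<and> b \<in> B"
    by (auto simp: sum_set_def)
  then obtain a b where ab: "\<And>j. g j = a j + b j" "\<And>j. a j \<in> A" "\<And>j. b j \<in> B"
    by metis
  have "x = (\<Sum>j<n. \<theta> j * a j) + (\<Sum>j<n. \<theta> j * b j)"
    by (simp add: g(1) ab(1) distrib_left sum.distrib)
  then show ?thesis
    unfolding sum_set_def mult_ideal_def using ab(2,3) by blast
qed

text \<open>
  The correction term \<open>quot_dim\<close> measures \<open>(I\<^sub>1 + \<theta>) \<inter> (I\<^sub>2 + \<theta>)\<close> modulo
  \<open>I\<^sub>1 \<inter> I\<^sub>2 + \<theta>\<close>. Regularity on \<open>I\<^sub>2\<close> makes it depend on \<open>I\<^sub>1\<close> and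
  \<open>I\<^sub>1 + I\<^sub>2\<close> only.
\<close>

lemma hilb_glue:
  fixes I1 I2 :: "('v, 'k::field) mpoly set"
  assumes I1: "mr.subspace I1" "graded I1" and I2: "mr.subspace I2" "graded I2"
    and \<theta>: "\<And>j. \<theta> j \<in> homogeneous_part 1"
    and fin: "fin_hilb (I1 \<inter> I2)" and reg: "regular_on I2 \<theta> n"
    and J: "J = sum_set I1 I2"
  shows "hilb (extend_ideal (I1 \<inter> I2) \<theta> n) i + hilb (extend_ideal J \<theta> n) i =
    hilb (extend_ideal I1 \<theta> n) i + hilb (extend_ideal I2 \<theta> n) i +
    quot_dim (J \<inter> extend_ideal I1 \<theta> n \<inter> homogeneous_part i)
      (sum_set I1 (mult_ideal J \<theta> n) \<inter> homogeneous_part i)"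
proof -
  let ?T = "extend_ideal {0} \<theta> n"
  let ?X1 = "extend_ideal I1 \<theta> n" and ?X2 = "extend_ideal I2 \<theta> n"
  let ?W = "extend_ideal (I1 \<inter> I2) \<theta> n" and ?W' = "sum_set I1 (mult_ideal J \<theta> n)"
  have T: "mr.subspace ?T" "graded ?T"
    by (intro ideal_extend_ideal graded_extend_ideal \<theta>; auto simp: mr.subspace_def graded_def)+
  have iJ: "mr.subspace J" "graded J" and I12: "mr.subspace (I1 \<inter> I2)"
    using I1 I2 unfolding J by (auto intro: ideal_sum_set graded_sum_set mr.subspace_inter)
  have X: "mr.subspace ?X1" "graded ?X1" "mr.subspace ?X2" "graded ?X2" "mr.subspace ?W"
    using I1 I2 I12 \<theta> by (auto intro: ideal_extend_ideal graded_extend_ideal)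
  note lin = ideal_imp_linear_subspace
  have W_sub: "?W \<subseteq> ?X1 \<inter> ?X2"
    by (auto dest: subsetD[OF extend_ideal_mono, rotated])
  have finW: "fin_hilb ?W"
    by (intro fin_hilb_mono[OF fin _ _ extend_ideal_superset] lin I12 X)
  then have finX: "fin_hilb (?X1 \<inter> ?X2)"
    by (rule fin_hilb_mono[OF _ _ _ W_sub]) (intro lin X mr.subspace_inter)+
  have sumX: "sum_set ?X1 ?X2 = extend_ideal J \<theta> n"
  proof (rule subset_antisym)
    have "?X1 \<subseteq> extend_ideal J \<theta> n" "?X2 \<subseteq> extend_ideal J \<theta> n"
      unfolding J by (intro extend_ideal_mono sum_set_upper I1 I2)+
    then show "sum_set ?X1 ?X2 \<subseteq> extend_ideal J \<theta> n"
      using mr.subspace_add[OF ideal_extend_ideal[OF iJ(1)]] unfolding sum_set_def by blast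
    show "extend_ideal J \<theta> n \<subseteq> sum_set ?X1 ?X2"
    proof (rule extend_ideal_least)
      show "mr.subspace (sum_set ?X1 ?X2)"
        by (intro ideal_sum_set X)
      show "J \<subseteq> sum_set ?X1 ?X2"
        unfolding J sum_set_def
        using extend_ideal_superset[of I1 \<theta> n] extend_ideal_superset[of I2 \<theta> n] by blast
      show "\<theta> j \<in> sum_set ?X1 ?X2" if "j < n" for j
        using generator_in_extend_ideal[OF I1(1) that] sum_set_upper(1)[OF X(1,3)] by blast
    qed
  qed
  have "hilb (?X1 \<inter> ?X2) i + hilb (extend_ideal J \<theta> n) i = hilb ?X1 i + hilb ?X2 i"
    unfolding sumX[symmetric] by (intro hilb_modular lin X finX)
  moreover have "hilb ?W i = hilb (?X1 \<inter> ?X2) i +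
      quot_dim ((?X1 \<inter> ?X2) \<inter> homogeneous_part i) (?W \<inter> homogeneous_part i)"
    by (intro hilb_add finW lin X W_sub mr.subspace_inter)
  \<comment> \<open>The correction is carried over to J \<inter> (I1 + (\<theta>)) modulo I1 +
    (\<theta>)J, where I2 occurs only through J. An element c of both extended ideals corresponds to
    x when some b in I2 is congruent to c modulo (\<theta>) and to x modulo I1. By the modular law
    the new quotient is the cokernel of (I1 \<inter> (\<theta>))/(\<theta>)I1 \<rightarrow> (J
    \<inter> (\<theta>))/(\<theta>)J.\<close>
  moreover have "quot_dim (J \<inter> ?X1 \<inter> homogeneous_part (i + 0)) (?W' \<inter> homogeneous_part (i + 0)) =
      quot_dim ((?X1 \<inter> ?X2) \<inter> homogeneous_part i) (?W \<inter> homogeneous_part i)"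
  proof (rule quot_dim_graded_relation[where R = "\<lambda>c x. \<exists>b\<in>I2. c - b \<in> ?T \<and> x - b \<in> I1"])
    show "mv.subspace (?X1 \<inter> ?X2)" "mv.subspace ?W" "mv.subspace (J \<inter> ?X1)"
      by (intro lin X mr.subspace_inter iJ)+
    show "mv.subspace ?W'"
      by (intro subspace_sum_set subspace_mult_ideal lin I1 iJ)
    show "graded (?X1 \<inter> ?X2)" "graded (J \<inter> ?X1)"
      by (intro graded_Int X iJ)+
    show "quot_finite_dim (?X1 \<inter> ?X2 \<inter> homogeneous_part i) (?W \<inter> homogeneous_part i)"
      by (rule quot_finite_dim_subspace[OF subspace_Int_homogeneous[OF lin[OF X(5)]]
            finW[unfolded fin_hilb_def, THEN spec] Int_lower2])
  next
    fix x y x' y'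
    assume "\<exists>b\<in>I2. x - b \<in> ?T \<and> y - b \<in> I1" "\<exists>b\<in>I2. x' - b \<in> ?T \<and> y' - b \<in> I1"
    then obtain b b' where "b \<in> I2" "x - b \<in> ?T" "y - b \<in> I1" "b' \<in> I2" "x' - b' \<in> ?T" "y' - b' \<in> I1"
      by blast
    then show "\<exists>b\<in>I2. x + x' - b \<in> ?T \<and> y + y' - b \<in> I1"
      using mr.subspace_add[OF T(1), of "x - b" "x' - b'"] mr.subspace_add[OF I1(1), of "y - b" "y' - b'"]
        mr.subspace_add[OF I2(1)]
      by (intro bexI[of _ "b + b'"]) (auto simp: algebra_simps)
  next
    fix c x y
    assume "\<exists>b\<in>I2. x - b \<in> ?T \<and> y - b \<in> I1"
    then obtain b where "b \<in> I2" "x - b \<in> ?T" "y - b \<in> I1"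
      by blast
    then show "\<exists>b\<in>I2. scalar_mult c x - b \<in> ?T \<and> scalar_mult c y - b \<in> I1"
      using mv.subspace_scale[OF lin[OF T(1)], of "x - b" c] mv.subspace_scale[OF lin[OF I1(1)], of "y - b" c]
        mv.subspace_scale[OF lin[OF I2(1)]]
      by (intro bexI[of _ "scalar_mult c b"]) (auto simp: mv.scale_right_diff_distrib)
  next
    fix x y
    assume "\<exists>b\<in>I2. x - b \<in> ?T \<and> y - b \<in> I1"
    then obtain b where b: "b \<in> I2" "x - b \<in> ?T" "y - b \<in> I1"
      by blast
    then have "hcomp i (x - b) \<in> ?T" "hcomp i (y - b) \<in> I1" "hcomp i b \<in> I2"
      using T I1 I2 unfolding graded_def by blast+
    then show "\<exists>b\<in>I2. hcomp i x - b \<in> ?T \<and> hcomp (i + 0) y - b \<in> I1"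
      by (intro bexI[of _ "hcomp i b"]) (auto simp: restrict_mons_diff)
  next
    fix c
    assume c: "c \<in> ?X1 \<inter> ?X2"
    then obtain b where b: "b \<in> I2" "c - b \<in> ?T"
      using extend_ideal_iff[of c I2] by blast
    have "?T \<subseteq> ?X1"
      using mr.subspace_0[OF I1(1)] by (intro extend_ideal_mono) simp
    then have "c - b \<in> ?X1"
      using b(2) by blast
    then have "c - (c - b) \<in> ?X1"
      using mr.subspace_diff[OF X(1), of c "c - b"] c by blast
    then have "b \<in> J \<inter> ?X1"
      using b sum_set_upper[OF I1(1) I2(1)] unfolding J by auto
    then show "\<exists>x\<in>J \<inter> ?X1. \<exists>b\<in>I2. c - b \<in> ?T \<and> x - b \<in> I1"
      using b mr.subspace_0[OF I1(1)] by (intro bexI[of _ b]) auto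
  next
    fix x
    assume x: "x \<in> J \<inter> ?X1"
    then obtain a b where ab: "x = a + b" "a \<in> I1" "b \<in> I2"
      unfolding J by (auto simp: sum_set_def)
    then have "x - a \<in> ?X1"
      using x extend_ideal_superset[of I1 \<theta> n] by (intro mr.subspace_diff[OF X(1)]) auto
    then have "b \<in> ?X1 \<inter> ?X2"
      using ab extend_ideal_superset[of I2 \<theta> n] by auto
    then show "\<exists>c\<in>?X1 \<inter> ?X2. \<exists>b\<in>I2. c - b \<in> ?T \<and> x - b \<in> I1"
      using ab mr.subspace_0[OF T(1)] by (intro bexI[of _ b]) auto
  next
    fix c x
    assume "\<exists>b\<in>I2. c - b \<in> ?T \<and> x - b \<in> I1"
    then obtain b where b: "b \<in> I2" "c - b \<in> ?T" "x - b \<in> I1"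
      by blast
    show "c \<in> ?W \<longleftrightarrow> x \<in> ?W'"
    proof
      assume "c \<in> ?W"
      then obtain e where e: "e \<in> I1" "e \<in> I2" "c - e \<in> ?T"
        using extend_ideal_iff[of c "I1 \<inter> I2"] by blast
      \<comment> \<open>Both b and e lie in I2 and are congruent to c modulo (\<theta>), so b - e is
        in I2 \<inter> (\<theta>); regularity puts it into (\<theta>)I2.\<close>
      have "b - e \<in> ?T"
        using mr.subspace_diff[OF T(1) e(3) b(2)] by simp
      then obtain q where q: "b - e = (\<Sum>j<n. \<theta> j * q j)"
        by (auto simp: extend_ideal_def)
      moreover have "b - e \<in> I2"
        using b e by (intro mr.subspace_diff[OF I2(1)])
      ultimately obtain g where g: "\<forall>j. g j \<in> I2" "b - e = (\<Sum>j<n. \<theta> j * g j)"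
        using regular_on_tor[OF I2(1) reg, of q] by auto
      have "b - e \<in> mult_ideal I2 \<theta> n"
        unfolding mult_ideal_def using g by blast
      then have m: "b - e \<in> mult_ideal J \<theta> n"
        unfolding J using mult_ideal_mono[OF sum_set_upper(2)[OF I1(1) I2(1)]] by blast
      have "(x - b) + e \<in> I1"
        using b(3) e(1) by (rule mr.subspace_add[OF I1(1)])
      moreover have "x = ((x - b) + e) + (b - e)"
        by simp
      ultimately show "x \<in> ?W'"
        unfolding sum_set_def using m by blast
    next
      assume "x \<in> ?W'"
      then obtain a t where at: "x = a + t" "a \<in> I1" "t \<in> mult_ideal J \<theta> n"
        by (auto simp: sum_set_def)
      \<comment> \<open>The part of t in (\<theta>)I1 is absorbed by I1; subtracting the part in
        (\<theta>)I2 from b leaves an element of I1 \<inter> I2 that is still congruent to c modulo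
        (\<theta>).\<close>
      then obtain t1 t2 where t: "t = t1 + t2" "t1 \<in> mult_ideal I1 \<theta> n" "t2 \<in> mult_ideal I2 \<theta> n"
        using mult_ideal_sum_set unfolding J by (fastforce simp: sum_set_def)
      have "t1 \<in> I1" "t2 \<in> I2"
        using t mult_ideal_subset I1 I2 by blast+
      have "a + t1 - (x - b) \<in> I1"
        using mr.subspace_diff[OF I1(1) mr.subspace_add[OF I1(1) at(2) \<open>t1 \<in> I1\<close>] b(3)] .
      then have "b - t2 \<in> I1"
        by (simp add: at(1) t(1) algebra_simps)
      moreover have "b - t2 \<in> I2"
        using b(1) \<open>t2 \<in> I2\<close> by (rule mr.subspace_diff[OF I2(1)])
      moreover have "c - b + t2 \<in> ?T"
        using mr.subspace_add[OF T(1) b(2) subsetD[OF mult_ideal_in_principal t(3)]] .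
      then have "c - (b - t2) \<in> ?T"
        by (simp add: algebra_simps)
      ultimately show "c \<in> ?W"
        using extend_ideal_iff[of c "I1 \<inter> I2"] by blast
    qed
  qed
  ultimately show ?thesis
    by simp
qed

section \<open>Generic linear forms\<close>

lemma hilb_extend_ideal_0:
  assumes "mr.subspace A" "graded A" "\<And>j. \<theta> j \<in> homogeneous_part 1"
  shows "hilb (extend_ideal A \<theta> n) 0 = hilb A 0"
proof (induction n)
  case (Suc n)
  have "hilb (adjoin (extend_ideal A \<theta> n) (\<theta> n)) 0 = hilb (extend_ideal A \<theta> n) 0"
    using assms by (intro hilb_adjoin_low[where k = 1] ideal_extend_ideal graded_extend_ideal) auto
  then show ?case
    using Suc by (simp add: extend_ideal_Suc)
qed simp

lemma linear_form_on_times_single: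
  "linear_form_on V a j * single m 1 =
    (\<Sum>v\<in>V. single (single v 1 + m) (a (j, v)))"
  by (simp add: linear_form_on_def sum_distrib_right scalar_mult_def indet_def mult_single)

lemma nonface_ideal_iff_lookup:
  assumes "p \<in> homogeneous_part i"
  shows "p \<in> nonface_ideal \<Delta> \<longleftrightarrow> (\<forall>x\<in>face_mons \<Delta> i. lookup p x = 0)"
proof -
  have "mon_degree m = i" if "lookup p m \<noteq> 0" for m
    using assms that by (simp add: homogeneous_part_def in_keys_iff)
  then show ?thesis
    unfolding nonface_ideal_def face_mons_def by (auto simp: in_keys_iff)
qed

text \<open>In degree k + 1 the reduction is S/I divided by the span of all products of a form with
  a face monomial of degree k. The coordinates of these products are polynomial in a, so a subfamily
  independent at a0 stays independent wherever a suitable f is nonzero, and the quotient there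
  cannot be larger. The polynomial f depends on the degree.\<close>

lemma hilb_semicontinuous:
  fixes a0 :: "nat \<times> 'v \<Rightarrow> 'k::field"
  assumes sc: "simplicial_complex \<Delta>"
  shows "\<exists>f. polyfun ({..<n} \<times> vertices \<Delta>) f \<and> f a0 \<noteq> 0 \<and>
    (\<forall>a. f a \<noteq> 0 \<longrightarrow> hilb (face_ideal \<Delta> a n) i \<le> hilb (face_ideal \<Delta> a0 n) i)"
proof -
  let ?I = "nonface_ideal \<Delta> :: ('v, 'k) mpoly set"
  note cl = simplicial_complex_subset_closed[OF sc] and fv = finite_vertices[OF sc]
  define lf :: "(nat \<times> 'v \<Rightarrow> 'k) \<Rightarrow> nat \<Rightarrow> ('v, 'k) mpoly" where "lf = linear_form_on (vertices \<Delta>)"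
  define X where "X = (\<lambda>a. extend_ideal ?I (lf a) n)"
  have fi: "face_ideal \<Delta> a n = X a" for a
    by (simp add: X_def lf_def face_ideal_eq[OF cl] linear_form_eq)
  have lf: "lf a j \<in> homogeneous_part 1" for a j
    unfolding lf_def by (rule linear_form_on_homogeneous)
  have I: "mr.subspace ?I" "graded ?I" "fin_hilb ?I"
    by (intro ideal_nonface_ideal graded_nonface_ideal fin_hilb_nonface_ideal cl fv)+
  have X: "mr.subspace (X a)" "graded (X a)" for a
    unfolding X_def by (intro ideal_extend_ideal graded_extend_ideal I lf)+
  note lin = ideal_imp_linear_subspace
  have IX: "?I \<subseteq> X a" for a
    unfolding X_def by (rule extend_ideal_superset)
  show ?thesis
  proof (cases i)
    case 0
    \<comment> \<open>Linear forms contribute nothing in degree 0.\<close>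
    have "hilb (X a) 0 = hilb ?I 0" for a
      unfolding X_def by (rule hilb_extend_ideal_0[OF I(1,2) lf])
    then show ?thesis
      using 0 by (intro exI[of _ "\<lambda>_. 1"]) (auto simp: fi intro: polyfun_const)
  next
    case (Suc k)
    define S :: "('v, 'k) mpoly set" where "S = homogeneous_part (Suc k)"
    define u :: "(nat \<times> 'v \<Rightarrow> 'k) \<Rightarrow> nat \<times> ('v \<Rightarrow>\<^sub>0 nat) \<Rightarrow> ('v, 'k) mpoly"
      where "u = (\<lambda>a (j, m). lf a j * single m 1)"
    define T where "T = {..<n} \<times> face_mons \<Delta> k"
    have finT: "finite T"
      unfolding T_def using finite_face_mons[OF fv] by blast
    have IS: "mv.subspace (?I \<inter> S)" and XS: "mv.subspace (X a \<inter> S)" for a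
      unfolding S_def by (intro subspace_Int_homogeneous lin I X)+
    have uXS: "u a t \<in> X a \<inter> S" if tT: "t \<in> T" for a t
    proof -
      obtain j m where t: "t = (j, m)" "j < n" "m \<in> face_mons \<Delta> k"
        using tT unfolding T_def by blast
      have "single m 1 * lf a j \<in> X a"
        unfolding X_def by (intro mr.subspace_scale[OF ideal_extend_ideal[OF I(1)]]
            generator_in_extend_ideal[OF I(1) t(2)])
      moreover have "lf a j * single m 1 \<in> homogeneous_part (1 + k)"
        using t(3) single_homogeneous[of m 1] by (intro homogeneous_part_mult lf) (auto simp: face_mons_def)
      ultimately show ?thesis
        by (simp add: u_def t S_def mult.commute)
    qed
    have span: "X a \<inter> S \<subseteq> mv.span (u a ` T \<union> (?I \<inter> S))" for a
    proof
      fix x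
      assume x: "x \<in> X a \<inter> S"
      then obtain e p where e: "x = e + (\<Sum>j<n. lf a j * p j)" "e \<in> ?I"
        unfolding X_def extend_ideal_def by blast
      have hsum: "hcomp l (\<Sum>j\<in>Z. g j) = (\<Sum>j\<in>Z. hcomp l (g j))" for l Z and g :: "nat \<Rightarrow> ('v, 'k) mpoly"
        by (induction Z rule: infinite_finite_induct) (auto simp: restrict_mons_add)
      have "x = hcomp (Suc k) x"
        using x by (simp add: S_def hcomp_id)
      also have "\<dots> = hcomp (Suc k) e + (\<Sum>j<n. hcomp (k + 1) (lf a j * p j))"
        by (simp add: e(1) restrict_mons_add hsum)
      also have "\<dots> = hcomp (Suc k) e + (\<Sum>j<n. lf a j * hcomp k (p j))"
        by (simp only: hcomp_mult[OF lf])
      finally have xe: "x = hcomp (Suc k) e + (\<Sum>j<n. lf a j * hcomp k (p j))" .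
      have "lf a j * hcomp k (p j) \<in> mv.span (u a ` T \<union> (?I \<inter> S))" if j: "j < n" for j
      proof -
        let ?s = "\<lambda>m. single m (1::'k)"
        \<comment> \<open>Modulo I a cofactor is a combination of face monomials, which is why
          finitely many products span.\<close>
        obtain c where c: "hcomp k (p j) - (\<Sum>b\<in>?s ` face_mons \<Delta> k. scalar_mult (c b) b) \<in> ?I \<inter> homogeneous_part k"
          using basis_mod_nonface_ideal[OF fv cl, where i = k and 'k = 'k] hcomp_in[of k "p j"]
          unfolding basis_mod_def by blast
        let ?b = "\<Sum>b\<in>?s ` face_mons \<Delta> k. scalar_mult (c b) b"
        let ?r = "hcomp k (p j) - ?b"
        have "lf a j * ?r \<in> homogeneous_part (1 + k)"
          using c by (intro homogeneous_part_mult lf) auto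
        then have "lf a j * ?r \<in> ?I \<inter> S"
          using c mr.subspace_scale[OF I(1)] by (auto simp: S_def)
        then have "lf a j * ?r \<in> mv.span (u a ` T \<union> (?I \<inter> S))"
          by (intro mv.span_base) auto
        moreover have "lf a j * ?b = (\<Sum>b\<in>?s ` face_mons \<Delta> k. scalar_mult (c b) (lf a j * b))"
          by (simp add: sum_distrib_left scalar_mult_def mult.left_commute)
        moreover have "lf a j * b \<in> u a ` T" if "b \<in> ?s ` face_mons \<Delta> k" for b
          using that j by (force simp: u_def T_def)
        then have "(\<Sum>b\<in>?s ` face_mons \<Delta> k. scalar_mult (c b) (lf a j * b)) \<in> mv.span (u a ` T \<union> (?I \<inter> S))"
          by (intro mv.span_sum mv.span_scale mv.span_base) blast
        ultimately have "lf a j * ?r + lf a j * ?b \<in> mv.span (u a ` T \<union> (?I \<inter> S))"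
          by (intro mv.span_add) simp_all
        then show ?thesis
          by (simp add: right_diff_distrib)
      qed
      moreover have "hcomp (Suc k) e \<in> ?I \<inter> S"
        using e(2) I(2) hcomp_in[of "Suc k" e] by (auto simp: graded_def S_def)
      ultimately show "x \<in> mv.span (u a ` T \<union> (?I \<inter> S))"
        by (subst xe) (intro mv.span_add mv.span_sum; auto intro: mv.span_base)
    qed
    have iff: "(\<Sum>t\<in>T'. scalar_mult (c t) (u a t)) \<in> ?I \<inter> S \<longleftrightarrow>
        (\<forall>x\<in>face_mons \<Delta> (Suc k). (\<Sum>t\<in>T'. c t * lookup (u a t) x) = 0)"
      if T': "T' \<subseteq> T" for T' c a
    proof -
      let ?p = "\<Sum>t\<in>T'. scalar_mult (c t) (u a t)"
      have pS: "?p \<in> S"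
        using uXS T' unfolding S_def
        by (intro mv.subspace_sum mv.subspace_scale subspace_homogeneous_part) auto
      have "?p \<in> ?I \<longleftrightarrow> (\<forall>x\<in>face_mons \<Delta> (Suc k). lookup ?p x = 0)"
        using pS unfolding S_def by (rule nonface_ideal_iff_lookup)
      then show ?thesis
        using pS by (simp add: lookup_sum)
    qed
    obtain B where B: "B \<subseteq> u a0 ` T" "basis_mod (X a0 \<inter> S) (?I \<inter> S) B"
      using spanning_contains_basis_mod[OF IS _ _ span[of a0]] uXS finT by blast
    \<comment> \<open>The basis consists of polynomials at the point a0; in order to move a, it is
      replaced by a set of indices, one for each member.\<close>
    then obtain T' where T': "T' \<subseteq> T" "inj_on (u a0) T'" "B = u a0 ` T'"
      using subset_image_inj[of B "u a0" T] by blast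
    have finT': "finite T'"
      using T'(1) finT finite_subset by blast
    have "indep_family T' (face_mons \<Delta> (Suc k)) (\<lambda>t. lookup (u a0 t))"
      unfolding indep_family_def
    proof (intro allI impI)
      fix c
      assume "\<forall>x\<in>face_mons \<Delta> (Suc k). (\<Sum>t\<in>T'. c t * lookup (u a0 t) x) = 0"
      then have "(\<Sum>t\<in>T'. scalar_mult (c t) (u a0 t)) \<in> ?I \<inter> S"
        using iff[OF T'(1)] by blast
      moreover have "(\<Sum>b\<in>B. scalar_mult (c (inv_into T' (u a0) b)) b) = (\<Sum>t\<in>T'. scalar_mult (c t) (u a0 t))"
        by (simp add: T'(3) sum.reindex[OF T'(2)] inv_into_f_f[OF T'(2)])
      ultimately have "(\<Sum>b\<in>B. scalar_mult (c (inv_into T' (u a0) b)) b) \<in> ?I \<inter> S"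
        by simp
      then have "\<forall>b\<in>B. c (inv_into T' (u a0) b) = 0"
        using indep_modD[where c = "\<lambda>b. c (inv_into T' (u a0) b)" and W = "?I \<inter> S" and B = B] B(2)
        unfolding basis_mod_iff[OF IS] by blast
      then show "\<forall>t\<in>T'. c t = 0"
        using T'(2,3) by (simp add: inv_into_f_f)
    qed
    moreover have "polyfun ({..<n} \<times> vertices \<Delta>) (\<lambda>a. lookup (u a t) x)" if "t \<in> T'" for t x
    proof -
      obtain j m where t: "t = (j, m)" "j < n"
        using \<open>t \<in> T'\<close> T'(1) unfolding T_def by blast
      have "lookup (u a t) x =
          (\<Sum>v\<in>vertices \<Delta>. a (j, v) * (if single v 1 + m = x then 1 else 0))" for a
        by (auto simp: t u_def lf_def linear_form_on_times_single lookup_sum lookup_single when_def intro!: sum.cong)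
      then show ?thesis
        using t(2) by (auto intro!: polyfun_sum polyfun_mult polyfun_var polyfun_const)
    qed
    ultimately have "\<exists>f. polyfun ({..<n} \<times> vertices \<Delta>) f \<and> f a0 \<noteq> 0 \<and>
        (\<forall>a. f a \<noteq> 0 \<longrightarrow> indep_family T' (face_mons \<Delta> (Suc k)) (\<lambda>t. lookup (u a t)))"
      using indep_family_open[where u = "\<lambda>a t. lookup (u a t)" and ?a0.0 = a0, OF finT'] by blast
    then obtain f where f: "polyfun ({..<n} \<times> vertices \<Delta>) f" "f a0 \<noteq> 0"
        "\<And>a. f a \<noteq> 0 \<Longrightarrow> indep_family T' (face_mons \<Delta> (Suc k)) (\<lambda>t. lookup (u a t))"
      by blast
    have "hilb (X a) i \<le> hilb (X a0) i" if fa: "f a \<noteq> 0" for a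
    proof -
      have add: "hilb ?I i = hilb (X b) i + quot_dim (X b \<inter> S) (?I \<inter> S)" for b
        unfolding S_def Suc by (intro hilb_add lin I X IX)
      obtain C where C: "basis_mod (X a \<inter> S) (?I \<inter> S) C"
        using quot_finite_dim_subspace[OF IS, of S "X a \<inter> S"] I(3)
        unfolding fin_hilb_def S_def quot_finite_dim_def by blast
      have "card T' \<le> card C"
      proof (rule indep_mod_card_le[where u = "u a" and V = "X a \<inter> S" and W = "?I \<inter> S"])
        show "\<forall>t\<in>T'. c t = 0" if "(\<Sum>t\<in>T'. scalar_mult (c t) (u a t)) \<in> ?I \<inter> S" for c
          using f(3)[OF fa] iff[OF T'(1), of c a] that unfolding indep_family_def by blast
      qed (use IS C finT' uXS T'(1) in \<open>auto simp: basis_mod_iff\<close>)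
      moreover have "card T' = card B"
        using T'(2,3) by (simp add: card_image)
      ultimately have "quot_dim (X a0 \<inter> S) (?I \<inter> S) \<le> quot_dim (X a \<inter> S) (?I \<inter> S)"
        by (simp add: quot_dim_eq[OF IS B(2)] quot_dim_eq[OF IS C])
      then show ?thesis
        using add[of a] add[of a0] by simp
    qed
    then show ?thesis
      using f(1,2) fi by auto
  qed
qed

section \<open>Vanishing above the rank, and generic linear systems of parameters\<close>

lemma ideal_face_ideal: "mr.subspace (face_ideal \<Delta> a n)"
  unfolding face_ideal_def ideal_gen_def by (rule mr.subspace_span)

lemma fin_hilb_face_ideal: "simplicial_complex \<Delta> \<Longrightarrow> fin_hilb (face_ideal \<Delta> a n)"
  by (simp add: face_ideal_eq simplicial_complex_subset_closed fin_hilb_extend_nonface_ideal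
      finite_vertices)

lemma homogeneous_subset_Suc:
  fixes A :: "('v, 'k::field) mpoly set"
  assumes A: "mr.subspace A" and "homogeneous_part N \<subseteq> A"
  shows "homogeneous_part (Suc N) \<subseteq> A"
proof
  fix p :: "('v, 'k) mpoly"
  assume p: "p \<in> homogeneous_part (Suc N)"
  have "single m (lookup p m) \<in> A" if m: "m \<in> keys p" for m
  proof -
    have deg: "mon_degree m = Suc N"
      using p m by (simp add: homogeneous_part_def)
    then have "keys m \<noteq> {}"
      by (auto simp: mon_degree_def)
    then obtain v where v: "v \<in> keys m"
      by blast
    let ?m = "m - single v 1"
    have eq: "m = single v 1 + ?m"
      using v by (intro poly_mapping_eqI) (auto simp: lookup_add lookup_minus lookup_single when_def in_keys_iff)
    then have "mon_degree ?m = N"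
      using deg mon_degree_add[of "single v 1" ?m] by simp
    then have "single ?m (lookup p m) \<in> A"
      using assms(2) single_homogeneous[of ?m] by auto
    then have "indet v * single ?m (lookup p m) \<in> A"
      by (rule mr.subspace_scale[OF A])
    also have "indet v * single ?m (lookup p m) =
        single (single v 1 + ?m) (lookup p m)"
      by (simp add: indet_def mult_single)
    finally show ?thesis
      using eq by simp
  qed
  then have "(\<Sum>m\<in>keys p. single m (lookup p m)) \<in> A"
    by (intro mr.subspace_sum[OF A])
  then show "p \<in> A"
    using poly_mapping_sum_single[of "keys p" p] by simp
qed

lemma homogeneous_subset_mono:
  assumes "mr.subspace A" "homogeneous_part N \<subseteq> A" "N \<le> i"
  shows "homogeneous_part i \<subseteq> A"
  using assms(3)
proof (induction rule: dec_induct)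
  case base
  show ?case by (rule assms(2))
next
  case (step i)
  then show ?case by (intro homogeneous_subset_Suc[OF assms(1)])
qed

lemma hilb_eq_0_iff:
  assumes "mr.subspace A" "fin_hilb A"
  shows "hilb A i = 0 \<longleftrightarrow> homogeneous_part i \<subseteq> A"
proof
  have l: "mv.subspace (A \<inter> homogeneous_part i)"
    by (intro subspace_Int_homogeneous ideal_imp_linear_subspace assms)
  show "homogeneous_part i \<subseteq> A" if "hilb A i = 0"
    using quot_dim_0_imp_subset[OF l, of "homogeneous_part i"] that assms(2)
    by (simp add: hilb_def fin_hilb_def)
  show "hilb A i = 0" if "homogeneous_part i \<subseteq> A"
    using quot_dim_self[OF subspace_homogeneous_part, of i] that by (simp add: hilb_def Int_absorb1)
qed

text \<open>Vanishing in one degree persists in all higher ones, so finitely many face monomials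
  span the quotient.\<close>

lemma top_vanish_imp_lsop:
  assumes sc: "simplicial_complex \<Delta>"
    and top: "homogeneous_part (Suc d) \<subseteq> face_ideal \<Delta> a (sc_rank \<Delta>)"
  shows "is_lsop \<Delta> a"
proof -
  let ?X = "face_ideal \<Delta> a (sc_rank \<Delta>)"
  note cl = simplicial_complex_subset_closed[OF sc] and fv = finite_vertices[OF sc]
  define B where "B = (\<Union>i\<le>d. (\<lambda>m. single m (1::'b)) ` face_mons \<Delta> i)"
  have IX: "nonface_ideal \<Delta> \<subseteq> ?X"
    using extend_ideal_superset by (simp add: face_ideal_eq[OF cl])
  have "hcomp i p \<in> mv.span (B \<union> ?X)" for i and p :: "('a, 'b) mpoly"
  proof (cases "i \<le> d")
    case True
    have "hcomp i p \<in> mv.span ((\<lambda>m. single m 1) ` face_mons \<Delta> i \<union> (nonface_ideal \<Delta> \<inter> homogeneous_part i))"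
      using basis_mod_nonface_ideal[OF fv cl, of i] hcomp_in[of i p]
      by (subst (asm) basis_mod_iff)
        (auto intro: subspace_Int_homogeneous ideal_imp_linear_subspace ideal_nonface_ideal cl)
    also have "\<dots> \<subseteq> mv.span (B \<union> ?X)"
      using IX True by (intro mv.span_mono) (auto simp: B_def)
    finally show ?thesis .
  next
    case False
    then have "homogeneous_part i \<subseteq> ?X"
      by (intro homogeneous_subset_mono[OF ideal_face_ideal top]) simp
    then show ?thesis
      using hcomp_in[of i p] by (intro mv.span_base) blast
  qed
  then have "(\<Sum>i\<in>mon_degree ` keys p. hcomp i p) \<in> mv.span (B \<union> ?X)" for p
    by (intro mv.span_sum)
  then have "UNIV \<subseteq> mv.span (B \<union> ?X)"
    using sum_hcomp by (metis subsetI)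
  moreover have "finite B"
    using finite_face_mons[OF fv] by (auto simp: B_def)
  ultimately show ?thesis
    unfolding is_lsop_def
    by (intro quot_dim_le_card(1) ideal_imp_linear_subspace ideal_face_ideal) auto
qed

lemma card_le_sc_rank: "simplicial_complex \<Delta> \<Longrightarrow> G \<in> \<Delta> \<Longrightarrow> card G \<le> sc_rank \<Delta>"
  by (simp add: simplicial_complex_def sc_rank_def)

text \<open>
  A Vandermonde matrix of coefficients: by Lagrange interpolation, modulo \<open>\<theta>\<close> each \<open>x\<^sub>v\<close> with
  \<open>v \<in> G\<close> is a combination of the variables outside \<open>G\<close>. This trades a repeated
  variable of a monomial for a larger support.
\<close>

lemma top_vanish_exists:
  assumes inf: "infinite (UNIV :: 'k::field set)" and sc: "simplicial_complex (\<Delta> :: 'v set set)"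
  shows "\<exists>a :: nat \<times> 'v \<Rightarrow> 'k. homogeneous_part (Suc (sc_rank \<Delta>)) \<subseteq> face_ideal \<Delta> a (sc_rank \<Delta>)"
proof -
  let ?d = "sc_rank \<Delta>"
  note cl = simplicial_complex_subset_closed[OF sc] and fv = finite_vertices[OF sc]
  obtain K :: "'k set" where K: "finite K" "card K = card (vertices \<Delta>)"
    using infinite_arbitrarily_large[OF inf] by blast
  obtain t :: "'v \<Rightarrow> 'k" where "bij_betw t (vertices \<Delta>) K"
    using finite_same_card_bij[OF fv K(1)] K(2) by auto
  then have inj: "inj_on t (vertices \<Delta>)"
    by (simp add: bij_betw_def)
  define a :: "nat \<times> 'v \<Rightarrow> 'k" where "a = (\<lambda>(j, v). t v ^ j)"
  let ?X = "face_ideal \<Delta> a ?d" and ?I = "nonface_ideal \<Delta> :: ('v, 'k) mpoly set"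
  have X: "mr.subspace ?X"
    by (rule ideal_face_ideal)
  have IX: "?I \<subseteq> ?X"
    using extend_ideal_superset by (simp add: face_ideal_eq[OF cl])
  have lfX: "linear_form \<Delta> a j \<in> ?X" if "j < ?d" for j
    using that generator_in_extend_ideal[OF ideal_nonface_ideal[OF cl]] by (simp add: face_ideal_eq[OF cl])
  have poly_form: "(\<Sum>w\<in>vertices \<Delta>. scalar_mult (poly q (t w)) (indet w)) \<in> ?X"
    if q: "degree q < ?d" for q
  proof -
    have "(\<Sum>w\<in>vertices \<Delta>. scalar_mult (poly q (t w)) (indet w)) =
        (\<Sum>w\<in>vertices \<Delta>. \<Sum>j\<le>degree q. scalar_mult (coeff q j * t w ^ j) (indet w))"
      by (simp add: poly_altdef mv.scale_sum_left)
    also have "\<dots> = (\<Sum>j\<le>degree q. scalar_mult (coeff q j) (linear_form \<Delta> a j))"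
      by (subst sum.swap) (simp add: linear_form_def mv.scale_sum_right a_def)
    also have "\<dots> \<in> ?X"
      using q lfX ideal_imp_linear_subspace[OF X] by (intro mv.subspace_sum mv.subspace_scale) auto
    finally show ?thesis .
  qed
  have mon: "single m 1 \<in> ?X" if "mon_degree m = Suc ?d" for m
    using that
  \<comment> \<open>Each exchange enlarges the support, and with more than d vertices it can no
    longer be a face.\<close>
  proof (induction "Suc ?d - card (keys m)" arbitrary: m rule: less_induct)
    case less
    let ?G = "keys m"
    show ?case
    proof (cases "?G \<in> \<Delta>")
      case False
      then have "single m 1 \<in> ?I"
        by (simp add: nonface_ideal_def)
      then show ?thesis
        using IX by blast
    next
      case True
      have cG: "card ?G \<le> ?d"
        by (rule card_le_sc_rank[OF sc True])
      \<comment> \<open>Degree d + 1 on at most d vertices forces a repeated variable; removing one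
        copy keeps the support.\<close>
      have "\<exists>v\<in>?G. lookup m v \<ge> 2"
      proof (rule ccontr)
        assume "\<not> (\<exists>v\<in>?G. lookup m v \<ge> 2)"
        then have "mon_degree m \<le> (\<Sum>v\<in>?G. 1)"
          unfolding mon_degree_def by (intro sum_mono) (force simp: not_le)
        then show False
          using less.prems cG by simp
      qed
      then obtain v where v: "v \<in> ?G" "lookup m v \<ge> 2"
        by blast
      define m' where "m' = m - single v 1"
      have m: "m = single v 1 + m'"
        using v by (intro poly_mapping_eqI) (auto simp: m'_def lookup_add lookup_minus lookup_single when_def)
      have keys': "keys m' = ?G"
        using v by (auto simp: m'_def in_keys_iff lookup_minus lookup_single when_def split: if_splits)
      have deg': "mon_degree m' = ?d"
        using less.prems m mon_degree_add[of "single v 1" m'] by simp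
      \<comment> \<open>Vanishing on the rest of the support costs degree at most |G| - 1, which is
        below d, so the form with coefficients q(t w) is a combination of the d Vandermonde
        rows.\<close>
      define q where "q = (\<Prod>w\<in>?G - {v}. [:- t w, 1:])"
      have "degree q \<le> card (?G - {v})"
        unfolding q_def using degree_prod_sum_le[of "?G - {v}" "\<lambda>w. [:- t w, 1:]"] by simp
      moreover have "card (?G - {v}) < card ?G"
        using v(1) by (intro psubset_card_mono) auto
      ultimately have q: "degree q < ?d"
        using cG by linarith
      have GV: "?G \<subseteq> vertices \<Delta>"
        using True by blast
      have q0: "poly q (t w) = 0" if "w \<in> ?G - {v}" for w
        using that unfolding q_def poly_prod by (intro prod_zero) auto
      have qv: "poly q (t v) \<noteq> 0"
        using inj_on_subset[OF inj GV] v(1) unfolding q_def poly_prod by (auto simp: inj_on_def)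
      let ?f = "\<Sum>w\<in>vertices \<Delta>. scalar_mult (poly q (t w)) (indet w)"
      let ?g = "\<Sum>w\<in>vertices \<Delta> - ?G. scalar_mult (poly q (t w)) (indet w)"
      have "?f = ?g + (\<Sum>w\<in>?G. scalar_mult (poly q (t w)) (indet w))"
        using GV fv by (rule sum.subset_diff)
      also have "(\<Sum>w\<in>?G. scalar_mult (poly q (t w)) (indet w)) = scalar_mult (poly q (t v)) (indet v)"
        using v(1) q0 by (subst sum.remove[of _ v]) (auto intro: sum.neutral)
      finally have f: "?f = ?g + scalar_mult (poly q (t v)) (indet v)" .
      have "single m' 1 * ?f \<in> ?X"
        using poly_form[OF q] by (rule mr.subspace_scale[OF X])
      moreover have "single m' 1 * ?g \<in> ?X"
      proof -
        have "single (single w 1 + m') 1 \<in> ?X" if w: "w \<in> vertices \<Delta> - ?G" for w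
        proof (rule less.hyps)
          have k: "keys (single w 1 + m') = insert w ?G"
            by (simp add: keys_add_nat keys')
          show "Suc ?d - card (keys (single w 1 + m')) < Suc ?d - card ?G"
            using w cG by (simp only: k) simp
          show "mon_degree (single w 1 + m') = Suc ?d"
            by (simp add: mon_degree_add deg')
        qed
        then have "(\<Sum>w\<in>vertices \<Delta> - ?G. scalar_mult (poly q (t w))
            (single (single w 1 + m') 1)) \<in> ?X"
          using ideal_imp_linear_subspace[OF X] by (intro mv.subspace_sum mv.subspace_scale) auto
        then show ?thesis
          by (simp add: sum_distrib_left scalar_mult_def indet_def mult_single add.commute)
      qed
      ultimately have "single m' 1 * ?f - single m' 1 * ?g \<in> ?X"
        by (rule mr.subspace_diff[OF X])
      then have "single m' 1 * scalar_mult (poly q (t v)) (indet v) \<in> ?X"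
        by (simp add: f distrib_left)
      then have "scalar_mult (poly q (t v)) (single m 1) \<in> ?X"
        by (simp add: scalar_mult_def indet_def mult_single m add.commute)
      then have "scalar_mult (inverse (poly q (t v))) (scalar_mult (poly q (t v)) (single m 1)) \<in> ?X"
        by (rule mv.subspace_scale[OF ideal_imp_linear_subspace[OF X]])
      then show ?thesis
        using qv by simp
    qed
  qed
  have "homogeneous_part (Suc ?d) \<subseteq> ?X"
  proof
    fix p :: "('v, 'k) mpoly"
    assume p: "p \<in> homogeneous_part (Suc ?d)"
    have "(\<Sum>m\<in>keys p. scalar_mult (lookup p m) (single m 1)) \<in> ?X"
      using p mon ideal_imp_linear_subspace[OF X]
      by (intro mv.subspace_sum mv.subspace_scale) (auto simp: homogeneous_part_def)
    then show "p \<in> ?X"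
      using poly_mapping_sum_single[of "keys p" p] by (simp add: scalar_mult_single)
  qed
  then show ?thesis
    by blast
qed

text \<open>Vanishing means that the Hilbert function attains its least possible value 0 in that
  degree, an open condition by semicontinuity; the Vandermonde point shows that it occurs.\<close>

lemma generic_top_vanish:
  assumes inf: "infinite (UNIV :: 'k::field set)" and sc: "simplicial_complex \<Delta>"
  shows "generic ({..<sc_rank \<Delta>} \<times> vertices \<Delta>)
    (\<lambda>a :: nat \<times> 'v \<Rightarrow> 'k. homogeneous_part (Suc (sc_rank \<Delta>)) \<subseteq> face_ideal \<Delta> a (sc_rank \<Delta>))"
proof -
  let ?d = "sc_rank \<Delta>"
  note iff = hilb_eq_0_iff[OF ideal_face_ideal fin_hilb_face_ideal[OF sc]]
  obtain a0 :: "nat \<times> 'v \<Rightarrow> 'k" where a0: "hilb (face_ideal \<Delta> a0 ?d) (Suc ?d) = 0"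
    using top_vanish_exists[OF inf sc] iff by blast
  obtain f where f: "polyfun ({..<?d} \<times> vertices \<Delta>) f" "f a0 \<noteq> 0"
      "\<And>a. f a \<noteq> 0 \<Longrightarrow> hilb (face_ideal \<Delta> a ?d) (Suc ?d) \<le> hilb (face_ideal \<Delta> a0 ?d) (Suc ?d)"
    using hilb_semicontinuous[OF sc, of ?d a0 "Suc ?d"] by blast
  show ?thesis
  proof (rule genericI[where f = f and a = a0])
    show "homogeneous_part (Suc ?d) \<subseteq> face_ideal \<Delta> a ?d" if "f a \<noteq> 0" for a
      using f(3)[OF that] a0 iff[of a ?d "Suc ?d"] by simp
  qed (rule f)+
qed

text \<open>In degree i the Hilbert function of the reduction has a least value over all a; by
  semicontinuity it is attained on a nonempty open set, so the generic value is the least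
  one.\<close>

lemma generic_h_prime:
  assumes inf: "infinite (UNIV :: 'k::field set)" and sc: "simplicial_complex \<Delta>"
  shows "generic ({..<sc_rank \<Delta>} \<times> vertices \<Delta>)
    (\<lambda>a :: nat \<times> 'v \<Rightarrow> 'k. hilb (face_ideal \<Delta> a (sc_rank \<Delta>)) i = h_prime TYPE('k) \<Delta> i)"
proof -
  let ?d = "sc_rank \<Delta>" and ?I = "{..<sc_rank \<Delta>} \<times> vertices \<Delta>"
  let ?h = "\<lambda>a :: nat \<times> 'v \<Rightarrow> 'k. hilb (face_ideal \<Delta> a ?d) i"
  obtain a0 where a0: "\<And>a. ?h a0 \<le> ?h a"
    using ex_has_least_nat[of "\<lambda>_. True" undefined ?h] by blast
  obtain f where f: "polyfun ?I f" "f a0 \<noteq> 0" "\<And>a. f a \<noteq> 0 \<Longrightarrow> ?h a \<le> ?h a0"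
    using hilb_semicontinuous[OF sc, of ?d a0 i] by blast
  have "generic ?I (\<lambda>a. ?h a = ?h a0)"
  proof (rule genericI[where f = f and a = a0])
    show "?h a = ?h a0" if "f a \<noteq> 0" for a
      using f(3)[OF that] a0[of a] by simp
  qed (rule f)+
  then have "generic ?I (\<lambda>a. homogeneous_part (Suc ?d) \<subseteq> face_ideal \<Delta> a ?d \<and> ?h a = ?h a0)"
    by (intro generic_conj[OF inf] generic_top_vanish[OF inf sc])
  then have gen: "generic ?I (\<lambda>a. is_lsop \<Delta> a \<and> ?h a = ?h a0)"
    by (rule generic_mono) (auto intro: top_vanish_imp_lsop[OF sc])
  have "h_prime TYPE('k) \<Delta> i = ?h a0"
    unfolding h_prime_def reduction_dim_def hilb_def[symmetric]
  proof (rule the_equality)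
    show "holds_generically ?I (\<lambda>a. is_lsop \<Delta> a \<and> ?h a = ?h a0)"
      by (rule generic_imp_holds_generically[OF gen])
    show "n = ?h a0" if "holds_generically ?I (\<lambda>a. is_lsop \<Delta> a \<and> ?h a = n)" for n
      using generic_meets_holds_generically[OF inf gen that] by auto
  qed
  then show ?thesis
    using generic_mono[OF gen order.refl] by simp
qed

text \<open>The polynomial from semicontinuity depends on the degree, and infinitely many nonempty
  open sets over a countable field may have empty intersection. Degrees above d are therefore
  settled together by \<open>generic_top_vanish\<close>.\<close>

lemma generic_hilb_le_hpoly:
  fixes a0 :: "nat \<times> 'v \<Rightarrow> 'k::field"
  assumes inf: "infinite (UNIV :: 'k set)" and sc: "simplicial_complex \<Delta>" and d: "sc_rank \<Delta> = d"
    and a0: "\<And>i. int (hilb (face_ideal \<Delta> a0 d) i) \<le> fps_nth H i"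
  shows "generic ({..<d} \<times> vertices \<Delta>)
    (\<lambda>a :: nat \<times> 'v \<Rightarrow> 'k. \<forall>i. int (hilb (face_ideal \<Delta> a d) i) \<le> fps_nth H i)"
proof -
  let ?I = "{..<d} \<times> vertices \<Delta>"
  have "generic ?I (\<lambda>a :: nat \<times> 'v \<Rightarrow> 'k. int (hilb (face_ideal \<Delta> a d) i) \<le> fps_nth H i)" for i
  proof -
    obtain f where f: "polyfun ?I f" "f a0 \<noteq> 0"
        "\<And>a. f a \<noteq> 0 \<Longrightarrow> hilb (face_ideal \<Delta> a d) i \<le> hilb (face_ideal \<Delta> a0 d) i"
      using hilb_semicontinuous[OF sc, of d a0 i] by blast
    show ?thesis
    proof (rule genericI[where f = f and a = a0])
      show "int (hilb (face_ideal \<Delta> a d) i) \<le> fps_nth H i" if "f a \<noteq> 0" for a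
        using f(3)[OF that] a0[of i] by linarith
    qed (rule f)+
  qed
  then have "generic ?I (\<lambda>a :: nat \<times> 'v \<Rightarrow> 'k. \<forall>i\<le>d. int (hilb (face_ideal \<Delta> a d) i) \<le> fps_nth H i)"
    by (rule generic_all_le[OF inf])
  then have "generic ?I (\<lambda>a :: nat \<times> 'v \<Rightarrow> 'k. (\<forall>i\<le>d. int (hilb (face_ideal \<Delta> a d) i) \<le> fps_nth H i) \<and>
      homogeneous_part (Suc d) \<subseteq> face_ideal \<Delta> a d)"
    by (rule generic_conj[OF inf _ generic_top_vanish[OF inf sc, unfolded d]])
  then show ?thesis
  proof (rule generic_mono)
    fix a :: "nat \<times> 'v \<Rightarrow> 'k"
    assume a: "(\<forall>i\<le>d. int (hilb (face_ideal \<Delta> a d) i) \<le> fps_nth H i) \<and>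
      homogeneous_part (Suc d) \<subseteq> face_ideal \<Delta> a d"
    show "\<forall>i. int (hilb (face_ideal \<Delta> a d) i) \<le> fps_nth H i"
    proof
      fix i
      show "int (hilb (face_ideal \<Delta> a d) i) \<le> fps_nth H i"
      proof (cases "i \<le> d")
        case False
        then have "homogeneous_part i \<subseteq> face_ideal \<Delta> a d"
          by (intro homogeneous_subset_mono[OF ideal_face_ideal conjunct2[OF a]]) simp
        then have "hilb (face_ideal \<Delta> a d) i = 0"
          using hilb_eq_0_iff[OF ideal_face_ideal fin_hilb_face_ideal[OF sc]] by blast
        \<comment> \<open>The coefficient of H is nonnegative, since it bounds a dimension at
          a0.\<close>
        then show ?thesis
          using a0[of i] by linarith
      qed (use a in simp)
    qed
  qed simp
qed

text \<open>The Hilbert series of the face ring is written in two ways, by regularity and by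
  counting faces, and the common factor 1/(1 - X)^d is cancelled.\<close>

lemma regular_sequence_imp_hilb:
  fixes a :: "nat \<times> 'v \<Rightarrow> 'k::field"
  assumes sc: "simplicial_complex \<Delta>" and reg: "regular_sequence \<Delta> a (sc_rank \<Delta>)"
  shows "int (hilb (face_ideal \<Delta> a (sc_rank \<Delta>)) i) = fps_nth (hpoly (sc_rank \<Delta>) \<Delta>) i"
proof -
  note cl = simplicial_complex_subset_closed[OF sc]
  let ?I = "nonface_ideal \<Delta> :: ('v, 'k) mpoly set" and ?d = "sc_rank \<Delta>"
  have "regular_on ?I (linear_form \<Delta> a) ?d"
    using reg by (simp add: regular_on_def regular_sequence_def face_ideal_eq[OF cl])
  then have "hseries ?I = geom ^ ?d * hseries (extend_ideal ?I (linear_form \<Delta> a) ?d)"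
    by (intro hseries_regular ideal_nonface_ideal graded_nonface_ideal fin_hilb_nonface_ideal
        cl finite_vertices[OF sc]) (simp_all only: linear_form_eq linear_form_on_homogeneous)
  moreover have "hseries ?I = geom ^ ?d * hpoly ?d \<Delta>"
    by (rule hseries_nonface_ideal[OF sc card_le_sc_rank[OF sc]])
  ultimately have "hseries (face_ideal \<Delta> a ?d) = hpoly ?d \<Delta>"
    using geom_nonzero by (simp add: face_ideal_eq[OF cl])
  then show ?thesis
    by (simp add: hseries_def fps_eq_iff)
qed

lemma adjoin_mono: "A \<subseteq> B \<Longrightarrow> adjoin A f \<subseteq> adjoin B f"
  by (auto simp: adjoin_def)

text \<open>Filter S/X by the powers of x. The k-th layer is generated by x^k and annihilated by B,
  because x^k B lies in X + (x^(k+1)). It is therefore a quotient of S/B shifted by k, and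
  nilpotency stops the filtration after r layers.\<close>

lemma hilb_nilpotent_filtration:
  fixes X B :: "('v, 'k::field) mpoly set"
  assumes X: "mr.subspace X" "graded X" "fin_hilb X" and B: "mr.subspace B" "fin_hilb B"
    and x: "x \<in> homogeneous_part 1" and BX: "B \<subseteq> adjoin X x" and nil: "x ^ r \<in> X"
  shows "hilb X i \<le> (\<Sum>k<r. if k \<le> i then hilb B (i - k) else 0)"
proof -
  let ?Y = "\<lambda>k. adjoin X (x ^ k)"
  note lin = ideal_imp_linear_subspace
  have Y: "mr.subspace (?Y k)" "graded (?Y k)" "fin_hilb (?Y k)" for k
  proof -
    show "mr.subspace (?Y k)" "graded (?Y k)"
      by (intro ideal_adjoin graded_adjoin[OF X(2) homogeneous_part_power[OF x]] X)+
    then show "fin_hilb (?Y k)"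
      by (intro fin_hilb_mono[OF X(3) _ _ adjoin_superset] lin X)
  qed
  have step: "hilb (?Y (Suc k)) i \<le> hilb (?Y k) i + (if k \<le> i then hilb B (i - k) else 0)" for k
  proof -
    let ?Z = "adjoin (?Y (Suc k)) (x ^ k)"
    have xk: "x ^ k \<in> homogeneous_part k"
      by (rule homogeneous_part_power[OF x])
    have Z: "hilb ?Z i \<le> hilb (?Y k) i"
      by (intro hilb_mono[OF Y(3)] lin Y ideal_adjoin[OF Y(1)] adjoin_mono adjoin_superset)
    show ?thesis
    proof (cases "k \<le> i")
      case True
      let ?C = "{p. x ^ k * p \<in> ?Y (Suc k)}"
      have "B \<subseteq> ?C"
      proof
        fix b
        assume "b \<in> B"
        then obtain e p where e: "b = e + x * p" "e \<in> X"
          using BX by (auto simp: adjoin_def)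
        then have "x ^ k * b = x ^ k * e + x ^ Suc k * p"
          by (simp add: distrib_left mult.assoc power_commutes mult.left_commute)
        moreover have "x ^ k * e \<in> X"
          by (rule mr.subspace_scale[OF X(1) e(2)])
        ultimately show "b \<in> ?C"
          unfolding adjoin_def by blast
      qed
      then have "hilb ?C (i - k) \<le> hilb B (i - k)"
        by (rule hilb_mono[OF B(2) lin[OF B(1)] lin[OF ideal_colon[OF Y(1)]]])
      then show ?thesis
        using hilb_adjoin[OF Y(1,2,3) xk, of "Suc k" "i - k"] Z True by simp
    next
      case False
      then show ?thesis
        using hilb_adjoin_low[OF Y(1,2) xk, of i "Suc k"] Z by simp
    qed
  qed
  have "hilb (?Y r) i \<le> (\<Sum>k<r. if k \<le> i then hilb B (i - k) else 0)"
  proof (induction r)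
    case 0
    have "?Y 0 = UNIV"
      using mr.subspace_0[OF X(1)] unfolding adjoin_def by (force intro: exI[of _ 0])
    then show ?case
      using hilb_eq_0_iff[OF Y(1,3), of 0 i] by simp
  next
    case (Suc r)
    then show ?case
      using step[of r] by simp
  qed
  moreover have "?Y r = X"
  proof (intro subset_antisym adjoin_superset subsetI)
    fix y
    assume "y \<in> ?Y r"
    then obtain e p where e: "y = e + x ^ r * p" "e \<in> X"
      by (auto simp: adjoin_def)
    have "p * x ^ r \<in> X"
      by (rule mr.subspace_scale[OF X(1) nil])
    then show "y \<in> X"
      using mr.subspace_add[OF X(1) e(2)] by (simp add: e(1) mult.commute)
  qed
  ultimately show ?thesis
    by simp
qed

section \<open>Stars and links\<close>

lemma sum_Pow_power_card:
  fixes x y :: "'a::comm_semiring_1"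
  assumes "finite F"
  shows "(\<Sum>A\<in>Pow F. x ^ card A * y ^ (card F - card A)) = (x + y) ^ card F"
proof -
  have "(x + y) ^ card F = (\<Sum>A\<in>Pow F. x ^ card A * y ^ card (F - A))"
    using prod_add[OF assms, of "\<lambda>_. x" "\<lambda>_. y"] by simp
  also have "\<dots> = (\<Sum>A\<in>Pow F. x ^ card A * y ^ (card F - card A))"
    using assms by (intro sum.cong) (auto simp: card_Diff_subset finite_subset)
  finally show ?thesis ..
qed

lemma simplicial_complex_Un:
  "simplicial_complex A \<Longrightarrow> simplicial_complex B \<Longrightarrow> simplicial_complex (A \<union> B)"
  unfolding simplicial_complex_def by auto

lemma sc_rank_eqI:
  assumes "simplicial_complex \<Delta>" "\<And>G. G \<in> \<Delta> \<Longrightarrow> card G \<le> d" "H \<in> \<Delta>" "card H = d"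
  shows "sc_rank \<Delta> = d"
  unfolding sc_rank_def using assms by (intro Max_eqI) (auto simp: simplicial_complex_def)

lemma sc_rank_attained:
  assumes "simplicial_complex \<Delta>"
  obtains H where "H \<in> \<Delta>" "card H = sc_rank \<Delta>"
proof -
  have "Max (card ` \<Delta>) \<in> card ` \<Delta>"
    using assms by (intro Max_in) (auto simp: simplicial_complex_def)
  then show ?thesis
    using that unfolding sc_rank_def by auto
qed

text \<open>\<open>rank_link\<close> says that some face of full size d contains F. This gives both
  stars rank d, so that a sequence of d forms has the right length for \<Delta>, \<Gamma> and both
  stars.\<close>

locale stellar_subdivision =
  fixes \<Delta> :: "'v set set" and F :: "'v set" and \<rho> :: 'v and d :: nat
  assumes sc: "simplicial_complex \<Delta>" and F: "F \<in> \<Delta>" "2 \<le> card F" and rho: "\<rho> \<notin> vertices \<Delta>"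
    and rank: "sc_rank \<Delta> = d" and rank_link: "d = sc_rank (link \<Delta> F) + card F"
    and sc_link: "simplicial_complex (link \<Delta> F)"
begin

definition deletion :: "'v set set" where
  "deletion = {G \<in> \<Delta>. \<not> F \<subseteq> G}"

definition star :: "'v set set" where
  "star = {G. G \<union> F \<in> \<Delta>}"

text \<open>The cone with apex \<rho> over \<open>bdry\<close>, as \<open>new_star_eq\<close>
  shows.\<close>

definition new_star :: "'v set set" where
  "new_star = {G. (G - {\<rho>}) \<union> F \<in> \<Delta> \<and> \<not> F \<subseteq> G}"

text \<open>The join of the boundary of F with the link, which is where the deletion meets either
  star.\<close>

definition bdry :: "'v set set" where
  "bdry = {G. G \<union> F \<in> \<Delta> \<and> \<not> F \<subseteq> G}"

lemma closed: "G \<in> \<Delta> \<Longrightarrow> H \<subseteq> G \<Longrightarrow> H \<in> \<Delta>"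
  using sc by (auto simp: simplicial_complex_def)

lemma finite_face: "G \<in> \<Delta> \<Longrightarrow> finite G"
  using sc by (auto simp: simplicial_complex_def)

lemma finite_complex: "finite \<Delta>"
  using sc by (auto simp: simplicial_complex_def)

lemma finite_F: "finite F"
  using finite_face F by blast

lemma rho_notin: "G \<in> \<Delta> \<Longrightarrow> \<rho> \<notin> G" and rho_F: "\<rho> \<notin> F"
  using rho F by auto

lemma star_subset: "star \<subseteq> \<Delta>"
  using closed by (auto simp: star_def)

lemma bdry_subset: "bdry \<subseteq> star"
  by (auto simp: bdry_def star_def)

lemma new_star_eq: "new_star = bdry \<union> insert \<rho> ` bdry"
proof (intro subset_antisym subsetI)
  fix G
  assume G: "G \<in> new_star"
  then have "G - {\<rho>} \<in> bdry"
    by (auto simp: new_star_def bdry_def)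
  then show "G \<in> bdry \<union> insert \<rho> ` bdry"
    by (cases "\<rho> \<in> G") (auto simp: image_iff insert_Diff intro!: bexI[of _ "G - {\<rho>}"])
next
  fix G
  assume "G \<in> bdry \<union> insert \<rho> ` bdry"
  then obtain H where H: "H \<in> bdry" "G = H \<or> G = insert \<rho> H"
    by blast
  then have "\<rho> \<notin> H"
    using rho_notin bdry_subset star_subset by blast
  then show "G \<in> new_star"
    using H rho_F by (auto simp: new_star_def bdry_def)
qed

lemma complex_eq: "\<Delta> = deletion \<union> star"
  using star_subset by (auto simp: deletion_def star_def Un_absorb2)

lemma bdry_deletion: "bdry \<subseteq> deletion"
  using bdry_subset star_subset by (auto simp: deletion_def bdry_def)

lemma stellar_eq: "stellar \<Delta> F \<rho> = deletion \<union> new_star"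
proof -
  have "{\<tau> \<union> {\<rho>} |\<tau>. \<not> F \<subseteq> \<tau> \<and> \<tau> \<union> F \<in> \<Delta>} = insert \<rho> ` bdry"
    by (auto simp: bdry_def)
  then have "stellar \<Delta> F \<rho> = deletion \<union> insert \<rho> ` bdry"
    unfolding stellar_def deletion_def by simp
  also have "\<dots> = deletion \<union> new_star"
    using Un_absorb2[OF bdry_deletion] by (simp add: new_star_eq flip: Un_assoc)
  finally show ?thesis .
qed

lemma deletion_Int_star: "deletion \<inter> star = bdry"
proof
  show "deletion \<inter> star \<subseteq> bdry"
    by (auto simp: deletion_def star_def bdry_def)
  show "bdry \<subseteq> deletion \<inter> star"
    using bdry_deletion bdry_subset by simp
qed

lemma deletion_Int_new_star: "deletion \<inter> new_star = bdry"
proof -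
  have "deletion \<inter> insert \<rho> ` bdry = {}"
    using rho_notin by (auto simp: deletion_def)
  then show ?thesis
    using Int_absorb1[OF bdry_deletion] by (simp add: new_star_eq Int_Un_distrib)
qed

lemma F_nonempty: "F \<noteq> {}"
  using F by auto

lemma sc_deletion: "simplicial_complex deletion"
  using sc F_nonempty by (auto simp: simplicial_complex_def deletion_def)

lemma sc_star: "simplicial_complex star"
  unfolding simplicial_complex_def
proof (intro conjI ballI allI impI)
  show "finite star"
    using star_subset finite_complex finite_subset by blast
  show "{} \<in> star"
    using F by (simp add: star_def)
  show "finite G" if "G \<in> star" for G
    using that star_subset finite_face by blast
  show "H \<in> star" if "G \<in> star" "H \<subseteq> G" for G H
    using that closed[of "G \<union> F" "H \<union> F"] by (auto simp: star_def)
qed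

lemma finite_bdry: "finite bdry"
  by (rule finite_subset[OF subset_trans[OF bdry_subset star_subset] finite_complex])

lemma sc_new_star: "simplicial_complex new_star"
  unfolding simplicial_complex_def
proof (intro conjI ballI allI impI)
  show "finite new_star"
    unfolding new_star_eq using finite_bdry by simp
  show "{} \<in> new_star"
    using F F_nonempty by (simp add: new_star_def)
  show "finite G" if "G \<in> new_star" for G
    using that bdry_subset star_subset finite_face unfolding new_star_eq by auto
  show "H \<in> new_star" if "G \<in> new_star" "H \<subseteq> G" for G H
    using that closed[of "G - {\<rho>} \<union> F" "H - {\<rho>} \<union> F"] by (auto simp: new_star_def)
qed

lemma sc_stellar: "simplicial_complex (stellar \<Delta> F \<rho>)"
  unfolding stellar_eq by (rule simplicial_complex_Un[OF sc_deletion sc_new_star])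

text \<open>A boundary face can be enlarged by the vertices of F that it misses.\<close>

lemma card_bdry_less:
  assumes "G \<in> bdry"
  shows "card G < d"
proof -
  have GF: "G \<union> F \<in> \<Delta>" "G \<subset> G \<union> F"
    using assms by (auto simp: bdry_def)
  then have "card G < card (G \<union> F)"
    using finite_face by (intro psubset_card_mono) auto
  then show ?thesis
    using card_le_sc_rank[OF sc GF(1)] rank by simp
qed

lemma card_new_star_le:
  assumes "G \<in> new_star"
  shows "card G \<le> d"
proof -
  obtain H where H: "H \<in> bdry" "G = H \<or> G = insert \<rho> H"
    using assms unfolding new_star_eq by blast
  then have "card G \<le> Suc (card H)"
    using card_insert_le_m1[of "Suc (card H)" H \<rho>] by auto
  then show ?thesis
    using card_bdry_less[OF H(1)] by simp
qed

lemma rank_star: "sc_rank star = d" and rank_new_star: "sc_rank new_star = d"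
  and rank_stellar: "sc_rank (stellar \<Delta> F \<rho>) = d"
proof -
  obtain H where H: "H \<in> link \<Delta> F" "card H = sc_rank (link \<Delta> F)"
    using sc_rank_attained[OF sc_link] .
  then have HF: "H \<inter> F = {}" "H \<union> F \<in> \<Delta>"
    by (auto simp: link_def)
  have finH: "finite H"
    using finite_face[OF HF(2)] by simp
  have "card (H \<union> F) = d"
    using HF finH finite_F H(2) rank_link by (simp add: card_Un_disjoint)
  moreover have "card G \<le> d" if "G \<in> star" for G
    using that star_subset card_le_sc_rank[OF sc] rank by blast
  ultimately show "sc_rank star = d"
    using HF by (intro sc_rank_eqI[OF sc_star, of d "H \<union> F"]) (auto simp: star_def Un_absorb2)
  \<comment> \<open>Exchanging one vertex of F for \<rho> turns the largest face of
    \<open>star\<close> into a face of \<open>new_star\<close> of the same size.\<close>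
  obtain v where v: "v \<in> F"
    using F_nonempty by blast
  let ?G = "insert \<rho> (H \<union> (F - {v}))"
  have "H \<union> (F - {v}) \<union> F = H \<union> F"
    by blast
  then have "H \<union> (F - {v}) \<in> bdry"
    using HF v by (auto simp: bdry_def)
  then have G: "?G \<in> new_star"
    unfolding new_star_eq by blast
  have "\<rho> \<notin> H \<union> (F - {v})"
    using rho_notin[OF HF(2)] by blast
  moreover have "card (H \<union> (F - {v})) = card H + (card F - 1)"
    using HF finH finite_F v by (subst card_Un_disjoint) auto
  ultimately have cG: "card ?G = d"
    using finH finite_F H(2) rank_link F(2) by simp
  show "sc_rank new_star = d"
    by (rule sc_rank_eqI[OF sc_new_star card_new_star_le G cG])
  have "card K \<le> d" if "K \<in> stellar \<Delta> F \<rho>" for K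
    using that card_new_star_le card_le_sc_rank[OF sc] rank by (auto simp: stellar_eq deletion_def)
  then show "sc_rank (stellar \<Delta> F \<rho>) = d"
    using G by (intro sc_rank_eqI[OF sc_stellar _ _ cG]) (auto simp: stellar_eq)
qed

lemma card_link_le: "B \<in> link \<Delta> F \<Longrightarrow> card B \<le> d - card F"
  using card_le_sc_rank[OF sc_link] rank_link by simp

lemma finite_link_face: "B \<in> link \<Delta> F \<Longrightarrow> finite B"
  using sc_link by (simp add: simplicial_complex_def)

lemma card_link_Un: "A \<subseteq> F \<Longrightarrow> B \<in> link \<Delta> F \<Longrightarrow> card (A \<union> B) = card A + card B"
  using finite_F finite_link_face finite_subset by (subst card_Un_disjoint) (auto simp: link_def)

text \<open>The star is the join of the full simplex on F with the link. The simplex contributes the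
  sum over A \<subseteq> F of X^|A| (1 - X)^(|F| - |A|), which is 1 by the binomial theorem.\<close>

lemma hpoly_star: "hpoly d star = hpoly (d - card F) (link \<Delta> F)"
proof -
  let ?t = "\<lambda>n G. fps_X ^ card G * (1 - fps_X) ^ (n - card G) :: int fps"
  let ?L = "link \<Delta> F" and ?f = "\<lambda>(A, B). A \<union> B"
  have inj: "inj_on ?f (Pow F \<times> ?L)"
  proof (rule inj_onI, clarify)
    fix A B A' B'
    assume "A \<subseteq> F" "B \<in> ?L" "A' \<subseteq> F" "B' \<in> ?L" "A \<union> B = A' \<union> B'"
    then have "A = A'" "B = B'"
      unfolding link_def by blast+
    then show "A = A' \<and> B = B'"
      by simp
  qed
  have img: "?f ` (Pow F \<times> ?L) = star"
  proof (intro subset_antisym subsetI)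
    fix G
    assume G: "G \<in> star"
    then have "G = ?f (G \<inter> F, G - F)" "G - F \<in> ?L"
      by (auto simp: star_def link_def)
    then show "G \<in> ?f ` (Pow F \<times> ?L)"
      by (intro rev_image_eqI[of "(G \<inter> F, G - F)"]) auto
  next
    fix G
    assume "G \<in> ?f ` (Pow F \<times> ?L)"
    then obtain A B where "G = A \<union> B" "A \<subseteq> F" "B \<in> ?L"
      by auto
    moreover from this have "G \<union> F = B \<union> F"
      by blast
    ultimately show "G \<in> star"
      by (auto simp: star_def link_def)
  qed
  have "hpoly d star = (\<Sum>(A, B)\<in>Pow F \<times> ?L. ?t d (A \<union> B))"
    unfolding hpoly_def img[symmetric] sum.reindex[OF inj] by (simp add: case_prod_unfold)
  also have "\<dots> = (\<Sum>(A, B)\<in>Pow F \<times> ?L. ?t (card F) A * ?t (d - card F) B)"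
  proof (rule sum.cong, simp, clarify)
    fix A B
    assume AB: "A \<subseteq> F" "B \<in> ?L"
    have "card A \<le> card F"
      using AB finite_F by (intro card_mono)
    then have "d - card (A \<union> B) = (card F - card A) + (d - card F - card B)"
      using card_link_Un[OF AB] card_link_le[OF AB(2)] rank_link by linarith
    then show "?t d (A \<union> B) = ?t (card F) A * ?t (d - card F) B"
      by (simp add: card_link_Un[OF AB] power_add mult_ac)
  qed
  also have "\<dots> = (\<Sum>A\<in>Pow F. ?t (card F) A) * hpoly (d - card F) ?L"
    by (simp add: sum_product sum.cartesian_product hpoly_def)
  also have "(\<Sum>A\<in>Pow F. ?t (card F) A) = 1"
    by (subst sum_Pow_power_card[OF finite_F]) simp
  finally show ?thesis
    by simp
qed

text \<open>Coning over \<open>bdry\<close> cancels one factor 1 - X, and the star consists of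
  \<open>bdry\<close> and the faces containing F, which contribute X^r times the polynomial of the
  link. So (1 - X) times the left side is h(lk F) (1 - X^r), and division yields the geometric
  sum.\<close>

lemma hpoly_new_star: "hpoly d new_star = hpoly (d - card F) (link \<Delta> F) * (\<Sum>k<card F. fps_X ^ k)"
proof -
  let ?X = "fps_X :: int fps"
  let ?t = "\<lambda>n G. ?X ^ card G * (1 - ?X) ^ (n - card G)"
  let ?L = "link \<Delta> F" and ?r = "card F"
  have "bdry \<subseteq> \<Delta>"
    using bdry_subset star_subset by blast
  then have cb: "card G < d" "finite G" "\<rho> \<notin> G" if "G \<in> bdry" for G
    using that card_bdry_less[of G] finite_face[of G] rho_notin[of G] by auto
  have inj: "inj_on (insert \<rho>) bdry"
    using cb(3) by (intro inj_onI) (metis insert_ident)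
  have split: "(1 - ?X) ^ (d - card G) = (1 - ?X) * (1 - ?X) ^ (d - Suc (card G))" if "G \<in> bdry" for G
    using cb(1)[OF that] by (simp flip: power_Suc add: Suc_diff_Suc)
  have "hpoly d new_star = (\<Sum>G\<in>bdry. ?t d G) + (\<Sum>G\<in>insert \<rho> ` bdry. ?t d G)"
    unfolding hpoly_def new_star_eq using finite_bdry cb(3) by (intro sum.union_disjoint) auto
  also have "\<dots> = (\<Sum>G\<in>bdry. ?t d G + ?t d (insert \<rho> G))"
    by (simp add: sum.reindex[OF inj] sum.distrib)
  \<comment> \<open>A boundary face and its cone with apex \<rho> add up to one term with exponent d
    - 1 - |G|.\<close>
  also have "\<dots> = (\<Sum>G\<in>bdry. ?X ^ card G * (1 - ?X) ^ (d - Suc (card G)))"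
  proof (rule sum.cong)
    fix G
    assume G: "G \<in> bdry"
    have ring: "x * ((1 - y) * z) + (y * x) * z = x * z" for x y z :: "int fps"
      by (simp add: left_diff_distrib right_diff_distrib mult_ac)
    have ins: "card (insert \<rho> G) = Suc (card G)"
      by (simp add: cb[OF G])
    show "?t d G + ?t d (insert \<rho> G) = ?X ^ card G * (1 - ?X) ^ (d - Suc (card G))"
      unfolding ins split[OF G] power_Suc by (rule ring)
  qed simp
  finally have hns: "hpoly d new_star = (\<Sum>G\<in>bdry. ?X ^ card G * (1 - ?X) ^ (d - Suc (card G)))" .
  have ns: "(1 - ?X) * hpoly d new_star = (\<Sum>G\<in>bdry. ?t d G)"
    unfolding hns sum_distrib_left
  proof (rule sum.cong)
    show "(1 - ?X) * (?X ^ card G * (1 - ?X) ^ (d - Suc (card G))) = ?t d G" if "G \<in> bdry" for G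
      unfolding split[OF that] by (rule mult.left_commute)
  qed simp
  have injF: "inj_on ((\<union>) F) ?L"
    by (rule inj_onI) (auto simp: link_def)
  have "star = bdry \<union> ((\<union>) F) ` ?L"
  proof (intro subset_antisym subsetI)
    fix G
    assume G: "G \<in> star"
    show "G \<in> bdry \<union> ((\<union>) F) ` ?L"
    proof (cases "F \<subseteq> G")
      case True
      then have "G = F \<union> (G - F)" "G - F \<in> ?L"
        using G by (auto simp: star_def link_def Un_absorb2)
      then show ?thesis
        by blast
    qed (use G in \<open>auto simp: star_def bdry_def\<close>)
  qed (auto simp: star_def bdry_def link_def Un_commute Un_left_commute)
  then have "hpoly d star = (\<Sum>G\<in>bdry. ?t d G) + (\<Sum>G\<in>((\<union>) F) ` ?L. ?t d G)"
    unfolding hpoly_def using finite_bdry sc_link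
    by (simp only:) (intro sum.union_disjoint; auto simp: bdry_def simplicial_complex_def)
  also have "(\<Sum>G\<in>((\<union>) F) ` ?L. ?t d G) = ?X ^ ?r * hpoly (d - ?r) ?L"
    unfolding sum.reindex[OF injF] hpoly_def sum_distrib_left
    using card_link_Un[OF order.refl] by (intro sum.cong) (auto simp: power_add mult_ac)
  finally have "(1 - ?X) * hpoly d new_star = hpoly (d - ?r) ?L * (1 - ?X ^ ?r)"
    unfolding ns hpoly_star by (simp add: algebra_simps)
  also have "\<dots> = (1 - ?X) * (hpoly (d - ?r) ?L * (\<Sum>k<?r. ?X ^ k))"
    by (simp add: one_diff_power_eq mult_ac)
  finally show ?thesis
    by simp
qed

end

section \<open>Linear systems of parameters on the two stars\<close>

lemma simplicial_complex_link:
  assumes "simplicial_complex \<Delta>" "F \<in> \<Delta>"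
  shows "simplicial_complex (link \<Delta> F)"
  unfolding simplicial_complex_def
proof (intro conjI ballI allI impI)
  have cl: "H \<in> \<Delta>" if "G \<in> \<Delta>" "H \<subseteq> G" for G H
    using assms(1) that by (auto simp: simplicial_complex_def)
  have sub: "link \<Delta> F \<subseteq> \<Delta>"
    using cl by (auto simp: link_def)
  then show "finite (link \<Delta> F)"
    by (rule finite_subset) (use assms(1) in \<open>simp add: simplicial_complex_def\<close>)
  show "{} \<in> link \<Delta> F"
    using assms(2) by (simp add: link_def)
  show "finite G" if "G \<in> link \<Delta> F" for G
    using sub that assms(1) by (auto simp: simplicial_complex_def)
  show "H \<in> link \<Delta> F" if "G \<in> link \<Delta> F" "H \<subseteq> G" for G H
    using that cl[of "G \<union> F" "H \<union> F"] by (auto simp: link_def)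
qed

lemma single_in_ideal:
  assumes X: "mr.subspace X" and v: "v \<in> keys m" "indet v \<in> X"
  shows "single m c \<in> X"
proof -
  have "m = (m - single v 1) + single v 1"
    using v(1) by (intro poly_mapping_eqI) (auto simp: lookup_add lookup_minus lookup_single when_def in_keys_iff)
  then have "single m c = single (m - single v 1) c * indet v"
    by (simp add: indet_def mult_single)
  then show ?thesis
    using mr.subspace_scale[OF X v(2)] by simp
qed

lemma nonface_ideal_subset_ideal:
  fixes X :: "('v, 'k::field) mpoly set"
  assumes X: "mr.subspace X" and m: "\<And>m c. keys m \<notin> \<Delta> \<Longrightarrow> single m c \<in> X"
  shows "nonface_ideal \<Delta> \<subseteq> X"
proof
  fix p :: "('v, 'k) mpoly"
  assume p: "p \<in> nonface_ideal \<Delta>"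
  have "(\<Sum>m\<in>keys p. single m (lookup p m)) \<in> X"
    using p m by (intro mr.subspace_sum[OF X]) (auto simp: nonface_ideal_def)
  then show "p \<in> X"
    using poly_mapping_sum_single[of "keys p" p] by simp
qed

lemma sum_delta_indet:
  "finite W \<Longrightarrow> u \<in> W \<Longrightarrow> (\<Sum>v\<in>W. scalar_mult (if v = u then 1 else 0) (indet v)) = indet u"
  by (subst sum.remove[of W u]) (auto intro: sum.neutral)

lemma linear_form_on_restrict:
  assumes "finite W" "vertices \<Delta> \<subseteq> W" "\<And>v. a (j, v) = (if v \<in> vertices \<Delta> then b (j, v) else 0)"
  shows "linear_form_on W a j = linear_form \<Delta> b j"
  unfolding linear_form_on_def linear_form_def using assms
  by (intro sum.mono_neutral_cong_right) auto

context stellar_subdivision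
begin

lemma rank_link_eq: "d - card F = sc_rank (link \<Delta> F)"
  using rank_link by simp

lemma vertices_link: "vertices (link \<Delta> F) \<subseteq> vertices \<Delta>"
  by (auto simp: link_def)

lemma finite_all_vertices: "finite (insert \<rho> (vertices \<Delta>))"
  using finite_vertices[OF sc] by simp

text \<open>The indices left over by the forms of the link are exactly as many as the vertices of
  F.\<close>

lemma enum_F:
  obtains e where "\<And>j. sc_rank (link \<Delta> F) \<le> j \<Longrightarrow> j < d \<Longrightarrow> e j \<in> F"
    "\<And>v. v \<in> F \<Longrightarrow> \<exists>j\<ge>sc_rank (link \<Delta> F). j < d \<and> e j = v"
proof -
  let ?s = "sc_rank (link \<Delta> F)"
  obtain h where h: "bij_betw h {0..<card F} F"
    using ex_bij_betw_nat_finite[OF finite_F] by blast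
  show ?thesis
  proof (rule that[of "\<lambda>j. h (j - ?s)"])
    show "h (j - ?s) \<in> F" if "?s \<le> j" "j < d" for j
      using bij_betwE[OF h] that rank_link by auto
    show "\<exists>j\<ge>?s. j < d \<and> h (j - ?s) = v" if "v \<in> F" for v
    proof -
      obtain k where "k < card F" "h k = v"
        using bij_betw_imp_surj_on[OF h] \<open>v \<in> F\<close> by force
      then show ?thesis
        using rank_link by (intro exI[of _ "k + ?s"]) auto
    qed
  qed
qed

text \<open>The regular sequence of the link is followed by the variables of F. Modulo these the
  star becomes the link, so its reduction is a quotient of that of the link, whose Hilbert function
  is the h-vector shared by link and star (\<open>hpoly_star\<close>).\<close>

lemma star_parameters:
  fixes aL :: "nat \<times> 'v \<Rightarrow> 'k::field"
  assumes reg: "regular_sequence (link \<Delta> F) aL (sc_rank (link \<Delta> F))"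
  shows "\<exists>a :: nat \<times> 'v \<Rightarrow> 'k. \<forall>i. int (hilb (face_ideal star a d) i) \<le> fps_nth (hpoly d star) i"
proof -
  let ?L = "link \<Delta> F" and ?s = "sc_rank (link \<Delta> F)"
  define W where "W = insert \<rho> (vertices \<Delta>)"
  obtain e where e: "\<And>j. ?s \<le> j \<Longrightarrow> j < d \<Longrightarrow> e j \<in> F" "\<And>v. v \<in> F \<Longrightarrow> \<exists>j\<ge>?s. j < d \<and> e j = v"
    using enum_F by blast
  \<comment> \<open>Coefficients are 0 off the link, so that the first forms on W coincide with
    those of the link.\<close>
  define a :: "nat \<times> 'v \<Rightarrow> 'k" where
    "a = (\<lambda>(j, v). if j < ?s then if v \<in> vertices ?L then aL (j, v) else 0 else if v = e j then 1 else 0)"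
  let ?X = "face_ideal star a d"
  have W: "finite W" "vertices star \<subseteq> W" "vertices ?L \<subseteq> W" "F \<subseteq> W"
    using finite_all_vertices star_subset vertices_link F(1) unfolding W_def by auto
  have X: "mr.subspace ?X"
    by (rule ideal_face_ideal)
  have Xeq: "?X = extend_ideal (nonface_ideal star) (linear_form_on W a) d"
    by (rule extend_linear_form_on[OF simplicial_complex_subset_closed[OF sc_star] W(1,2), symmetric])
  have I: "mr.subspace (nonface_ideal star :: ('v, 'k) mpoly set)"
    by (rule ideal_nonface_ideal[OF simplicial_complex_subset_closed[OF sc_star]])
  have gen: "linear_form_on W a j \<in> ?X" if "j < d" for j
    unfolding Xeq by (rule generator_in_extend_ideal[OF I that])
  have FX: "indet v \<in> ?X" if v: "v \<in> F" for v
  proof -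
    obtain j where j: "?s \<le> j" "j < d" "e j = v"
      using e(2)[OF v] by blast
    then have "linear_form_on W a j = (\<Sum>u\<in>W. scalar_mult (if u = v then 1 else 0) (indet u))"
      by (simp add: linear_form_on_def a_def)
    also have "\<dots> = indet v"
      using W v by (intro sum_delta_indet) auto
    finally show ?thesis
      using gen[OF j(2)] by simp
  qed
  have sub: "face_ideal ?L aL ?s \<subseteq> ?X"
    unfolding face_ideal_eq[OF simplicial_complex_subset_closed[OF sc_link]]
  proof (rule extend_ideal_least[OF X])
    show "nonface_ideal ?L \<subseteq> ?X"
    proof (rule nonface_ideal_subset_ideal[OF X])
      fix m :: "'v \<Rightarrow>\<^sub>0 nat" and c :: 'k
      assume m: "keys m \<notin> ?L"
      show "single m c \<in> ?X"
      proof (cases "keys m \<inter> F = {}")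
        case True
        then have "keys m \<notin> star"
          using m by (auto simp: link_def star_def)
        then have "single m c \<in> nonface_ideal star"
          by (simp add: nonface_ideal_def)
        then show ?thesis
          unfolding Xeq using extend_ideal_superset by blast
      next
        case False
        then show ?thesis
          using single_in_ideal[OF X] FX by blast
      qed
    qed
    show "linear_form ?L aL j \<in> ?X" if "j < ?s" for j
    proof -
      have "linear_form_on W a j = linear_form ?L aL j"
        using that by (intro linear_form_on_restrict W) (simp add: a_def)
      then show ?thesis
        using gen[of j] that rank_link by simp
    qed
  qed
  have "int (hilb ?X i) \<le> fps_nth (hpoly d star) i" for i
  proof -
    have "hilb ?X i \<le> hilb (face_ideal ?L aL ?s) i"
      by (intro hilb_mono fin_hilb_face_ideal[OF sc_link] ideal_imp_linear_subspace ideal_face_ideal sub)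
    moreover have "int (hilb (face_ideal ?L aL ?s) i) = fps_nth (hpoly d star) i"
      using regular_sequence_imp_hilb[OF sc_link reg, of i] by (simp add: hpoly_star rank_link_eq)
    ultimately show ?thesis
      by simp
  qed
  then show ?thesis
    by blast
qed

text \<open>After the forms of the link come the variable of \<rho> and the differences x_v - x_w
  with v in F. All variables of F then equal x = x_w, and the nonface F yields x^r = 0, while modulo
  x only a quotient of the reduction of the link remains. The powers of x give r shifted copies of
  h(lk F) as an upper bound, and their sum is the h-polynomial of the new star.\<close>

lemma new_star_parameters:
  fixes aL :: "nat \<times> 'v \<Rightarrow> 'k::field"
  assumes reg: "regular_sequence (link \<Delta> F) aL (sc_rank (link \<Delta> F))"
  shows "\<exists>a :: nat \<times> 'v \<Rightarrow> 'k. \<forall>i. int (hilb (face_ideal new_star a d) i) \<le> fps_nth (hpoly d new_star) i"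
proof -
  let ?L = "link \<Delta> F" and ?s = "sc_rank (link \<Delta> F)" and ?r = "card F"
  define W where "W = insert \<rho> (vertices \<Delta>)"
  obtain e where e: "\<And>j. ?s \<le> j \<Longrightarrow> j < d \<Longrightarrow> e j \<in> F" "\<And>v. v \<in> F \<Longrightarrow> \<exists>j\<ge>?s. j < d \<and> e j = v"
    using enum_F by blast
  have sd: "?s < d"
    using rank_link F(2) by simp
  define w where "w = e ?s"
  have w: "w \<in> F"
    unfolding w_def using e(1) sd by simp
  \<comment> \<open>The first leftover index belongs to w, whose difference x_w - x_w would be zero;
    that slot is given to \<rho>, and the later indices still reach every other vertex of F.\<close>
  define a :: "nat \<times> 'v \<Rightarrow> 'k" where
    "a = (\<lambda>(j, v). if j < ?s then if v \<in> vertices ?L then aL (j, v) else 0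
      else if j = ?s then if v = \<rho> then 1 else 0
      else (if v = e j then 1 else 0) - (if v = w then 1 else 0))"
  let ?X = "face_ideal new_star a d" and ?x = "indet w :: ('v, 'k) mpoly"
  note cl = simplicial_complex_subset_closed[OF sc_new_star]
  have "vertices new_star \<subseteq> W"
    using bdry_subset star_subset unfolding new_star_eq W_def by auto
  then have W: "finite W" "vertices new_star \<subseteq> W" "vertices ?L \<subseteq> W" "F \<subseteq> W" "\<rho> \<in> W"
    using finite_all_vertices vertices_link F(1) unfolding W_def by auto
  have X: "mr.subspace ?X"
    by (rule ideal_face_ideal)
  have Xeq: "?X = extend_ideal (nonface_ideal new_star) (linear_form_on W a) d"
    by (rule extend_linear_form_on[OF cl W(1,2), symmetric])
  have I: "mr.subspace (nonface_ideal new_star :: ('v, 'k) mpoly set)"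
    by (rule ideal_nonface_ideal[OF cl])
  have IX: "nonface_ideal new_star \<subseteq> ?X"
    unfolding Xeq by (rule extend_ideal_superset)
  have gen: "linear_form_on W a j \<in> ?X" if "j < d" for j
    unfolding Xeq by (rule generator_in_extend_ideal[OF I that])
  have rhoX: "indet \<rho> \<in> ?X"
  proof -
    have "linear_form_on W a ?s = (\<Sum>u\<in>W. scalar_mult (if u = \<rho> then 1 else 0) (indet u))"
      by (simp add: linear_form_on_def a_def)
    also have "\<dots> = indet \<rho>"
      using W by (intro sum_delta_indet) auto
    finally show ?thesis
      using gen[OF sd] by simp
  qed
  have FX: "indet v - ?x \<in> ?X" if v: "v \<in> F" for v
  proof (cases "v = w")
    case True
    then show ?thesis
      using mr.subspace_0[OF X] by simp
  next
    case False
    obtain j where j: "?s \<le> j" "j < d" "e j = v"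
      using e(2)[OF v] by blast
    then have "j \<noteq> ?s"
      using False w_def by blast
    then have "linear_form_on W a j = (\<Sum>u\<in>W. scalar_mult ((if u = v then 1 else 0) - (if u = w then 1 else 0)) (indet u))"
      using j by (simp add: linear_form_on_def a_def)
    also have "\<dots> = (\<Sum>u\<in>W. scalar_mult (if u = v then 1 else 0) (indet u)) -
        (\<Sum>u\<in>W. scalar_mult (if u = w then 1 else 0) (indet u))"
      by (simp only: mv.scale_left_diff_distrib sum_subtractf)
    also have "\<dots> = indet v - ?x"
      using W v w by (subst (1 2) sum_delta_indet) auto
    finally show ?thesis
      using gen[OF j(2)] by simp
  qed
  \<comment> \<open>The variables of F are replaced by x one at a time, which turns the nonface
    monomial of F into a power of x.\<close>
  have "?x ^ card A - (\<Prod>v\<in>A. indet v) \<in> ?X" if "A \<subseteq> F" for A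
    using finite_subset[OF that finite_F] that
  proof (induction A rule: finite_induct)
    case empty
    show ?case
      using mr.subspace_0[OF X] by simp
  next
    case (insert v A)
    let ?P = "\<Prod>u\<in>A. indet u :: ('v, 'k) mpoly"
    have "?x * (?x ^ card A - ?P) - ?P * (indet v - ?x) \<in> ?X"
      using insert FX[of v] by (intro mr.subspace_diff[OF X mr.subspace_scale[OF X] mr.subspace_scale[OF X]]) auto
    also have "?x * (?x ^ card A - ?P) - ?P * (indet v - ?x) = ?x ^ card (insert v A) - (\<Prod>u\<in>insert v A. indet u)"
      using insert.hyps by (simp add: algebra_simps)
    finally show ?case .
  qed
  then have "?x ^ ?r - (\<Prod>v\<in>F. indet v) \<in> ?X"
    by blast
  moreover have "(\<Prod>v\<in>F. indet v :: ('v, 'k) mpoly) \<in> nonface_ideal new_star"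
    by (simp add: prod_indet finite_F nonface_ideal_def keys_sum_single new_star_def)
  ultimately have "?x ^ ?r - (\<Prod>v\<in>F. indet v) + (\<Prod>v\<in>F. indet v) \<in> ?X"
    using IX by (intro mr.subspace_add[OF X]) auto
  then have nil: "?x ^ ?r \<in> ?X"
    by simp
  let ?Z = "adjoin ?X ?x"
  have Z: "mr.subspace ?Z" "?X \<subseteq> ?Z"
    by (rule ideal_adjoin[OF X], rule adjoin_superset)
  have FZ: "indet v \<in> ?Z" if v: "v \<in> F" for v
    unfolding adjoin_def using FX[OF v]
    by (intro CollectI exI[of _ "indet v - ?x"] exI[of _ 1]) simp
  have sub: "face_ideal ?L aL ?s \<subseteq> ?Z"
    unfolding face_ideal_eq[OF simplicial_complex_subset_closed[OF sc_link]]
  proof (rule extend_ideal_least[OF Z(1)])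
    show "nonface_ideal ?L \<subseteq> ?Z"
    proof (rule nonface_ideal_subset_ideal[OF Z(1)])
      fix m :: "'v \<Rightarrow>\<^sub>0 nat" and c :: 'k
      assume m: "keys m \<notin> ?L"
      show "single m c \<in> ?Z"
      proof (cases "keys m \<inter> insert \<rho> F = {}")
        case True
        then have "keys m - {\<rho>} = keys m"
          by auto
        then have "keys m \<notin> new_star"
          using m True by (auto simp: link_def new_star_def)
        then have "single m c \<in> nonface_ideal new_star"
          by (simp add: nonface_ideal_def)
        then show ?thesis
          using IX Z(2) by blast
      next
        case False
        then show ?thesis
          using single_in_ideal[OF Z(1)] FZ rhoX Z(2) by blast
      qed
    qed
    show "linear_form ?L aL j \<in> ?Z" if "j < ?s" for j
    proof -
      have "linear_form_on W a j = linear_form ?L aL j"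
        using that by (intro linear_form_on_restrict W) (simp add: a_def)
      then show ?thesis
        using gen[of j] that rank_link Z(2) by auto
    qed
  qed
  have gr: "graded ?X"
    unfolding Xeq by (intro graded_extend_ideal graded_nonface_ideal linear_form_on_homogeneous)
  have "int (hilb ?X i) \<le> fps_nth (hpoly d new_star) i" for i
  proof -
    have "hilb ?X i \<le> (\<Sum>k<?r. if k \<le> i then hilb (face_ideal ?L aL ?s) (i - k) else 0)"
      by (rule hilb_nilpotent_filtration[OF X gr fin_hilb_face_ideal[OF sc_new_star]
            ideal_face_ideal fin_hilb_face_ideal[OF sc_link] indet_homogeneous sub nil])
    then have "int (hilb ?X i) \<le> int (\<Sum>k<?r. if k \<le> i then hilb (face_ideal ?L aL ?s) (i - k) else 0)"
      by (simp only: of_nat_le_iff)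
    also have "\<dots> = (\<Sum>k<?r. if k \<le> i then fps_nth (hpoly (d - ?r) ?L) (i - k) else 0)"
      using regular_sequence_imp_hilb[OF sc_link reg]
      by (simp add: if_distrib[of int] rank_link_eq cong: if_cong)
    also have "\<dots> = fps_nth (hpoly d new_star) i"
      by (auto simp: hpoly_new_star sum_distrib_left fps_sum_nth fps_X_power_mult_right_nth intro!: sum.cong)
    finally show ?thesis .
  qed
  then show ?thesis
    by blast
qed

section \<open>Comparison of h' and h for the two complexes\<close>

lemma h_prime_difference:
  assumes inf: "infinite (UNIV :: 'k::field set)"
    and cm: "cohen_macaulay TYPE('k) (link \<Delta> F)"
  shows "int (h_prime TYPE('k) (stellar \<Delta> F \<rho>) i) - h_num (stellar \<Delta> F \<rho>) i =
    int (h_prime TYPE('k) \<Delta> i) - h_num \<Delta> i"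
proof -
  let ?\<Gamma> = "stellar \<Delta> F \<rho>"
  \<comment> \<open>The vertex sets of \<Delta> and \<Gamma> differ; a common index set lets one
    point a be generic for both.\<close>
  define W where "W = insert \<rho> (vertices \<Delta>)"
  have V: "vertices \<Delta> \<subseteq> W" "vertices star \<subseteq> W" "vertices new_star \<subseteq> W" "vertices ?\<Gamma> \<subseteq> W"
      "vertices deletion \<subseteq> W"
    using bdry_subset star_subset unfolding W_def stellar_eq new_star_eq deletion_def by auto
  have finW: "finite W"
    unfolding W_def by (rule finite_all_vertices)
  obtain aL :: "nat \<times> 'v \<Rightarrow> 'k" where reg: "regular_sequence (link \<Delta> F) aL (sc_rank (link \<Delta> F))"
    using cm unfolding cohen_macaulay_def by blast
  obtain a1 :: "nat \<times> 'v \<Rightarrow> 'k" where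
    a1: "\<And>i. int (hilb (face_ideal star a1 d) i) \<le> fps_nth (hpoly d star) i"
    using star_parameters[OF reg] by blast
  obtain a2 :: "nat \<times> 'v \<Rightarrow> 'k" where
    a2: "\<And>i. int (hilb (face_ideal new_star a2 d) i) \<le> fps_nth (hpoly d new_star) i"
    using new_star_parameters[OF reg] by blast
  let ?I = "{..<d} \<times> W"
  have "generic ?I (\<lambda>a :: nat \<times> 'v \<Rightarrow> 'k. \<forall>i. int (hilb (face_ideal star a d) i) \<le> fps_nth (hpoly d star) i)"
    using generic_hilb_le_hpoly[OF inf sc_star rank_star a1] by (rule generic_mono) (use V in auto)
  moreover have "generic ?I (\<lambda>a :: nat \<times> 'v \<Rightarrow> 'k. \<forall>i. int (hilb (face_ideal new_star a d) i) \<le> fps_nth (hpoly d new_star) i)"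
    using generic_hilb_le_hpoly[OF inf sc_new_star rank_new_star a2] by (rule generic_mono) (use V in auto)
  moreover have "generic ?I (\<lambda>a :: nat \<times> 'v \<Rightarrow> 'k. hilb (face_ideal \<Delta> a d) i = h_prime TYPE('k) \<Delta> i)"
    using generic_h_prime[OF inf sc] unfolding rank by (rule generic_mono) (use V in auto)
  moreover have "generic ?I (\<lambda>a :: nat \<times> 'v \<Rightarrow> 'k. hilb (face_ideal ?\<Gamma> a d) i = h_prime TYPE('k) ?\<Gamma> i)"
    using generic_h_prime[OF inf sc_stellar] unfolding rank_stellar by (rule generic_mono) (use V in auto)
  ultimately have "generic ?I (\<lambda>a :: nat \<times> 'v \<Rightarrow> 'k.
      ((\<forall>i. int (hilb (face_ideal star a d) i) \<le> fps_nth (hpoly d star) i) \<and>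
       (\<forall>i. int (hilb (face_ideal new_star a d) i) \<le> fps_nth (hpoly d new_star) i)) \<and>
      hilb (face_ideal \<Delta> a d) i = h_prime TYPE('k) \<Delta> i \<and>
      hilb (face_ideal ?\<Gamma> a d) i = h_prime TYPE('k) ?\<Gamma> i)"
    by (intro generic_conj[OF inf])
  from generic_exists[OF this] obtain a :: "nat \<times> 'v \<Rightarrow> 'k" where
    le1: "\<And>i. int (hilb (face_ideal star a d) i) \<le> fps_nth (hpoly d star) i" and
    le2: "\<And>i. int (hilb (face_ideal new_star a d) i) \<le> fps_nth (hpoly d new_star) i" and
    hp: "hilb (face_ideal \<Delta> a d) i = h_prime TYPE('k) \<Delta> i"
      "hilb (face_ideal ?\<Gamma> a d) i = h_prime TYPE('k) ?\<Gamma> i"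
    by blast
  define \<theta> where "\<theta> = linear_form_on W a"
  have \<theta>: "\<theta> j \<in> homogeneous_part 1" for j
    unfolding \<theta>_def by (rule linear_form_on_homogeneous)
  have ext: "face_ideal K a d = extend_ideal (nonface_ideal K) \<theta> d"
    if "simplicial_complex K" "vertices K \<subseteq> W" for K
    unfolding \<theta>_def
    by (rule extend_linear_form_on[OF simplicial_complex_subset_closed[OF that(1)] finW that(2), symmetric])
  have nf: "mr.subspace (nonface_ideal K :: ('v, 'k) mpoly set)" "graded (nonface_ideal K :: ('v, 'k) mpoly set)"
      "fin_hilb (nonface_ideal K :: ('v, 'k) mpoly set)" if "simplicial_complex K" for K
    by (intro ideal_nonface_ideal graded_nonface_ideal fin_hilb_nonface_ideal finite_vertices
        simplicial_complex_subset_closed that)+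
  \<comment> \<open>At the chosen point the bound forces both equality and regularity; this is
    applied to each of the two stars.\<close>
  have crit: "int (hilb (face_ideal K a d) i) = fps_nth (hpoly d K) i \<and> regular_on (nonface_ideal K) \<theta> d"
    if K: "simplicial_complex K" "sc_rank K = d" "vertices K \<subseteq> W"
      and le: "\<And>i. int (hilb (face_ideal K a d) i) \<le> fps_nth (hpoly d K) i" for K
  proof -
    have H: "hseries (nonface_ideal K :: ('v, 'k) mpoly set) = geom ^ d * hpoly d K"
      using card_le_sc_rank[OF K(1)] K(2) by (intro hseries_nonface_ideal[OF K(1)]) simp
    have "hseries (extend_ideal (nonface_ideal K) \<theta> d) = hpoly d K" "regular_on (nonface_ideal K) \<theta> d"
      by (rule hilbert_criterion[OF nf[OF K(1)] \<theta> H le[unfolded ext[OF K(1,3)]]])+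
    then show ?thesis
      unfolding ext[OF K(1,3)] by (simp add: hseries_def fps_eq_iff)
  qed
  note star = crit[OF sc_star rank_star V(2) le1] and new_star = crit[OF sc_new_star rank_new_star V(3) le2]
  let ?N = "\<lambda>K. nonface_ideal K :: ('v, 'k) mpoly set"
  \<comment> \<open>The correction term of \<open>hilb_glue\<close>. It is taken at
    \<open>bdry\<close> in both gluings, so subtracting them removes it together with the terms of
    the deletion and of \<open>bdry\<close>.\<close>
  let ?Q = "\<lambda>K. quot_dim (?N K \<inter> extend_ideal (?N deletion) \<theta> d \<inter> homogeneous_part i)
      (sum_set (?N deletion) (mult_ideal (?N K) \<theta> d) \<inter> homogeneous_part i)"
  note cl = simplicial_complex_subset_closed
  have "hilb (extend_ideal (?N deletion \<inter> ?N star) \<theta> d) i + hilb (extend_ideal (?N bdry) \<theta> d) i =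
      hilb (extend_ideal (?N deletion) \<theta> d) i + hilb (extend_ideal (?N star) \<theta> d) i + ?Q bdry"
  proof (rule hilb_glue)
    show "fin_hilb (?N deletion \<inter> ?N star)"
      using nf(3)[OF sc] complex_eq by (simp flip: nonface_ideal_Un)
    show "?N bdry = sum_set (?N deletion) (?N star)"
      using nonface_ideal_Int[OF cl[OF sc_deletion] cl[OF sc_star]] by (simp add: deletion_Int_star)
  qed (use star in \<open>auto intro: nf sc_deletion sc_star simp: \<theta>[simplified]\<close>)
  moreover have "hilb (extend_ideal (?N deletion \<inter> ?N new_star) \<theta> d) i + hilb (extend_ideal (?N bdry) \<theta> d) i =
      hilb (extend_ideal (?N deletion) \<theta> d) i + hilb (extend_ideal (?N new_star) \<theta> d) i + ?Q bdry"
  proof (rule hilb_glue)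
    show "fin_hilb (?N deletion \<inter> ?N new_star)"
      using nf(3)[OF sc_stellar] stellar_eq by (simp flip: nonface_ideal_Un)
    show "?N bdry = sum_set (?N deletion) (?N new_star)"
      using nonface_ideal_Int[OF cl[OF sc_deletion] cl[OF sc_new_star]] by (simp add: deletion_Int_new_star)
  qed (use new_star in \<open>auto intro: nf sc_deletion sc_new_star simp: \<theta>[simplified]\<close>)
  moreover have "extend_ideal (?N deletion \<inter> ?N star) \<theta> d = face_ideal \<Delta> a d"
    using ext[OF sc V(1)] complex_eq by (simp flip: nonface_ideal_Un)
  moreover have "extend_ideal (?N deletion \<inter> ?N new_star) \<theta> d = face_ideal ?\<Gamma> a d"
    using ext[OF sc_stellar V(4)] stellar_eq by (simp flip: nonface_ideal_Un)
  moreover note ext[OF sc_star V(2)] ext[OF sc_new_star V(3)]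
  ultimately have "int (hilb (face_ideal ?\<Gamma> a d) i) - int (hilb (face_ideal \<Delta> a d) i) =
      int (hilb (face_ideal new_star a d) i) - int (hilb (face_ideal star a d) i)"
    by simp
  then have diff: "int (h_prime TYPE('k) ?\<Gamma> i) - int (h_prime TYPE('k) \<Delta> i) =
      fps_nth (hpoly d new_star) i - fps_nth (hpoly d star) i"
    using hp star new_star by simp
  have fin: "finite deletion" "finite star" "finite new_star"
    using sc_deletion sc_star sc_new_star by (auto simp: simplicial_complex_def)
  \<comment> \<open>The same two gluings on the level of faces, all counted with the exponent
    d.\<close>
  have "hpoly d \<Delta> + hpoly d bdry = hpoly d deletion + hpoly d star"
    using hpoly_Un_Int[OF fin(1,2), of d] complex_eq deletion_Int_star by simp
  moreover have "hpoly d ?\<Gamma> + hpoly d bdry = hpoly d deletion + hpoly d new_star"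
    using hpoly_Un_Int[OF fin(1,3), of d] stellar_eq deletion_Int_new_star by simp
  ultimately have "(hpoly d ?\<Gamma> + hpoly d bdry) - (hpoly d \<Delta> + hpoly d bdry) =
      (hpoly d deletion + hpoly d new_star) - (hpoly d deletion + hpoly d star)"
    by (simp only:)
  then have "hpoly d ?\<Gamma> - hpoly d \<Delta> = hpoly d new_star - hpoly d star"
    by (simp only: add_diff_cancel_left add_diff_cancel_right)
  then have "fps_nth (hpoly d ?\<Gamma>) i - fps_nth (hpoly d \<Delta>) i =
      fps_nth (hpoly d new_star) i - fps_nth (hpoly d star) i"
    by (metis fps_sub_nth)
  then show ?thesis
    using diff by (simp add: h_num_eq_hpoly[OF sc] h_num_eq_hpoly[OF sc_stellar] rank rank_stellar)
qed

end

theorem theorem7p2: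
  fixes \<Delta> \<Gamma> :: "'v set set" and F :: "'v set" and \<rho> :: 'v and d :: nat
  assumes "infinite (UNIV :: 'k::field set)"
    and "simplicial_complex \<Delta>"
    and "sc_dim \<Delta> = int d - 1"
    and "F \<in> \<Delta>"
    and "face_dim F > 0"
    and "\<rho> \<notin> vertices \<Delta>"
    and "\<Gamma> = stellar \<Delta> F \<rho>"
    and "cohen_macaulay TYPE('k) (link \<Delta> F)"
    and "sc_dim (link \<Delta> F) = int d - 1 - int (card F)"
  shows "\<forall>i. int (h_prime TYPE('k) \<Gamma> i) - h_num \<Gamma> i = int (h_prime TYPE('k) \<Delta> i) - h_num \<Delta> i"
proof -
  interpret stellar_subdivision \<Delta> F \<rho> d
    using assms(2-6,9) simplicial_complex_link[OF assms(2,4)]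
    by unfold_locales (simp_all add: sc_dim_def face_dim_def)
  show ?thesis
    unfolding assms(7) using h_prime_difference[OF assms(1,8)] by blast
qed

end
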